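(* Let $p\neq q$ be odd primes, $P$ a finite $p$-group and $Q$ a finite $q$-group acting on $P$; identify $P$ and $Q$ with their images in the semidirect product $QP=Q\ltimes P$. Let $\mathcal{T}$ be a finite-dimensional right $\mathbb{Z}_q[QP]$-module on which $P$ acts faithfully. Then there exists $\tau\in\mathcal{T}$ whose stabilizer $(QP)(\tau)$ in $QP$ equals $Q$.
   Context: $\mathbb{Z}_q$ denotes the field with $q$ elements. *)

theory Defs
  imports "HOL-Algebra.Algebra" "HOL-Number_Theory.Residues"
begin

definition fin_dim_module :: "('r, 'c) ring_scheme \<Rightarrow> ('r, 'v, 'd) module_scheme \<Rightarrow> bool" where
  "fin_dim_module R M \<longleftrightarrow>
     (\<exists>S. finite S \<and> S \<subseteq> carrier M \<and>
        (\<forall>v\<in>carrier M. \<exists>c. c \<in> S \<rightarrow> carrier R \<and>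
            v = (\<Oplus>\<^bsub>M\<^esub>s\<in>S. c s \<odot>\<^bsub>M\<^esub> s)))"

text \<open>A right linear action of the group G on the R-module M (i.e. a right R[G]-module structure):
  v \<mapsto> act v g.\<close>
definition right_linear_action ::
  "('g, 'e) monoid_scheme \<Rightarrow> ('r, 'c) ring_scheme \<Rightarrow> ('r, 'v, 'd) module_scheme \<Rightarrow> ('v \<Rightarrow> 'g \<Rightarrow> 'v) \<Rightarrow> bool" where
  "right_linear_action G R M act \<longleftrightarrow>
     (\<forall>g\<in>carrier G. \<forall>v\<in>carrier M. act v g \<in> carrier M) \<and>
     (\<forall>v\<in>carrier M. act v \<one>\<^bsub>G\<^esub> = v) \<and>
     (\<forall>g\<in>carrier G. \<forall>h\<in>carrier G. \<forall>v\<in>carrier M. act v (g \<otimes>\<^bsub>G\<^esub> h) = act (act v g) h) \<and>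
     (\<forall>g\<in>carrier G. \<forall>v\<in>carrier M. \<forall>w\<in>carrier M. act (v \<oplus>\<^bsub>M\<^esub> w) g = act v g \<oplus>\<^bsub>M\<^esub> act w g) \<and>
     (\<forall>g\<in>carrier G. \<forall>a\<in>carrier R. \<forall>v\<in>carrier M. act (a \<odot>\<^bsub>M\<^esub> v) g = a \<odot>\<^bsub>M\<^esub> act v g)"

definition acts_faithfully ::
  "('g, 'e) monoid_scheme \<Rightarrow> 'g set \<Rightarrow> ('r, 'v, 'd) module_scheme \<Rightarrow> ('v \<Rightarrow> 'g \<Rightarrow> 'v) \<Rightarrow> bool" where
  "acts_faithfully G H M act \<longleftrightarrow>
     (\<forall>g\<in>H. (\<forall>v\<in>carrier M. act v g = v) \<longrightarrow> g = \<one>\<^bsub>G\<^esub>)"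

definition stabilizer_in :: "('g, 'e) monoid_scheme \<Rightarrow> ('v \<Rightarrow> 'g \<Rightarrow> 'v) \<Rightarrow> 'v \<Rightarrow> 'g set" where
  "stabilizer_in G act v = {g \<in> carrier G. act v g = v}"

end

theory Submission
  imports Defs
begin

text \<open>
  Since \<open>G = QP\<close>, it suffices to find a \<open>Q\<close>-fixed vector \<open>v\<close> such that every \<open>g \<in> P\<close> with
  \<open>g v = v\<close> acts trivially. In this form the claim is proved for all submodules \<open>U\<close> by induction on
  \<open>|U|\<close>. If \<open>U\<close> has a proper submodule \<open>W \<noteq> 0\<close> with kernel \<open>K\<close> in \<open>P\<close>, then either a
  vector for \<open>W\<close> already works, or \<open>U\<close> is the direct sum of the proper submodules \<open>C\<^sub>U(K)\<close> and \<open>ker tr\<^sub>K\<close>.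

  Let \<open>U\<close> be irreducible. If some abelian \<open>B \<le> P\<close> normalized by \<open>QP\<close> contains an element that
  acts nontrivially but has a nonzero fixed vector, then \<open>U\<close> decomposes into blocks permuted by
  \<open>QP\<close>. Either \<open>P\<close> fixes every block, and one sums the \<open>Q\<close>-conjugates of a vector obtained by
  induction, or \<open>P\<close> permutes the blocks transitively, and then \<open>Q\<close> fixes a block. There one takes
  the vector \<open>w\<close> given by induction with sign \<open>-1\<close> and on all other blocks \<open>P\<close>-translates of \<open>w\<close>
  with sign \<open>+1\<close>; as \<open>|P|\<close> and \<open>q\<close> are odd, \<open>w\<close> and \<open>-w\<close> lie in different \<open>P\<close>-orbits.

  If there is no such \<open>B\<close>, then every nonzero \<open>Q\<close>-fixed vector \<open>w\<close> works. Take \<open>A\<close> maximal among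
  the abelian subgroups of \<open>P\<close> normalized by \<open>QP\<close> and \<open>K = C\<^sub>P(A)\<close>. All such subgroups are cyclic,
  and \<open>[K, P] \<le> A\<close>. Hence \<open>C\<^sub>K(w) A\<close> is abelian and normalized by \<open>QP\<close>, which forces
  \<open>C\<^sub>K(w) = 1\<close>. An element of order \<open>p\<close> in \<open>C\<^sub>P(w)\<close> could be corrected by an element of \<open>K\<close> so as
  to generate, with the elements of order \<open>p\<close> of \<open>A\<close>, a noncyclic abelian subgroup normalized by
  \<open>QP\<close>; this is where \<open>p\<close> must be odd.
\<close>

section \<open>Actions of finite p-groups\<close>

text \<open>Everything takes place over \<open>Z_q\<close> itself, with no extension to a field in
  which abelian groups have eigenvectors. Traces \<open>tr H\<close> replace projections: on
  \<open>H\<close>-fixed vectors they are invertible when \<open>q\<close> does not divide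
  \<open>card H\<close>. Characters are replaced by one device: a sum that is fixed by an element
  without nonzero fixed vectors is zero. It yields the cyclicity of the good subgroups and also
  \<open>twisted_complement\<close>, which plays the role of nondegeneracy of the commutator pairing
  on \<open>Y\<close> modulo its centre \<open>A\<close>: a map \<open>y \<mapsto> [y, k]\<close>
  into \<open>A\<close> is already induced by an element of \<open>Y\<close>.

  Regularity is formulated modulo the kernel of \<open>P\<close> because submodules and blocks need
  not be faithful, and \<open>P\<close> and \<open>Q\<close> vary in the induction because a block
  is in general invariant only under smaller subgroups. The two primes act differently:
  \<open>p\<close>-subgroups allow averaging, while \<open>q\<close>-subgroups always have nonzero
  fixed vectors. Fixed-point-freeness is a condition on elements different from
  \<open>\<one>\<close>, so the irreducible case works with the group of permutations induced on
  \<open>U\<close>.\<close>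

lemma (in group) subgroup_card_dvd:
  assumes "subgroup H G" "subgroup K G" "H \<subseteq> K"
  shows "card H dvd card K"
proof -
  have "subgroup H (G\<lparr>carrier := K\<rparr>)" using assms by (simp add: subgroup_incl)
  from group.lagrange[OF subgroup_imp_group[OF assms(2)] this] show ?thesis
    by (simp add: order_def) (metis dvd_triv_right)
qed

text \<open>\<open>group_action\<close> wants permutations that are extensional on \<open>E\<close>,
  hence \<open>restrict\<close>. The hypotheses are pointwise so that later uses only check the laws
  of an action.\<close>

lemma (in group) subgroup_action:
  assumes P: "subgroup P G"
    and cl: "\<And>g e. g \<in> P \<Longrightarrow> e \<in> E \<Longrightarrow> f g e \<in> E"
    and one: "\<And>e. e \<in> E \<Longrightarrow> f \<one> e = e"
    and mult: "\<And>g h e. g \<in> P \<Longrightarrow> h \<in> P \<Longrightarrow> e \<in> E \<Longrightarrow> f (g \<otimes> h) e = f g (f h e)"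
  shows "group_action (G\<lparr>carrier := P\<rparr>) E (\<lambda>g. restrict (f g) E)"
proof -
  define H where "H = G\<lparr>carrier := P\<rparr>"
  define \<phi> where "\<phi> = (\<lambda>g. restrict (f g) E)"
  interpret H: group H
    unfolding H_def using P by (rule subgroup_imp_group)
  have cH: "carrier H = P" "monoid.mult H = monoid.mult G" "one H = one G" by (simp_all add: H_def)
  have invP: "inv g \<in> P" if "g \<in> P" for g using P that by (rule subgroup.m_inv_closed)
  have Psub: "g \<in> carrier G" if "g \<in> P" for g using P that by (rule subgroup.mem_carrier)
  have f_inv: "f (inv g) (f g e) = e" "f g (f (inv g) e) = e" if "g \<in> P" "e \<in> E" for g e
    using mult[OF invP[OF that(1)] that] mult[OF that(1) invP[OF that(1)] that(2)] one[OF that(2)] Psub[OF that(1)]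
    by simp_all
  have bij: "bij_betw (f g) E E" if "g \<in> P" for g
    by (rule bij_betw_byWitness[where f' = "f (inv g)"]) (use that f_inv cl invP in auto)
  have inBij: "\<phi> g \<in> Bij E" if "g \<in> P" for g
    using bij[OF that] by (simp add: \<phi>_def Bij_def bij_betw_cong[of E "restrict (f g) E" "f g"])
  have hom: "\<phi> \<in> hom H (BijGroup E)"
  proof (rule homI)
    fix x assume "x \<in> carrier H"
    then show "\<phi> x \<in> carrier (BijGroup E)"
      using inBij by (simp add: cH BijGroup_def)
  next
    fix x y assume "x \<in> carrier H" "y \<in> carrier H"
    then show "\<phi> (x \<otimes>\<^bsub>H\<^esub> y) = \<phi> x \<otimes>\<^bsub>BijGroup E\<^esub> \<phi> y"
      using inBij[of x] inBij[of y] mult[of x y] cl[of y]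
      by (simp add: cH BijGroup_def) (auto simp: \<phi>_def compose_def)
  qed
  show ?thesis
    unfolding H_def[symmetric] \<phi>_def[symmetric] group_action_def group_hom_def group_hom_axioms_def
    using hom H.is_group group_BijGroup by blast
qed

lemma (in group) orbit_card_dvd:
  assumes P: "subgroup P G"
    and cl: "\<And>g e. g \<in> P \<Longrightarrow> e \<in> E \<Longrightarrow> f g e \<in> E"
    and one: "\<And>e. e \<in> E \<Longrightarrow> f \<one> e = e"
    and mult: "\<And>g h e. g \<in> P \<Longrightarrow> h \<in> P \<Longrightarrow> e \<in> E \<Longrightarrow> f (g \<otimes> h) e = f g (f h e)"
    and e: "e \<in> E"
  shows "card ((\<lambda>g. f g e) ` P) dvd card P"
proof -
  interpret group_action "G\<lparr>carrier := P\<rparr>" E "\<lambda>g. restrict (f g) E"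
    using subgroup_action[OF P cl one mult] .
  have "orbit (G\<lparr>carrier := P\<rparr>) (\<lambda>g. restrict (f g) E) e = (\<lambda>g. f g e) ` P"
    using e by (auto simp: orbit_def)
  with orbit_stabilizer_theorem[OF e] show ?thesis
    by (simp add: order_def) (metis dvd_triv_left)
qed

text \<open>The orbits have \<open>p\<close>-power length, and those of length one are the fixed
  points; all others contribute multiples of \<open>p\<close>.\<close>

lemma (in group) p_group_fixed_points:
  fixes p a :: nat
  assumes P: "subgroup P G" and card: "card P = p ^ a" and p: "Factorial_Ring.prime p" and fin: "finite E"
    and cl: "\<And>g e. g \<in> P \<Longrightarrow> e \<in> E \<Longrightarrow> f g e \<in> E"
    and one: "\<And>e. e \<in> E \<Longrightarrow> f \<one> e = e"
    and mult: "\<And>g h e. g \<in> P \<Longrightarrow> h \<in> P \<Longrightarrow> e \<in> E \<Longrightarrow> f (g \<otimes> h) e = f g (f h e)"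
  shows "[card {e \<in> E. \<forall>g\<in>P. f g e = e} = card E] (mod p)"
proof -
  define H where "H = G\<lparr>carrier := P\<rparr>"
  define \<phi> where "\<phi> = (\<lambda>g. restrict (f g) E)"
  have cH: "carrier H = P" by (simp add: H_def)
  interpret group_action H E \<phi>
    unfolding H_def \<phi>_def using subgroup_action[OF P cl one mult] .
  let ?F = "{e \<in> E. \<forall>g\<in>P. f g e = e}"
  have orb: "orbit H \<phi> e = (\<lambda>g. f g e) ` P" if "e \<in> E" for e
    using that unfolding orbit_def by (auto simp: cH \<phi>_def)
  let ?C = "{ob \<in> orbits H E \<phi>. \<not> (\<exists>e\<in>?F. ob = {e})}"
  have oneP: "\<one> \<in> P" using P by (rule subgroup.one_closed)
  have self: "e \<in> orbit H \<phi> e" if "e \<in> E" for e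
    using orb[OF that] one[OF that] oneP by force
  have disj: "o1 \<inter> o2 = {}" if "o1 \<in> orbits H E \<phi>" "o2 \<in> orbits H E \<phi>" "o1 \<noteq> o2" for o1 o2
    using that orbit_partition by (auto simp: partition_def)
  have un: "\<Union>?C = E - ?F"
  proof (intro equalityI subsetI)
    fix e assume "e \<in> \<Union>?C"
    then obtain e' where e': "e' \<in> E" "e \<in> orbit H \<phi> e'" "\<not> (\<exists>e\<in>?F. orbit H \<phi> e' = {e})"
      by (auto simp: orbits_def)
    have eE: "e \<in> E" using e' orb[OF e'(1)] cl by auto
    moreover have "e \<notin> ?F"
    proof
      assume F: "e \<in> ?F"
      have "orbit H \<phi> e = {e}" using orb[OF eE] F oneP by force
      moreover have "orbit H \<phi> e = orbit H \<phi> e'"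
        using disj[of "orbit H \<phi> e" "orbit H \<phi> e'"] e' self[OF eE] eE by (force simp: orbits_def)
      ultimately show False using e' F by auto
    qed
    ultimately show "e \<in> E - ?F" by auto
  next
    fix e assume e: "e \<in> E - ?F"
    then have "orbit H \<phi> e \<in> orbits H E \<phi>" by (auto simp: orbits_def)
    moreover have "\<not> (\<exists>e'\<in>?F. orbit H \<phi> e = {e'})"
      using self[of e] e by auto
    ultimately show "e \<in> \<Union>?C" using self e by blast
  qed
  have dvd: "p dvd card o'" if "o' \<in> ?C" for o'
  proof -
    from that obtain e where e: "e \<in> E" "o' = orbit H \<phi> e" "\<not> (\<exists>e\<in>?F. o' = {e})"
      by (auto simp: orbits_def)
    have "card o' dvd p ^ a"
      using orbit_card_dvd[OF P cl one mult e(1)] card orb[OF e(1)] by (simp add: e(2))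
    then obtain i where i: "card o' = p ^ i" using p by (auto simp: divides_primepow_nat)
    have "i \<noteq> 0"
    proof
      assume "i = 0"
      then have "card o' = 1" using i by simp
      then obtain e1 where "o' = {e1}" by (auto simp: card_1_singleton_iff)
      with self[OF e(1)] e(2) have oe: "o' = {e}" by (metis singletonD)
      then have "e \<in> ?F" using e orb[OF e(1)] by auto
      then show False using e oe by auto
    qed
    then show ?thesis using i by simp
  qed
  have "p dvd card (\<Union>?C)"
    by (rule dvd_partition) (use dvd disj un fin in \<open>auto\<close>)
  then obtain k where "card (E - ?F) = p * k" unfolding un by blast
  moreover have "card E = card ?F + card (E - ?F)"
    using fin by (simp add: card_Diff_subset card_mono)
  ultimately have "card E = card ?F + p * k" by simp
  then show ?thesis by (simp add: cong_def)
qed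

lemma (in group) p_group_acts_fixed_point:
  fixes b q :: nat
  assumes Q: "subgroup Q G" "card Q = q ^ b" and q: "Factorial_Ring.prime q" and fin: "finite E"
    and "\<not> q dvd card E"
    and "\<And>g e. g \<in> Q \<Longrightarrow> e \<in> E \<Longrightarrow> f g e \<in> E"
    and "\<And>e. e \<in> E \<Longrightarrow> f \<one> e = e"
    and "\<And>g h e. g \<in> Q \<Longrightarrow> h \<in> Q \<Longrightarrow> e \<in> E \<Longrightarrow> f (g \<otimes> h) e = f g (f h e)"
  obtains e where "e \<in> E" "\<And>g. g \<in> Q \<Longrightarrow> f g e = e"
proof -
  have "[card {e \<in> E. \<forall>g\<in>Q. f g e = e} = card E] (mod q)"
    by (rule p_group_fixed_points[where f = f]) (use assms in blast)+
  then have "\<not> q dvd card {e \<in> E. \<forall>g\<in>Q. f g e = e}"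
    using assms(5) cong_dvd_iff by blast
  then have "{e \<in> E. \<forall>g\<in>Q. f g e = e} \<noteq> {}"
    by (metis card.empty dvd_0_right)
  then show ?thesis using that by blast
qed

lemma (in group) inv_cancel_simps:
  assumes "x \<in> carrier G" "y \<in> carrier G"
  shows "inv x \<otimes> (x \<otimes> y) = y" "x \<otimes> (inv x \<otimes> y) = y"
  using assms by (simp_all flip: m_assoc)

lemmas (in group) grp_simps = m_assoc inv_mult_group inv_cancel_simps

lemma (in group) rcos_eq_iff:
  assumes "subgroup A G" "x \<in> carrier G" "y \<in> carrier G"
  shows "A #> x = A #> y \<longleftrightarrow> x \<otimes> inv y \<in> A"
proof
  assume "A #> x = A #> y"
  then have "x \<in> A #> y" using rcos_self[OF assms(2,1)] by simp
  then show "x \<otimes> inv y \<in> A"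
    using subgroup.rcos_module[OF assms(1) is_group assms(3,2)] by simp
next
  assume "x \<otimes> inv y \<in> A"
  then have "x \<in> A #> y"
    using subgroup.rcos_module[OF assms(1) is_group assms(3,2)] by simp
  then show "A #> x = A #> y" using repr_independence[OF _ assms(3,1)] by simp
qed

text \<open>A nontrivial normal subgroup \<open>D/A\<close> of the \<open>p\<close>-group
  \<open>P/A\<close> meets its centre. Without quotient groups: \<open>P\<close> permutes the cosets
  of \<open>A\<close> in \<open>D\<close> by conjugation, their number is divisible by
  \<open>p\<close>, hence so is the number of fixed cosets; \<open>A\<close> is one of them, so
  there is another.\<close>

lemma (in group) p_group_central_element:
  fixes p a :: nat
  assumes P: "subgroup P G" "card P = p ^ a" and p: "Factorial_Ring.prime p"
    and D: "subgroup D G" "D \<subseteq> P" and A: "subgroup A G" "A \<subseteq> D" "A \<noteq> D"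
    and nD: "\<And>g d. g \<in> P \<Longrightarrow> d \<in> D \<Longrightarrow> g \<otimes> d \<otimes> inv g \<in> D"
    and nA: "\<And>g d. g \<in> P \<Longrightarrow> d \<in> A \<Longrightarrow> g \<otimes> d \<otimes> inv g \<in> A"
  obtains d where "d \<in> D" "d \<notin> A" "\<And>g. g \<in> P \<Longrightarrow> g \<otimes> d \<otimes> inv g \<otimes> inv d \<in> A"
proof -
  have Pc: "g \<in> carrier G" if "g \<in> P" for g using that by (rule subgroup.mem_carrier[OF P(1)])
  have Dc: "g \<in> carrier G" if "g \<in> D" for g using that by (rule subgroup.mem_carrier[OF D(1)])
  have Ac: "g \<in> carrier G" if "g \<in> A" for g using that by (rule subgroup.mem_carrier[OF A(1)])
  have "card P > 0" using P p by (simp add: prime_gt_0_nat)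
  then have finP: "finite P" by (simp add: card_gt_0_iff)
  then have finD: "finite D" "finite A" using D A by (meson finite_subset)+
  define H where "H = G\<lparr>carrier := D\<rparr>"
  interpret H: group H unfolding H_def using D by (intro subgroup_imp_group)
  define E where "E = (\<lambda>d. A #> d) ` D"
  define f where "f = (\<lambda>g C. (\<lambda>x. g \<otimes> x \<otimes> inv g) ` C)"
  have fA: "f g (A #> d) = A #> (g \<otimes> d \<otimes> inv g)" if g: "g \<in> P" and d: "d \<in> D" for g d
  proof (intro equalityI subsetI)
    fix x assume "x \<in> f g (A #> d)"
    then obtain a where a: "a \<in> A" "x = g \<otimes> (a \<otimes> d) \<otimes> inv g" by (auto simp: f_def r_coset_def)
    then have "x = (g \<otimes> a \<otimes> inv g) \<otimes> (g \<otimes> d \<otimes> inv g)" using Pc[OF g] Dc[OF d] Ac[OF a(1)] by (simp add: grp_simps)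
    then show "x \<in> A #> (g \<otimes> d \<otimes> inv g)" using nA[OF g a(1)] by (auto simp: r_coset_def)
  next
    fix x assume "x \<in> A #> (g \<otimes> d \<otimes> inv g)"
    then obtain a where a: "a \<in> A" "x = a \<otimes> (g \<otimes> d \<otimes> inv g)" by (auto simp: r_coset_def)
    have g': "inv g \<in> P" using g by (rule subgroup.m_inv_closed[OF P(1)])
    from a have "x = g \<otimes> ((inv g \<otimes> a \<otimes> inv (inv g)) \<otimes> d) \<otimes> inv g" using Pc[OF g] Dc[OF d] Ac[OF a(1)] by (simp add: grp_simps)
    then show "x \<in> f g (A #> d)" using nA[OF g' a(1)] by (auto simp: f_def r_coset_def)
  qed
  have cong: "[card {e \<in> E. \<forall>g\<in>P. f g e = e} = card E] (mod p)"
  proof (rule p_group_fixed_points[OF P p])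
    show "finite E" unfolding E_def using finD by simp
    show "f g e \<in> E" if "g \<in> P" "e \<in> E" for g e using that fA nD by (auto simp: E_def)
    show "f \<one> e = e" if "e \<in> E" for e
      using that P(1) subgroup.one_closed[OF P(1)] fA[of \<one>] Dc by (auto simp: E_def)
    show "f (g \<otimes> h) e = f g (f h e)" if "g \<in> P" "h \<in> P" "e \<in> E" for g h e
      using that fA nD Pc Dc subgroup.m_closed[OF P(1)] by (auto simp: E_def grp_simps)
  qed
  have EH: "E = rcosets\<^bsub>H\<^esub> A" by (auto simp: E_def RCOSETS_def H_def r_coset_def)
  have "subgroup A H" unfolding H_def using A D by (simp add: subgroup_incl)
  from H.lagrange[OF this] have lag: "card E * card A = card D" by (simp add: EH order_def H_def)
  have "card D dvd p ^ a" using subgroup_card_dvd[OF D(1) P(1) D(2)] P(2) by simp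
  then have "card E dvd p ^ a" using lag dvd_trans by (metis dvd_triv_left)
  then obtain i where i: "card E = p ^ i" using p by (auto simp: divides_primepow_nat)
  have "card E \<noteq> 1" using lag A finD by (metis card_subset_eq mult_1)
  then have "p dvd card E" using i by (cases i) auto
  then have dv: "p dvd card {e \<in> E. \<forall>g\<in>P. f g e = e}" using cong cong_dvd_iff by blast
  have oneD: "\<one> \<in> D" using D subgroup.one_closed by blast
  have A1: "A #> \<one> = A" using A by (simp add: coset_mult_one subgroup.subset)
  have AF: "A \<in> {e \<in> E. \<forall>g\<in>P. f g e = e}"
  proof -
    have "A \<in> E" using oneD A1 unfolding E_def by (metis imageI)
    moreover have "f g A = A" if "g \<in> P" for g using fA[OF that oneD] A1 Pc[OF that] by simp
    ultimately show ?thesis by blast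
  qed
  have "{e \<in> E. \<forall>g\<in>P. f g e = e} \<noteq> {A}" using dv p by (metis card_1_singleton_iff One_nat_def not_prime_1 nat_dvd_1_iff_1)
  then obtain e where e: "e \<in> E" "\<forall>g\<in>P. f g e = e" "e \<noteq> A" using AF by blast
  then obtain d where d: "d \<in> D" "e = A #> d" by (auto simp: E_def)
  have "d \<notin> A" using e d coset_join2[OF Dc[OF d(1)] A(1)] by auto
  moreover have "g \<otimes> d \<otimes> inv g \<otimes> inv d \<in> A" if g: "g \<in> P" for g
  proof -
    have "A #> (g \<otimes> d \<otimes> inv g) = A #> d" using e d fA[OF g d(1)] g by auto
    then show ?thesis using rcos_eq_iff[OF A(1)] Pc[OF g] Dc[OF d(1)] by simp
  qed
  ultimately show ?thesis using that d by blast
qed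

section \<open>Linear actions on elementary abelian groups\<close>

lemma (in abelian_monoid) finsum_swap:
  assumes "finite A" "finite B" "\<And>a b. a \<in> A \<Longrightarrow> b \<in> B \<Longrightarrow> f a b \<in> carrier G"
  shows "(\<Oplus>a\<in>A. \<Oplus>b\<in>B. f a b) = (\<Oplus>b\<in>B. \<Oplus>a\<in>A. f a b)"
  using assms(1,3)
proof (induction A rule: finite_induct)
  case empty
  then show ?case by simp
next
  case (insert x A)
  have "(\<Oplus>a\<in>insert x A. \<Oplus>b\<in>B. f a b) = (\<Oplus>b\<in>B. f x b) \<oplus> (\<Oplus>b\<in>B. \<Oplus>a\<in>A. f a b)"
    using insert by (subst finsum_insert) (auto intro!: finsum_closed)
  also have "\<dots> = (\<Oplus>b\<in>B. f x b \<oplus> (\<Oplus>a\<in>A. f a b))"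
    using insert by (intro finsum_addf[symmetric]) (auto intro!: finsum_closed)
  also have "\<dots> = (\<Oplus>b\<in>B. \<Oplus>a\<in>insert x A. f a b)"
    using insert by (intro finsum_cong') (auto intro!: finsum_closed)
  finally show ?case .
qed

definition (in group) normalized_by :: "'a set \<Rightarrow> 'a set \<Rightarrow> bool" where
  "normalized_by S H \<longleftrightarrow> (\<forall>g\<in>S. \<forall>x\<in>H. g \<otimes> x \<otimes> inv g \<in> H)"

lemma (in group) normalized_byD:
  "normalized_by S H \<Longrightarrow> g \<in> S \<Longrightarrow> x \<in> H \<Longrightarrow> g \<otimes> x \<otimes> inv g \<in> H"
  by (simp add: normalized_by_def)

lemma (in group) normalized_by_inv:
  assumes "subgroup P G" "subgroup Q G" "normalized_by (P \<union> Q) H" "g \<in> P \<union> Q" "x \<in> H"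
  shows "inv g \<otimes> x \<otimes> g \<in> H"
proof -
  have "inv g \<in> P \<union> Q" "g \<in> carrier G"
    using assms(1,2,4) by (auto dest: subgroup.m_inv_closed subgroup.mem_carrier)
  then show ?thesis using normalized_byD[OF assms(3) _ assms(5), of "inv g"] by simp
qed

text \<open>This is the preimage of the part of \<open>K/N\<close> that is central in
  \<open>P/N\<close>. Products stay inside because \<open>[g, m k] = [g, m] (m [g, k] m^-1)\<close>
  and \<open>P\<close> normalizes \<open>N\<close>.\<close>

lemma (in group) commutator_preimage_subgroup:
  assumes P: "subgroup P G" and K: "subgroup K G" "K \<subseteq> P" and N: "subgroup N G" "normalized_by P N"
  shows "subgroup {k \<in> K. \<forall>g\<in>P. g \<otimes> k \<otimes> inv g \<otimes> inv k \<in> N} G" (is "subgroup ?M G")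
proof (rule subgroupI)
  note Pc = subgroup.mem_carrier[OF P] and Km = subgroup.m_closed[OF K(1)] and Ki = subgroup.m_inv_closed[OF K(1)]
  note Kc = subgroup.mem_carrier[OF K(1)]
  show "?M \<subseteq> carrier G" using Kc by blast
  have "\<one> \<in> ?M" using Pc subgroup.one_closed[OF K(1)] subgroup.one_closed[OF N(1)] by auto
  then show "?M \<noteq> {}" by blast
  show "inv m \<in> ?M" if m: "m \<in> ?M" for m
  proof -
    have mK: "m \<in> K" "m \<in> P" using m K(2) by auto
    have "g \<otimes> inv m \<otimes> inv g \<otimes> inv (inv m) \<in> N" if g: "g \<in> P" for g
    proof -
      have "inv (g \<otimes> m \<otimes> inv g \<otimes> inv m) \<in> N" using m g subgroup.m_inv_closed[OF N(1)] by blast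
      from normalized_byD[OF N(2) subgroup.m_inv_closed[OF P mK(2)] this]
      show ?thesis using Pc[OF g] Kc[OF mK(1)] by (simp add: grp_simps)
    qed
    then show ?thesis using Ki[OF mK(1)] by blast
  qed
  show "m \<otimes> k \<in> ?M" if m: "m \<in> ?M" and k: "k \<in> ?M" for m k
  proof -
    have mK: "m \<in> K" "k \<in> K" "m \<in> P" using m k K(2) by auto
    have "g \<otimes> (m \<otimes> k) \<otimes> inv g \<otimes> inv (m \<otimes> k) \<in> N" if g: "g \<in> P" for g
    proof -
      have 1: "g \<otimes> m \<otimes> inv g \<otimes> inv m \<in> N" and "g \<otimes> k \<otimes> inv g \<otimes> inv k \<in> N" using m k g by auto
      from subgroup.m_closed[OF N(1) 1 normalized_byD[OF N(2) mK(3) this(2)]]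
      show ?thesis using Pc[OF g] Kc mK by (simp add: grp_simps)
    qed
    then show ?thesis using Km[OF mK(1,2)] by blast
  qed
qed

text \<open>Conjugation moves into the commutator:
  \<open>[g, h m h^-1] = h [h^-1 g h, m] h^-1\<close>.\<close>

lemma (in group) commutator_preimage_normalized:
  assumes P: "subgroup P G" and Q: "subgroup Q G" and K: "subgroup K G"
    and n: "normalized_by (P \<union> Q) P" "normalized_by (P \<union> Q) K" "normalized_by (P \<union> Q) N"
  shows "normalized_by (P \<union> Q) {k \<in> K. \<forall>g\<in>P. g \<otimes> k \<otimes> inv g \<otimes> inv k \<in> N}" (is "normalized_by _ ?M")
  unfolding normalized_by_def
proof (intro ballI)
  fix h m assume h: "h \<in> P \<union> Q" and m: "m \<in> ?M"
  have c: "h \<in> carrier G" "m \<in> carrier G" using h m P Q K by (auto dest: subgroup.mem_carrier)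
  have "g \<otimes> (h \<otimes> m \<otimes> inv h) \<otimes> inv g \<otimes> inv (h \<otimes> m \<otimes> inv h) \<in> N" if g: "g \<in> P" for g
  proof -
    define g' where "g' = inv h \<otimes> g \<otimes> h"
    have "g' \<in> P" unfolding g'_def using normalized_by_inv[OF P Q n(1) h g] .
    then have "g' \<otimes> m \<otimes> inv g' \<otimes> inv m \<in> N" using m by blast
    from normalized_byD[OF n(3) h this] show ?thesis
      unfolding g'_def using c subgroup.mem_carrier[OF P g] by (simp add: grp_simps)
  qed
  then show "h \<otimes> m \<otimes> inv h \<in> ?M" using normalized_byD[OF n(2) h] m by blast
qed

text \<open>Scalars of \<open>Z_q\<close> are repeated additions, so an additive group killed by
  \<open>q\<close> encodes the module: subspaces are additive subgroups and linear maps are additive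
  maps.\<close>

locale lin_action = group G + T: abelian_group T
  for G :: "('g, 'e) monoid_scheme" (structure) and T :: "('v, 'd) ring_scheme" +
  fixes act :: "'g \<Rightarrow> 'v \<Rightarrow> 'v" and q :: nat
  assumes finite_G: "finite (carrier G)" and finite_T: "finite (carrier T)"
    and prime_q: "Factorial_Ring.prime q"
    and q_torsion: "v \<in> carrier T \<Longrightarrow> [q] \<cdot>\<^bsub>T\<^esub> v = \<zero>\<^bsub>T\<^esub>"
    and act_closed [simp, intro]: "g \<in> carrier G \<Longrightarrow> v \<in> carrier T \<Longrightarrow> act g v \<in> carrier T"
    and act_one [simp]: "v \<in> carrier T \<Longrightarrow> act \<one> v = v"
    and act_mult: "g \<in> carrier G \<Longrightarrow> h \<in> carrier G \<Longrightarrow> v \<in> carrier T \<Longrightarrow> act (g \<otimes> h) v = act g (act h v)"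
    and act_add: "g \<in> carrier G \<Longrightarrow> v \<in> carrier T \<Longrightarrow> w \<in> carrier T \<Longrightarrow>
      act g (v \<oplus>\<^bsub>T\<^esub> w) = act g v \<oplus>\<^bsub>T\<^esub> act g w"
begin

lemma act_zero [simp]: "g \<in> carrier G \<Longrightarrow> act g \<zero>\<^bsub>T\<^esub> = \<zero>\<^bsub>T\<^esub>"
  using act_add[of g "\<zero>\<^bsub>T\<^esub>" "\<zero>\<^bsub>T\<^esub>"] act_closed[of g "\<zero>\<^bsub>T\<^esub>"]
  by (metis T.add.r_cancel_one T.add.one_closed T.l_zero)

lemma act_minus: "g \<in> carrier G \<Longrightarrow> v \<in> carrier T \<Longrightarrow> act g (\<ominus>\<^bsub>T\<^esub> v) = \<ominus>\<^bsub>T\<^esub> act g v"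
  by (metis T.minus_equality T.add.inv_closed act_add act_closed act_zero T.l_neg)

lemma act_inv [simp]:
  assumes "g \<in> carrier G" "v \<in> carrier T"
  shows "act (inv g) (act g v) = v" "act g (act (inv g) v) = v"
  using act_mult[of "inv g" g v] act_mult[of g "inv g" v] assms by simp_all

lemma act_inj: "g \<in> carrier G \<Longrightarrow> v \<in> carrier T \<Longrightarrow> w \<in> carrier T \<Longrightarrow> act g v = act g w \<longleftrightarrow> v = w"
  by (metis act_inv(1))

lemma act_inv_fixed: "g \<in> carrier G \<Longrightarrow> v \<in> carrier T \<Longrightarrow> act g v = v \<Longrightarrow> act (inv g) v = v"
  by (metis act_inv(1))

lemma act_sum:
  assumes "g \<in> carrier G" "\<And>i. i \<in> I \<Longrightarrow> f i \<in> carrier T"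
  shows "act g (\<Oplus>\<^bsub>T\<^esub>i\<in>I. f i) = (\<Oplus>\<^bsub>T\<^esub>i\<in>I. act g (f i))"
  using assms(2)
proof (induction I rule: infinite_finite_induct)
  case (insert x F)
  then show ?case
    using assms(1) by (simp add: T.finsum_insert act_add T.finsum_closed Pi_iff)
qed (simp_all add: assms(1))

text \<open>The substitute for division by \<open>n\<close>: the additive order of \<open>v\<close>
  divides both \<open>q\<close> and \<open>n\<close>, hence is 1.\<close>

lemma coprime_torsion:
  assumes "\<not> q dvd n" "v \<in> carrier T" "[n] \<cdot>\<^bsub>T\<^esub> v = \<zero>\<^bsub>T\<^esub>"
  shows "v = \<zero>\<^bsub>T\<^esub>"
proof -
  have "T.add.ord v dvd q" using T.add.pow_eq_id[OF assms(2)] q_torsion[OF assms(2)] by simp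
  moreover have "T.add.ord v dvd n" using T.add.pow_eq_id[OF assms(2)] assms(3) by simp
  ultimately have "T.add.ord v = 1"
    using prime_q assms(1) by (metis prime_nat_iff)
  then show ?thesis using T.add.ord_eq_1[OF assms(2)] by simp
qed

text \<open>\<open>S\<close> need not be a subgroup. With \<open>P \<union> Q\<close> it expresses
  invariance under the generated group, with \<open>{}\<close> it leaves a bare additive
  subgroup.\<close>

definition submod :: "'g set \<Rightarrow> 'v set \<Rightarrow> bool" where
  "submod S W \<longleftrightarrow> W \<subseteq> carrier T \<and> \<zero>\<^bsub>T\<^esub> \<in> W \<and> (\<forall>v\<in>W. \<forall>w\<in>W. v \<oplus>\<^bsub>T\<^esub> w \<in> W) \<and>
     (\<forall>v\<in>W. \<ominus>\<^bsub>T\<^esub> v \<in> W) \<and> (\<forall>g\<in>S. \<forall>v\<in>W. act g v \<in> W)"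

lemma submodI:
  assumes "W \<subseteq> carrier T" "\<zero>\<^bsub>T\<^esub> \<in> W" "\<And>v w. v \<in> W \<Longrightarrow> w \<in> W \<Longrightarrow> v \<oplus>\<^bsub>T\<^esub> w \<in> W"
    "\<And>v. v \<in> W \<Longrightarrow> \<ominus>\<^bsub>T\<^esub> v \<in> W" "\<And>g v. g \<in> S \<Longrightarrow> v \<in> W \<Longrightarrow> act g v \<in> W"
  shows "submod S W"
  using assms by (auto simp: submod_def)

lemma submodD:
  assumes "submod S W"
  shows "v \<in> W \<Longrightarrow> v \<in> carrier T" "\<zero>\<^bsub>T\<^esub> \<in> W" "v \<in> W \<Longrightarrow> w \<in> W \<Longrightarrow> v \<oplus>\<^bsub>T\<^esub> w \<in> W"
    "v \<in> W \<Longrightarrow> \<ominus>\<^bsub>T\<^esub> v \<in> W" "g \<in> S \<Longrightarrow> v \<in> W \<Longrightarrow> act g v \<in> W"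
  using assms by (auto simp: submod_def)

lemma submod_mono: "submod S W \<Longrightarrow> S' \<subseteq> S \<Longrightarrow> submod S' W"
  by (auto simp: submod_def)

lemma submod_finite: "submod S W \<Longrightarrow> finite W"
  using finite_T finite_subset by (auto simp: submod_def)

lemma submod_sum:
  assumes "submod S W" "\<And>i. i \<in> I \<Longrightarrow> f i \<in> W"
  shows "(\<Oplus>\<^bsub>T\<^esub>i\<in>I. f i) \<in> W"
  using assms(2)
proof (induction I rule: infinite_finite_induct)
  case (insert x F)
  then have "f \<in> insert x F \<rightarrow> carrier T" using submodD(1)[OF assms(1)] by blast
  with insert show ?case
    by (subst T.finsum_insert) (auto intro: submodD[OF assms(1)])
qed (simp_all add: submodD(2)[OF assms(1)])

lemma submod_add_pow:
  fixes n :: nat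
  assumes "submod S W" "v \<in> W"
  shows "[n] \<cdot>\<^bsub>T\<^esub> v \<in> W"
proof (induction n)
  case (Suc n)
  then show ?case using submodD[OF assms(1)] assms(2) by (simp add: T.add.nat_pow_Suc)
qed (simp add: submodD(2)[OF assms(1)])

lemma fixed_submod:
  assumes U: "submod S U" and S: "S \<subseteq> carrier G" and K: "K \<subseteq> carrier G"
    and nK: "\<And>g k. g \<in> S \<Longrightarrow> k \<in> K \<Longrightarrow> inv g \<otimes> k \<otimes> g \<in> K"
  shows "submod S {u \<in> U. \<forall>k\<in>K. act k u = u}" (is "submod S ?W")
proof (rule submodI)
  fix g v assume g: "g \<in> S" and v: "v \<in> ?W"
  have vU: "v \<in> U" using v by simp
  have "act k (act g v) = act g v" if k: "k \<in> K" for k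
  proof -
    have c: "g \<in> carrier G" "k \<in> carrier G" using S K g k by auto
    have "act (inv g \<otimes> k \<otimes> g) v = v" using nK[OF g k] v by blast
    then have "act g (act (inv g \<otimes> k \<otimes> g) v) = act g v" by simp
    then show ?thesis using c submodD(1)[OF U vU] by (simp add: act_mult)
  qed
  then show "act g v \<in> ?W" using submodD(5)[OF U g vU] by blast
qed (use submodD(1-4)[OF U] K in \<open>auto simp: act_add act_minus subset_iff\<close>)

lemma submod_subgroup: "submod S W \<Longrightarrow> subgroup W (add_monoid T)"
  by (rule T.add.subgroupI) (auto simp: submod_def a_inv_def)

lemma act_add_pow:
  fixes n :: nat
  assumes "g \<in> carrier G" "v \<in> carrier T"
  shows "act g ([n] \<cdot>\<^bsub>T\<^esub> v) = [n] \<cdot>\<^bsub>T\<^esub> act g v"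
  by (induction n) (simp_all add: assms act_add T.add.nat_pow_Suc)

text \<open>The trace map of \<open>H\<close>. It takes values in the \<open>H\<close>-fixed vectors
  when \<open>H\<close> is a subgroup and multiplies each fixed vector by \<open>card H\<close>, so
  it is an unnormalized averaging projection if \<open>q\<close> does not divide
  \<open>card H\<close>.\<close>

definition tr :: "'g set \<Rightarrow> 'v \<Rightarrow> 'v" where
  "tr H v = (\<Oplus>\<^bsub>T\<^esub>x\<in>H. act x v)"

lemma tr_closed [simp, intro]: "H \<subseteq> carrier G \<Longrightarrow> v \<in> carrier T \<Longrightarrow> tr H v \<in> carrier T"
  unfolding tr_def by (rule T.finsum_closed) auto

lemma tr_add: "H \<subseteq> carrier G \<Longrightarrow> v \<in> carrier T \<Longrightarrow> w \<in> carrier T \<Longrightarrow>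
    tr H (v \<oplus>\<^bsub>T\<^esub> w) = tr H v \<oplus>\<^bsub>T\<^esub> tr H w"
  unfolding tr_def
  by (subst T.finsum_addf[symmetric]) (auto simp: act_add intro!: T.finsum_cong')

lemma tr_zero [simp]: "H \<subseteq> carrier G \<Longrightarrow> tr H \<zero>\<^bsub>T\<^esub> = \<zero>\<^bsub>T\<^esub>"
  unfolding tr_def by (auto intro!: T.add.finprod_one_eqI)

lemma tr_minus: "H \<subseteq> carrier G \<Longrightarrow> v \<in> carrier T \<Longrightarrow> tr H (\<ominus>\<^bsub>T\<^esub> v) = \<ominus>\<^bsub>T\<^esub> tr H v"
  by (metis T.minus_equality T.add.inv_closed tr_add tr_closed tr_zero T.l_neg)

lemma tr_add_pow:
  fixes n :: nat
  shows "H \<subseteq> carrier G \<Longrightarrow> v \<in> carrier T \<Longrightarrow> tr H ([n] \<cdot>\<^bsub>T\<^esub> v) = [n] \<cdot>\<^bsub>T\<^esub> tr H v"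
  by (induction n) (simp_all add: tr_add T.add.nat_pow_Suc)

lemma tr_sum:
  assumes "H \<subseteq> carrier G" "\<And>i. i \<in> I \<Longrightarrow> f i \<in> carrier T"
  shows "tr H (\<Oplus>\<^bsub>T\<^esub>i\<in>I. f i) = (\<Oplus>\<^bsub>T\<^esub>i\<in>I. tr H (f i))"
  using assms(2)
proof (induction I rule: infinite_finite_induct)
  case (insert x F)
  then show ?case
    using assms(1) by (simp add: T.finsum_insert tr_add T.finsum_closed Pi_iff)
qed (simp_all add: assms(1))

lemma tr_of_fixed:
  assumes "v \<in> carrier T" "\<And>x. x \<in> H \<Longrightarrow> act x v = v"
  shows "tr H v = [card H] \<cdot>\<^bsub>T\<^esub> v"
proof -
  have "tr H v = (\<Oplus>\<^bsub>T\<^esub>x\<in>H. v)"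
    unfolding tr_def using assms by (intro T.finsum_cong') auto
  then show ?thesis using T.add.finprod_const[OF assms(1)] by simp
qed

lemma sum_translate_left:
  assumes Y: "subgroup Y G" and z: "z \<in> Y" and f: "\<And>y. y \<in> Y \<Longrightarrow> f y \<in> carrier T"
  shows "(\<Oplus>\<^bsub>T\<^esub>y\<in>Y. f (z \<otimes> y)) = (\<Oplus>\<^bsub>T\<^esub>y\<in>Y. f y)"
proof -
  note c = subgroup.mem_carrier[OF Y]
  have im: "(\<lambda>y. z \<otimes> y) ` Y = Y"
  proof (intro equalityI subsetI)
    fix x assume x: "x \<in> Y"
    then have "x = z \<otimes> (inv z \<otimes> x)" using c z by (simp add: grp_simps)
    moreover have "inv z \<otimes> x \<in> Y" using Y z x by (simp add: subgroup.m_closed subgroup.m_inv_closed)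
    ultimately show "x \<in> (\<lambda>y. z \<otimes> y) ` Y" by blast
  qed (use Y z in \<open>auto simp: subgroup.m_closed\<close>)
  have inj: "inj_on (\<lambda>y. z \<otimes> y) Y" using c z by (auto simp: inj_on_def)
  show ?thesis using T.finsum_reindex[OF _ inj, of f] im f by auto
qed

lemma sum_translate_right:
  assumes Y: "subgroup Y G" and z: "z \<in> Y" and f: "\<And>y. y \<in> Y \<Longrightarrow> f y \<in> carrier T"
  shows "(\<Oplus>\<^bsub>T\<^esub>y\<in>Y. f (y \<otimes> z)) = (\<Oplus>\<^bsub>T\<^esub>y\<in>Y. f y)"
proof -
  note c = subgroup.mem_carrier[OF Y]
  have im: "(\<lambda>y. y \<otimes> z) ` Y = Y"
  proof (intro equalityI subsetI)
    fix x assume x: "x \<in> Y"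
    then have "x = (x \<otimes> inv z) \<otimes> z" using c z by (simp add: grp_simps)
    moreover have "x \<otimes> inv z \<in> Y" using Y z x by (simp add: subgroup.m_closed subgroup.m_inv_closed)
    ultimately show "x \<in> (\<lambda>y. y \<otimes> z) ` Y" by blast
  qed (use Y z in \<open>auto simp: subgroup.m_closed\<close>)
  have inj: "inj_on (\<lambda>y. y \<otimes> z) Y" using c z by (auto simp: inj_on_def)
  show ?thesis using T.finsum_reindex[OF _ inj, of f] im f by auto
qed

lemma tr_fixed:
  assumes "subgroup H G" "x \<in> H" "v \<in> carrier T"
  shows "act x (tr H v) = tr H v"
proof -
  note c = subgroup.mem_carrier[OF assms(1)]
  have "act x (tr H v) = (\<Oplus>\<^bsub>T\<^esub>y\<in>H. act (x \<otimes> y) v)"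
    unfolding tr_def using c assms by (subst act_sum) (auto simp: act_mult intro!: T.finsum_cong')
  then show ?thesis
    unfolding tr_def using sum_translate_left[OF assms(1,2), of "\<lambda>y. act y v"] c assms by auto
qed

lemma act_tr:
  assumes "H \<subseteq> carrier G" "g \<in> carrier G" "v \<in> carrier T"
  shows "act g (tr H v) = tr ((\<lambda>x. g \<otimes> x \<otimes> inv g) ` H) (act g v)"
proof -
  have inj: "inj_on (\<lambda>x. g \<otimes> x \<otimes> inv g) H"
    using assms by (auto simp: inj_on_def subset_iff)
  have "tr ((\<lambda>x. g \<otimes> x \<otimes> inv g) ` H) (act g v) = (\<Oplus>\<^bsub>T\<^esub>x\<in>H. act (g \<otimes> x \<otimes> inv g) (act g v))"
    unfolding tr_def using assms by (subst T.finsum_reindex[OF _ inj]) auto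
  also have "\<dots> = (\<Oplus>\<^bsub>T\<^esub>x\<in>H. act g (act x v))"
    using assms by (intro T.finsum_cong') (auto simp: act_mult subset_iff)
  also have "\<dots> = act g (tr H v)"
    unfolding tr_def using assms by (subst act_sum) auto
  finally show ?thesis ..
qed

lemma tr_submod:
  assumes "submod S W" "H \<subseteq> S" "v \<in> W"
  shows "tr H v \<in> W"
  unfolding tr_def using assms by (intro submod_sum) (auto dest: submodD)

text \<open>A nonzero vector has additive order \<open>q\<close>, so \<open>q\<close> divides
  \<open>card W\<close> and hence the number of \<open>Q\<close>-fixed vectors. Zero is one of them,
  so it cannot be the only one.\<close>

lemma q_group_fixed_vector:
  assumes "subgroup Q G" "card Q = q ^ b" "submod Q W" "W \<noteq> {\<zero>\<^bsub>T\<^esub>}"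
  obtains w where "w \<in> W" "w \<noteq> \<zero>\<^bsub>T\<^esub>" "\<And>x. x \<in> Q \<Longrightarrow> act x w = w"
proof -
  note sub = submodD[OF assms(3)]
  obtain u where u: "u \<in> W" "u \<noteq> \<zero>\<^bsub>T\<^esub>" using assms(4) sub by blast
  have uT: "u \<in> carrier T" using u sub by blast
  let ?A = "(add_monoid T)\<lparr>carrier := W\<rparr>"
  have A: "group ?A" using submod_subgroup[OF assms(3)] T.add.subgroup_imp_group by blast
  have "T.add.ord u dvd q" using T.add.pow_eq_id[OF uT] q_torsion[OF uT] by simp
  moreover have "T.add.ord u \<noteq> 1" using T.add.ord_eq_1[OF uT] u by simp
  ultimately have ord: "T.add.ord u = q" using prime_q by (metis prime_nat_iff)
  have "q dvd card W"
  proof -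
    have pow: "u [^]\<^bsub>?A\<^esub> n = [n] \<cdot>\<^bsub>T\<^esub> u" for n :: nat
      by (simp add: add_pow_def nat_pow_consistent[symmetric] nat_pow_def)
    have "group.ord ?A u dvd order ?A"
      using group.ord_dvd_group_order[OF A] u by simp
    moreover have "group.ord ?A u = q"
      using group.ord_unique[OF A, of u q] u T.add.pow_eq_id[OF uT] ord pow by simp
    ultimately show ?thesis by (simp add: order_def)
  qed
  moreover have "[card {e \<in> W. \<forall>g\<in>Q. act g e = e} = card W] (mod q)"
    by (rule p_group_fixed_points[OF assms(1,2) prime_q submod_finite[OF assms(3)]])
      (use sub subgroup.mem_carrier[OF assms(1)] act_mult in auto)
  ultimately have "q dvd card {e \<in> W. \<forall>g\<in>Q. act g e = e}" using cong_dvd_iff by blast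
  then have "{e \<in> W. \<forall>g\<in>Q. act g e = e} \<noteq> {\<zero>\<^bsub>T\<^esub>}"
    using prime_q by (metis card_1_singleton_iff One_nat_def not_prime_1 nat_dvd_1_iff_1)
  moreover have "\<zero>\<^bsub>T\<^esub> \<in> {e \<in> W. \<forall>g\<in>Q. act g e = e}"
    using sub subgroup.mem_carrier[OF assms(1)] by auto
  ultimately show ?thesis using that by blast
qed

text \<open>
  The sum of \<open>y\<^sup>-\<^sup>1 k y\<^sub>0\<^sup>-\<^sup>1 y y\<^sub>0 v\<close> over all \<open>y, y\<^sub>0 \<in> Y\<close> is evaluated in two ways. If no
  \<open>k y\<^sub>0\<^sup>-\<^sup>1\<close> centralizes \<open>Y\<close>, each inner sum over \<open>y\<close> is fixed by a nontrivial element of \<open>A\<close>,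
  hence zero; the inner sum over \<open>y\<^sub>0\<close> vanishes unless \<open>y \<in> A\<close>, so the total is \<open>|A| |Y| k v\<close>.
\<close>

lemma twisted_complement:
  assumes Y: "subgroup Y G" "\<not> q dvd card Y" and A: "subgroup A G" "A \<subseteq> Y" and k: "k \<in> carrier G"
    and AY: "\<And>a y. a \<in> A \<Longrightarrow> y \<in> Y \<Longrightarrow> a \<otimes> y = y \<otimes> a"
    and Ak: "\<And>a. a \<in> A \<Longrightarrow> a \<otimes> k = k \<otimes> a"
    and Yk: "\<And>y. y \<in> Y \<Longrightarrow> inv y \<otimes> k \<otimes> y \<otimes> inv k \<in> A"
    and YY: "\<And>y z. y \<in> Y \<Longrightarrow> z \<in> Y \<Longrightarrow> inv y \<otimes> z \<otimes> y \<otimes> inv z \<in> A"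
    and cent: "\<And>y. y \<in> Y \<Longrightarrow> (\<And>z. z \<in> Y \<Longrightarrow> y \<otimes> z = z \<otimes> y) \<Longrightarrow> y \<in> A"
    and fpf: "\<And>a v. a \<in> A \<Longrightarrow> a \<noteq> \<one> \<Longrightarrow> v \<in> carrier T \<Longrightarrow> act a v = v \<Longrightarrow> v = \<zero>\<^bsub>T\<^esub>"
    and v: "v \<in> carrier T" "v \<noteq> \<zero>\<^bsub>T\<^esub>"
  shows "\<exists>y0\<in>Y. \<forall>y\<in>Y. (k \<otimes> inv y0) \<otimes> y = y \<otimes> (k \<otimes> inv y0)"
proof (rule ccontr)
  assume neg: "\<not> ?thesis"
  note Yc = subgroup.mem_carrier[OF Y(1)]
  have Ac: "a \<in> carrier G" if "a \<in> A" for a using that A(2) Yc by blast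
  have finY: "finite Y" using finite_G Y(1) subgroup.subset finite_subset by blast
  have finA: "finite A" using finY A(2) finite_subset by blast
  note Yi = subgroup.m_inv_closed[OF Y(1)]
  note Ym = subgroup.m_closed[OF Y(1)]
  note Am = subgroup.m_closed[OF A(1)]
  define t where "t = (\<lambda>y y0. act (inv y \<otimes> k \<otimes> inv y0 \<otimes> y \<otimes> y0) v)"
  have tc: "t y y0 \<in> carrier T" if "y \<in> Y" "y0 \<in> Y" for y y0
    unfolding t_def using that Yc k v by auto
  have col: "(\<Oplus>\<^bsub>T\<^esub>y\<in>Y. t y y0) = \<zero>\<^bsub>T\<^esub>" if y0: "y0 \<in> Y" for y0
  proof -
    define g where "g = k \<otimes> inv y0"
    have gc: "g \<in> carrier G" using k Yc[OF y0] by (simp add: g_def)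
    obtain y1 where y1: "y1 \<in> Y" "g \<otimes> y1 \<noteq> y1 \<otimes> g" using neg y0 unfolding g_def by blast
    \<comment> \<open>This is \<open>[y1^-1, g]\<close>, nontrivial because \<open>y1\<close> and
      \<open>g\<close> do not commute. Replacing \<open>y\<close> by \<open>y1 \<otimes> y\<close>
      multiplies each summand by \<open>a\<close> (fact \<open>sh\<close>), so the whole sum is
      fixed by \<open>a\<close>.\<close>
    define a where "a = inv y1 \<otimes> g \<otimes> y1 \<otimes> inv g"
    have c1: "y1 \<in> carrier G" "y0 \<in> carrier G" using Yc y1 y0 by auto
    have bA: "inv y1 \<otimes> inv y0 \<otimes> y1 \<otimes> y0 \<in> A" using YY[OF y1(1) Yi[OF y0]] c1 by simp
    \<comment> \<open>The commutator with \<open>g = k y0^-1\<close> splits into one with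
      \<open>k\<close> and a \<open>k\<close>-conjugate of one inside \<open>Y\<close>; both lie in
      \<open>A\<close>, and \<open>k\<close> centralizes \<open>A\<close>.\<close>
    have "a = (inv y1 \<otimes> k \<otimes> y1 \<otimes> inv k) \<otimes> (k \<otimes> (inv y1 \<otimes> inv y0 \<otimes> y1 \<otimes> y0) \<otimes> inv k)"
      unfolding a_def g_def using c1 k by (simp add: grp_simps)
    also have "k \<otimes> (inv y1 \<otimes> inv y0 \<otimes> y1 \<otimes> y0) \<otimes> inv k = inv y1 \<otimes> inv y0 \<otimes> y1 \<otimes> y0"
      using Ak[OF bA] c1 k by (metis Ac bA inv_solve_right m_closed)
    finally have aA: "a \<in> A" using Am[OF Yk[OF y1(1)] bA] by simp
    have a1: "a \<noteq> \<one>"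
    proof
      assume "a = \<one>"
      then have "y1 \<otimes> a \<otimes> g = y1 \<otimes> g" using c1 gc by simp
      moreover have "y1 \<otimes> a \<otimes> g = g \<otimes> y1" unfolding a_def using c1 gc by (simp add: grp_simps)
      ultimately show False using y1 by simp
    qed
    define u where "u = act y0 v"
    have uT: "u \<in> carrier T" unfolding u_def using c1 v by simp
    define f where "f = (\<lambda>y. act (inv y \<otimes> g \<otimes> y) u)"
    have fc: "f y \<in> carrier T" if "y \<in> Y" for y unfolding f_def using Yc[OF that] gc uT by simp
    have tf: "t y y0 = f y" if "y \<in> Y" for y
    proof -
      have "f y = act (inv y \<otimes> g \<otimes> y \<otimes> y0) v"
        unfolding f_def u_def using Yc[OF that] gc c1 v by (simp add: act_mult)
      then show ?thesis unfolding t_def g_def using Yc[OF that] k c1 by (simp add: m_assoc)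
    qed
    have sh: "f (y1 \<otimes> y) = act a (f y)" if y: "y \<in> Y" for y
    proof -
      have yc: "y \<in> carrier G" using Yc y by simp
      have "inv (y1 \<otimes> y) \<otimes> g \<otimes> (y1 \<otimes> y) = (inv y \<otimes> a) \<otimes> (g \<otimes> y)"
        unfolding a_def using c1 gc yc by (simp add: grp_simps)
      also have "inv y \<otimes> a = a \<otimes> inv y" using AY[OF aA Yi[OF y]] by simp
      also have "a \<otimes> inv y \<otimes> (g \<otimes> y) = a \<otimes> (inv y \<otimes> g \<otimes> y)"
        using yc gc Ac[OF aA] by (simp add: m_assoc)
      finally show ?thesis unfolding f_def using yc gc Ac[OF aA] uT by (simp add: act_mult)
    qed
    have "act a (\<Oplus>\<^bsub>T\<^esub>y\<in>Y. f y) = (\<Oplus>\<^bsub>T\<^esub>y\<in>Y. act a (f y))"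
      using act_sum[OF Ac[OF aA], of Y f] fc by simp
    also have "\<dots> = (\<Oplus>\<^bsub>T\<^esub>y\<in>Y. f (y1 \<otimes> y))" using sh fc Ym[OF y1(1)] by (intro T.finsum_cong') auto
    also have "\<dots> = (\<Oplus>\<^bsub>T\<^esub>y\<in>Y. f y)" using sum_translate_left[OF Y(1) y1(1)] fc by simp
    finally have "(\<Oplus>\<^bsub>T\<^esub>y\<in>Y. f y) = \<zero>\<^bsub>T\<^esub>"
      using fpf[OF aA a1] fc by (simp add: T.finsum_closed Pi_iff)
    moreover have "(\<Oplus>\<^bsub>T\<^esub>y\<in>Y. t y y0) = (\<Oplus>\<^bsub>T\<^esub>y\<in>Y. f y)" using tf fc by (intro T.finsum_cong') auto
    ultimately show ?thesis by simp
  qed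
  have row: "(\<Oplus>\<^bsub>T\<^esub>y0\<in>Y. t y y0) = \<zero>\<^bsub>T\<^esub>" if y: "y \<in> Y" "y \<notin> A" for y
  proof -
    have yc: "y \<in> carrier G" using Yc y by simp
    obtain y1 where y1: "y1 \<in> Y" "y \<otimes> y1 \<noteq> y1 \<otimes> y" using cent[OF y(1)] y(2) by blast
    have c1: "y1 \<in> carrier G" using Yc y1 by auto
    \<comment> \<open>The mirror image of the previous argument: after
      \<open>inv y \<otimes> k \<otimes> y\<close> is pulled out, the summands are
      \<open>[y^-1, z^-1] v\<close>, and a right shift of \<open>z\<close> by \<open>y1\<close>
      multiplies them by \<open>a\<close>.\<close>
    define a where "a = inv y \<otimes> inv y1 \<otimes> y \<otimes> y1"
    have aA: "a \<in> A" unfolding a_def using YY[OF y(1) Yi[OF y1(1)]] c1 by simp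
    have a1: "a \<noteq> \<one>"
    proof
      assume "a = \<one>"
      then have "y1 \<otimes> y \<otimes> a = y1 \<otimes> y" using c1 yc by simp
      moreover have "y1 \<otimes> y \<otimes> a = y \<otimes> y1" unfolding a_def using c1 yc by (simp add: grp_simps)
      ultimately show False using y1 by simp
    qed
    define f where "f = (\<lambda>y0. act (inv y \<otimes> inv y0 \<otimes> y \<otimes> y0) v)"
    have fc: "f z \<in> carrier T" if "z \<in> Y" for z unfolding f_def using Yc[OF that] yc v by simp
    have tf: "t y z = act (inv y \<otimes> k \<otimes> y) (f z)" if "z \<in> Y" for z
    proof -
      have "act (inv y \<otimes> k \<otimes> y) (f z) = act ((inv y \<otimes> k \<otimes> y) \<otimes> (inv y \<otimes> inv z \<otimes> y \<otimes> z)) v"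
        unfolding f_def using Yc[OF that] yc k v by (simp add: act_mult)
      also have "(inv y \<otimes> k \<otimes> y) \<otimes> (inv y \<otimes> inv z \<otimes> y \<otimes> z) = inv y \<otimes> k \<otimes> inv z \<otimes> y \<otimes> z"
        using Yc[OF that] yc k by (simp add: grp_simps)
      finally show ?thesis unfolding t_def by simp
    qed
    have sh: "f (z \<otimes> y1) = act a (f z)" if z: "z \<in> Y" for z
    proof -
      have zc: "z \<in> carrier G" using Yc z by simp
      define b where "b = inv y \<otimes> inv z \<otimes> y \<otimes> z"
      have bA: "b \<in> A" unfolding b_def using YY[OF y(1) Yi[OF z]] zc by simp
      have "inv y \<otimes> inv (z \<otimes> y1) \<otimes> y \<otimes> (z \<otimes> y1) = inv y \<otimes> inv y1 \<otimes> y \<otimes> (b \<otimes> y1)"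
        unfolding b_def using c1 zc yc by (simp add: grp_simps)
      also have "b \<otimes> y1 = y1 \<otimes> b" using AY[OF bA y1(1)] .
      also have "inv y \<otimes> inv y1 \<otimes> y \<otimes> (y1 \<otimes> b) = a \<otimes> b"
        unfolding a_def using c1 yc Ac[OF bA] by (simp add: grp_simps)
      finally show ?thesis unfolding f_def b_def[symmetric] using Ac[OF aA] Ac[OF bA] v by (simp add: act_mult)
    qed
    have "act a (\<Oplus>\<^bsub>T\<^esub>z\<in>Y. f z) = (\<Oplus>\<^bsub>T\<^esub>z\<in>Y. act a (f z))"
      using act_sum[OF Ac[OF aA], of Y f] fc by simp
    also have "\<dots> = (\<Oplus>\<^bsub>T\<^esub>z\<in>Y. f (z \<otimes> y1))" using sh fc Ym[OF _ y1(1)] by (intro T.finsum_cong') auto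
    also have "\<dots> = (\<Oplus>\<^bsub>T\<^esub>z\<in>Y. f z)" using sum_translate_right[OF Y(1) y1(1)] fc by simp
    finally have 0: "(\<Oplus>\<^bsub>T\<^esub>z\<in>Y. f z) = \<zero>\<^bsub>T\<^esub>"
      using fpf[OF aA a1] fc by (simp add: T.finsum_closed Pi_iff)
    have "(\<Oplus>\<^bsub>T\<^esub>z\<in>Y. t y z) = (\<Oplus>\<^bsub>T\<^esub>z\<in>Y. act (inv y \<otimes> k \<otimes> y) (f z))"
      using tf fc yc k by (intro T.finsum_cong') auto
    also have "\<dots> = act (inv y \<otimes> k \<otimes> y) (\<Oplus>\<^bsub>T\<^esub>z\<in>Y. f z)"
      using act_sum[of "inv y \<otimes> k \<otimes> y" Y f] fc yc k by simp
    finally show ?thesis using 0 yc k by simp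
  qed
  have diag: "t y y0 = act k v" if "y \<in> A" "y0 \<in> Y" for y y0
  proof -
    have c: "y \<in> carrier G" "y0 \<in> carrier G" using that Ac Yc by auto
    have "inv y \<otimes> k \<otimes> inv y0 \<otimes> y \<otimes> y0 = inv y \<otimes> k \<otimes> inv y0 \<otimes> (y \<otimes> y0)"
      using c k by (simp add: m_assoc)
    also have "\<dots> = inv y \<otimes> (k \<otimes> y)" unfolding AY[OF that] using c k by (simp add: grp_simps)
    also have "\<dots> = k" unfolding Ak[OF that(1), symmetric] using c k by (simp add: grp_simps)
    finally show ?thesis by (simp add: t_def)
  qed
  have kv: "act k v \<in> carrier T" using k v by simp
  have rs: "(\<Oplus>\<^bsub>T\<^esub>y0\<in>Y. t y y0) \<in> carrier T" if "y \<in> Y" for y using tc that by (simp add: T.finsum_closed Pi_iff)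
  have "\<zero>\<^bsub>T\<^esub> = (\<Oplus>\<^bsub>T\<^esub>y0\<in>Y. \<Oplus>\<^bsub>T\<^esub>y\<in>Y. t y y0)"
    using col by (intro T.add.finprod_one_eqI[symmetric]) auto
  also have "\<dots> = (\<Oplus>\<^bsub>T\<^esub>y\<in>Y. \<Oplus>\<^bsub>T\<^esub>y0\<in>Y. t y y0)"
    by (rule T.finsum_swap) (use finY tc in auto)
  also have "\<dots> = (\<Oplus>\<^bsub>T\<^esub>y\<in>A. \<Oplus>\<^bsub>T\<^esub>y0\<in>Y. t y y0)"
    by (rule T.add.finprod_mono_neutral_cong_right) (use finY A row rs in auto)
  also have "\<dots> = (\<Oplus>\<^bsub>T\<^esub>y\<in>A. \<Oplus>\<^bsub>T\<^esub>y0\<in>Y. act k v)"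
    using diag kv by (intro T.finsum_cong') (auto intro!: T.finsum_cong' T.finsum_closed)
  also have "\<dots> = [card A] \<cdot>\<^bsub>T\<^esub> ([card Y] \<cdot>\<^bsub>T\<^esub> act k v)"
    using kv by (simp add: T.add.finprod_const)
  finally have z: "[card A] \<cdot>\<^bsub>T\<^esub> ([card Y] \<cdot>\<^bsub>T\<^esub> act k v) = \<zero>\<^bsub>T\<^esub>" by simp
  have "card A dvd card Y" using subgroup_card_dvd[OF A(1) Y(1) A(2)] .
  then have "\<not> q dvd card A" using Y(2) dvd_trans by blast
  from coprime_torsion[OF this _ z] have "[card Y] \<cdot>\<^bsub>T\<^esub> act k v = \<zero>\<^bsub>T\<^esub>" using kv by simp
  from coprime_torsion[OF Y(2) kv this] have "act k v = \<zero>\<^bsub>T\<^esub>" .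
  then show False using v k act_inv(1)[OF k v(1)] by simp
qed

text \<open>Applying \<open>c\<close> to a partial sum drops the term \<open>v\<close> and appends
  the next power. At length \<open>p\<close> these agree because \<open>c [^] p = \<one>\<close>, so
  the sum is fixed by \<open>c\<close> and therefore zero.\<close>

lemma power_sum_zero:
  fixes p :: nat
  assumes c: "c \<in> carrier G" "c [^] p = \<one>" and v: "v \<in> carrier T"
    and fpf: "\<And>v. v \<in> carrier T \<Longrightarrow> act c v = v \<Longrightarrow> v = \<zero>\<^bsub>T\<^esub>"
  shows "(\<Oplus>\<^bsub>T\<^esub>j\<in>{..<p}. act (c [^] j) v) = \<zero>\<^bsub>T\<^esub>"
proof -
  let ?F = "\<lambda>n. (\<Oplus>\<^bsub>T\<^esub>j\<in>{..<n}. act (c [^] j) v)"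
  have Fc: "?F n \<in> carrier T" for n :: nat using c v by (intro T.finsum_closed) auto
  have F_Suc: "?F (Suc n) = act (c [^] n) v \<oplus>\<^bsub>T\<^esub> ?F n" for n :: nat
    unfolding lessThan_Suc using c v by (subst T.finsum_insert) auto
  have "act c (?F n) \<oplus>\<^bsub>T\<^esub> v = ?F n \<oplus>\<^bsub>T\<^esub> act (c [^] n) v" for n :: nat
  proof (induction n)
    case 0
    then show ?case using c v by simp
  next
    case (Suc n)
    have cn: "act (c [^] n) v \<in> carrier T" "act (c [^] Suc n) v \<in> carrier T" using c v by auto
    have e: "act c (act (c [^] n) v) = act (c [^] Suc n) v"
      using c v nat_pow_Suc2[OF c(1), of n] by (simp add: act_mult)
    have "act c (?F (Suc n)) \<oplus>\<^bsub>T\<^esub> v = act (c [^] Suc n) v \<oplus>\<^bsub>T\<^esub> (act c (?F n) \<oplus>\<^bsub>T\<^esub> v)"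
      unfolding F_Suc using c cn Fc v e by (simp add: act_add T.a_assoc)
    also have "\<dots> = act (c [^] Suc n) v \<oplus>\<^bsub>T\<^esub> ?F (Suc n)"
      unfolding Suc F_Suc using cn Fc by (simp add: T.a_comm)
    finally show ?case using cn Fc by (simp add: T.a_comm)
  qed
  from this[of p] have "act c (?F p) = ?F p"
    using c v Fc[of p] by simp
  then show ?thesis using fpf Fc by blast
qed

text \<open>
  If \<open>b\<close> and \<open>d\<close> were independent, summing the vanishing traces of all \<open>\<langle>d b\<^sup>i\<rangle>\<close> would give \<open>p v = 0\<close>.
\<close>

lemma fpf_order_p_unique:
  fixes p :: nat
  assumes p: "Factorial_Ring.prime p" "p \<noteq> q"
    and b: "b \<in> carrier G" "b [^] p = \<one>" "b \<noteq> \<one>" and d: "d \<in> carrier G" "d [^] p = \<one>"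
    and comm: "b \<otimes> d = d \<otimes> b"
    and fpf: "\<And>i j v. d [^] (i::nat) \<otimes> b [^] (j::nat) \<noteq> \<one> \<Longrightarrow> v \<in> carrier T \<Longrightarrow>
      act (d [^] i \<otimes> b [^] j) v = v \<Longrightarrow> v = \<zero>\<^bsub>T\<^esub>"
    and v: "v \<in> carrier T" "v \<noteq> \<zero>\<^bsub>T\<^esub>"
  shows "\<exists>i::nat. d = b [^] i"
proof (rule ccontr)
  assume neg: "\<not> ?thesis"
  have ob: "ord b = p"
    using pow_eq_id[OF b(1), of p] ord_eq_1[OF b(1)] p b by (metis prime_nat_iff)
  have c1: "d \<otimes> b [^] i \<noteq> \<one>" for i :: nat
  proof
    assume "d \<otimes> b [^] i = \<one>"
    then have "d = inv (b [^] i)" using b d by (metis inv_equality nat_pow_closed inv_inv inv_unique' inv_comm)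
    \<comment> \<open>The exponent \<open>i * (p - 1)\<close> represents \<open>-i\<close> modulo
      \<open>p\<close> by a natural number.\<close>
    also have "\<dots> = b [^] (i * (p - 1))"
    proof -
      have e: "i * (p - 1) + i = p * i"
        using prime_gt_0_nat[OF p(1)] by (cases p) (simp_all add: algebra_simps)
      have "b [^] (i * (p - 1)) \<otimes> b [^] i = (b [^] p) [^] i"
        using b(1) e by (simp add: nat_pow_pow nat_pow_mult)
      then show ?thesis using b by (metis inv_equality nat_pow_closed nat_pow_one)
    qed
    finally show False using neg by blast
  qed
  have cp: "(d \<otimes> b [^] i) [^] p = \<one>" for i :: nat
  proof -
    have "d \<otimes> b [^] i = b [^] i \<otimes> d" using comm b d by (metis group_commutes_pow)
    then have "(d \<otimes> b [^] i) [^] p = d [^] p \<otimes> (b [^] i) [^] p"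
      using b d by (intro pow_mult_distrib) auto
    then show ?thesis using b d by (simp add: nat_pow_pow) (metis mult.commute nat_pow_one nat_pow_pow)
  qed
  have expand: "(d \<otimes> b [^] i) [^] j = d [^] j \<otimes> (b [^] j) [^] i" for i j :: nat
  proof -
    have "d \<otimes> b [^] i = b [^] i \<otimes> d" using comm b d by (metis group_commutes_pow)
    then have "(d \<otimes> b [^] i) [^] j = d [^] j \<otimes> (b [^] i) [^] j"
      using b d by (intro pow_mult_distrib) auto
    then show ?thesis using b d by (simp add: nat_pow_pow mult.commute)
  qed
  define t where "t = (\<lambda>i j. act ((d \<otimes> b [^] (i::nat)) [^] (j::nat)) v)"
  have tc: "t i j \<in> carrier T" for i j unfolding t_def using b d v by simp
  have row: "(\<Oplus>\<^bsub>T\<^esub>j\<in>{..<p}. t i j) = \<zero>\<^bsub>T\<^esub>" for i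
    unfolding t_def
  proof (rule power_sum_zero)
    fix u assume "u \<in> carrier T" "act (d \<otimes> b [^] i) u = u"
    then show "u = \<zero>\<^bsub>T\<^esub>" using fpf[of 1 i u] c1[of i] d by simp
  qed (use b d v cp in auto)
  \<comment> \<open>As \<open>b\<close> and \<open>d\<close> commute,
    \<open>(d b^i)^j = d^j (b^j)^i\<close>. For \<open>0 < j < p\<close> the sum over
    \<open>i\<close> is therefore \<open>d^j\<close> applied to the trace of the nontrivial element
    \<open>b^j\<close>; only the column \<open>j = 0\<close> survives, and it is \<open>p\<close>
    copies of \<open>v\<close>.\<close>
  have col: "(\<Oplus>\<^bsub>T\<^esub>i\<in>{..<p}. t i j) = \<zero>\<^bsub>T\<^esub>" if j: "j \<in> {..<p}" "j \<noteq> 0" for j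
  proof -
    have bj: "b [^] j \<noteq> \<one>" using pow_eq_id[OF b(1), of j] ob j nat_dvd_not_less[of j p] by auto
    have z: "(\<Oplus>\<^bsub>T\<^esub>i\<in>{..<p}. act ((b [^] j) [^] i) v) = \<zero>\<^bsub>T\<^esub>"
    proof (rule power_sum_zero)
      show "(b [^] j) [^] p = \<one>" using b by (metis mult.commute nat_pow_one nat_pow_pow)
      fix u assume "u \<in> carrier T" "act (b [^] j) u = u"
      then show "u = \<zero>\<^bsub>T\<^esub>" using fpf[of 0 j u] bj b by simp
    qed (use b v in auto)
    have "(\<Oplus>\<^bsub>T\<^esub>i\<in>{..<p}. t i j) = (\<Oplus>\<^bsub>T\<^esub>i\<in>{..<p}. act (d [^] j) (act ((b [^] j) [^] i) v))"
      using b d v by (intro T.finsum_cong') (auto simp: t_def expand act_mult)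
    also have "\<dots> = act (d [^] j) (\<Oplus>\<^bsub>T\<^esub>i\<in>{..<p}. act ((b [^] j) [^] i) v)"
      using b d v by (subst act_sum) auto
    finally show ?thesis using z d by simp
  qed
  have "\<zero>\<^bsub>T\<^esub> = (\<Oplus>\<^bsub>T\<^esub>i\<in>{..<p}. \<Oplus>\<^bsub>T\<^esub>j\<in>{..<p}. t i j)"
    using row by (intro T.add.finprod_one_eqI[symmetric]) auto
  also have "\<dots> = (\<Oplus>\<^bsub>T\<^esub>j\<in>{..<p}. \<Oplus>\<^bsub>T\<^esub>i\<in>{..<p}. t i j)"
    by (rule T.finsum_swap) (use tc in auto)
  also have "\<dots> = (\<Oplus>\<^bsub>T\<^esub>j\<in>{0}. \<Oplus>\<^bsub>T\<^esub>i\<in>{..<p}. t i j)"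
    by (rule T.add.finprod_mono_neutral_cong_right)
      (use col tc prime_gt_0_nat[OF p(1)] in \<open>auto intro!: T.finsum_closed\<close>)
  also have "\<dots> = (\<Oplus>\<^bsub>T\<^esub>i\<in>{..<p}. t i 0)" using tc by (simp add: T.finsum_closed Pi_iff)
  also have "\<dots> = (\<Oplus>\<^bsub>T\<^esub>i\<in>{..<p}. v)" using v by (intro T.finsum_cong') (auto simp: t_def)
  also have "\<dots> = [p] \<cdot>\<^bsub>T\<^esub> v" using v T.add.finprod_const[OF v(1), of "{..<p}"] by simp
  finally have "[p] \<cdot>\<^bsub>T\<^esub> v = \<zero>\<^bsub>T\<^esub>" by simp
  moreover have "\<not> q dvd p" using p prime_q primes_dvd_imp_eq by blast
  ultimately show False using coprime_torsion v by blast
qed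

end

section \<open>Cyclic p-groups and powers of products\<close>

text \<open>An element \<open>a\<close> of maximal order generates \<open>A\<close>. By induction on
  \<open>ord x\<close>, the power \<open>x [^] p\<close> is \<open>a [^] j\<close>. If
  \<open>p\<close> does not divide \<open>j\<close>, then \<open>x\<close> has order
  \<open>p * ord a\<close>, too large. If \<open>j = p * j'\<close>, then \<open>x a^-j'\<close> has
  order dividing \<open>p\<close> and lies in the only subgroup of order \<open>p\<close>, which
  \<open>a\<close> already contains.\<close>

lemma (in group) abelian_p_group_cyclic:
  fixes p n :: nat
  assumes fin: "finite (carrier G)" and A: "subgroup A G" "card A = p ^ n" and p: "Factorial_Ring.prime p"
    and comm: "\<And>x y. x \<in> A \<Longrightarrow> y \<in> A \<Longrightarrow> x \<otimes> y = y \<otimes> x"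
    and uniq: "\<And>b d. b \<in> A \<Longrightarrow> d \<in> A \<Longrightarrow> b [^] p = \<one> \<Longrightarrow> b \<noteq> \<one> \<Longrightarrow> d [^] p = \<one> \<Longrightarrow> \<exists>i::nat. d = b [^] i"
  shows "\<exists>a\<in>A. \<forall>x\<in>A. \<exists>i::nat. x = a [^] i"
proof -
  note Ac = subgroup.mem_carrier[OF A(1)]
  have powA: "x [^] (i::nat) \<in> A" if "x \<in> A" for x i
    using that A(1) by (induction i) (auto simp: subgroup.one_closed subgroup.m_closed)
  have ordp: "\<exists>i. ord x = p ^ i" if "x \<in> A" for x
  proof -
    have "x [^] card A = \<one>"
      using group.pow_order_eq_1[OF subgroup_imp_group[OF A(1)], of x] that
      by (simp add: order_def nat_pow_consistent[symmetric])
    then have "ord x dvd p ^ n" using pow_eq_id[OF Ac[OF that]] A(2) by simp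
    then show ?thesis using p by (auto simp: divides_primepow_nat)
  qed
  have finA: "finite A" using fin A(1) subgroup.subset finite_subset by blast
  have "A \<noteq> {}" using subgroup.one_closed[OF A(1)] by blast
  then have "Max (ord ` A) \<in> ord ` A" using finA by (intro Max_in) auto
  then obtain a where "a \<in> A" "ord a = Max (ord ` A)" by force
  then have a: "a \<in> A" "\<And>x. x \<in> A \<Longrightarrow> ord x \<le> ord a" using finA by auto
  obtain k where k: "ord a = p ^ k" using ordp a by blast
  have "\<exists>i::nat. x = a [^] i" if "x \<in> A" for x
    using that
  proof (induction "ord x" arbitrary: x rule: less_induct)
    case less
    note xc = Ac[OF less.prems] and ac = Ac[OF a(1)]
    show ?case
    proof (cases "x = \<one>")
      case True
      then have "x = a [^] (0::nat)" by simp
      then show ?thesis by blast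
    next
      case False
      obtain i where i: "ord x = p ^ i" using ordp less.prems by blast
      have "i \<noteq> 0" using False i ord_eq_1[OF xc] by (metis power_0)
      then have pd: "p dvd ord x" using i by simp
      have oxp: "ord (x [^] p) = ord x div p" using ord_pow[OF xc pd] p by (simp add: prime_gt_0_nat)
      have pos: "ord x > 0" using i p by (simp add: prime_gt_0_nat)
      then have "ord (x [^] p) < ord x" using oxp prime_gt_1_nat[OF p] by simp
      from less.hyps[OF this powA[OF less.prems]] obtain j :: nat where j: "x [^] p = a [^] j" by blast
      show ?thesis
      proof (cases "p dvd j")
        case True
        then obtain j' where j': "j = p * j'" by blast
        define y where "y = x \<otimes> inv (a [^] j')"
        have yA: "y \<in> A" unfolding y_def using less.prems a powA A(1)
          by (simp add: subgroup.m_closed subgroup.m_inv_closed)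
        have iA: "inv (a [^] j') \<in> A" using a powA A(1) by (simp add: subgroup.m_inv_closed)
        have "y [^] p = x [^] p \<otimes> (inv (a [^] j')) [^] p"
          unfolding y_def using xc ac comm[OF less.prems iA] by (intro pow_mult_distrib) auto
        also have "\<dots> = x [^] p \<otimes> inv (a [^] j)"
          using ac j' by (simp add: nat_pow_inv nat_pow_pow mult.commute)
        finally have yp: "y [^] p = \<one>" using j xc ac by simp
        have k0: "k \<noteq> 0" using a(2)[OF less.prems] pos k i \<open>i \<noteq> 0\<close> p
          by (metis One_nat_def less_le_not_le one_less_power power_0 prime_gt_1_nat zero_less_iff_neq_zero)
        \<comment> \<open>A generator of the subgroup of order \<open>p\<close> in the cyclic group
          generated by \<open>a\<close>.\<close>
        define b where "b = a [^] (p ^ (k - 1))"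
        have bp: "b [^] p = \<one>" unfolding b_def using ac k k0 pow_ord_eq_1[OF ac]
          by (simp add: nat_pow_pow power_eq_if mult.commute)
        have "\<not> p ^ k dvd p ^ (k - 1)"
          using k0 power_dvd_imp_le[OF _ prime_gt_1_nat[OF p], of k "k - 1"] by auto
        then have "b \<noteq> \<one>" unfolding b_def using pow_eq_id[OF ac] k by simp
        from uniq[OF _ yA bp this yp] obtain l :: nat where "y = b [^] l"
          using powA[OF a(1)] by (auto simp: b_def)
        then have "x = a [^] (p ^ (k - 1) * l + j')"
          using xc ac unfolding y_def b_def by (simp add: nat_pow_pow inv_solve_right' flip: nat_pow_mult)
        then show ?thesis by blast
      next
        case nd: False
        then have "coprime j (ord a)" unfolding k using p
          by (metis coprime_commute coprime_power_left_iff prime_imp_coprime_nat)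
        then have "ord (x [^] p) = p ^ k" using pow_ord_eq_ord_iff[OF fin ac] j k by simp
        then have "ord x = p ^ k * p" using oxp pd by (metis dvd_div_mult_self)
        moreover have "p ^ k > 0" "p > 1" using prime_gt_0_nat[OF p] prime_gt_1_nat[OF p] by simp_all
        ultimately have "ord x > p ^ k" by simp
        then show ?thesis using a(2)[OF less.prems] k by simp
      qed
    qed
  qed
  then show ?thesis using a by blast
qed

text \<open>Here \<open>z\<close> is the commutator \<open>[y, x]\<close>. Moving the next
  \<open>x\<close> to the left past \<open>y [^] n\<close> costs \<open>z [^] n\<close>, which adds
  up to the exponent \<open>0 + 1 + ... + (n - 1)\<close>.\<close>

lemma (in group) pow_mult_central_commutator:
  fixes n :: nat
  assumes c: "x \<in> carrier G" "y \<in> carrier G" "z \<in> carrier G"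
    and yx: "y \<otimes> x = z \<otimes> x \<otimes> y" and zx: "z \<otimes> x = x \<otimes> z" and zy: "z \<otimes> y = y \<otimes> z"
  shows "(x \<otimes> y) [^] n = z [^] (\<Sum>{..<n}) \<otimes> x [^] n \<otimes> y [^] n"
proof -
  have znx: "z [^] (n::nat) \<otimes> x = x \<otimes> z [^] n" for n using zx c by (metis group_commutes_pow)
  have zny: "z [^] (n::nat) \<otimes> y = y \<otimes> z [^] n" for n using zy c by (metis group_commutes_pow)
  have ynx: "y [^] (n::nat) \<otimes> x = z [^] n \<otimes> x \<otimes> y [^] n" for n
  proof (induction n)
    case (Suc n)
    have "y [^] Suc n \<otimes> x = y \<otimes> (y [^] n \<otimes> x)" using c nat_pow_Suc2[of y n] by (simp add: m_assoc)
    also have "\<dots> = (y \<otimes> z [^] n) \<otimes> x \<otimes> y [^] n" unfolding Suc using c by (simp add: m_assoc)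
    also have "\<dots> = z [^] n \<otimes> (y \<otimes> x) \<otimes> y [^] n" unfolding zny[symmetric] using c by (simp add: m_assoc)
    also have "\<dots> = z [^] Suc n \<otimes> x \<otimes> y [^] Suc n" unfolding yx using c nat_pow_Suc2[of y n] by (simp add: m_assoc)
    finally show ?case .
  qed (use c in simp)
  have znxm: "z [^] (n::nat) \<otimes> x [^] (m::nat) = x [^] m \<otimes> z [^] n" for n m
    using znx c by (metis group_commutes_pow nat_pow_closed)
  show ?thesis
  proof (induction n)
    case (Suc n)
    have "(x \<otimes> y) [^] Suc n = z [^] (\<Sum>{..<n}) \<otimes> x [^] n \<otimes> (y [^] n \<otimes> x) \<otimes> y"
      using c by (simp add: Suc m_assoc)
    also have "\<dots> = z [^] (\<Sum>{..<n}) \<otimes> (x [^] n \<otimes> z [^] n) \<otimes> x \<otimes> y [^] Suc n"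
      unfolding ynx using c by (simp add: m_assoc)
    also have "\<dots> = (z [^] (\<Sum>{..<n}) \<otimes> z [^] n) \<otimes> x [^] Suc n \<otimes> y [^] Suc n"
      unfolding znxm[symmetric] using c by (simp add: m_assoc)
    also have "z [^] (\<Sum>{..<n}) \<otimes> z [^] n = z [^] (\<Sum>{..<Suc n})" using c by (simp add: nat_pow_mult add.commute)
    finally show ?case .
  qed (use c in simp)
qed

lemma odd_dvd_sum_lessThan: "odd (p::nat) \<Longrightarrow> p dvd \<Sum>{..<p}"
proof -
  assume "odd p"
  then obtain k where k: "p = 2 * k + 1" by (metis oddE)
  have "2 * \<Sum>{..<p} = p * (p - 1)" for p :: nat
  proof (induction p)
    case (Suc p)
    then show ?case by (cases p) (simp_all add: algebra_simps lessThan_Suc)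
  qed simp
  from this[of p] have "\<Sum>{..<p} = p * k" using k by simp
  then show ?thesis by simp
qed

text \<open>For odd \<open>p\<close> the exponent \<open>p (p - 1) / 2\<close> of the commutator is
  a multiple of \<open>p\<close>, so its contribution disappears. For \<open>p = 2\<close> two
  involutions of the dihedral group of order 8 violate the formula.\<close>

lemma (in group) pow_p_mult:
  fixes p :: nat
  assumes "x \<in> carrier G" "y \<in> carrier G" "z \<in> carrier G"
    and "y \<otimes> x = z \<otimes> x \<otimes> y" and "z \<otimes> x = x \<otimes> z" and "z \<otimes> y = y \<otimes> z"
    and "odd p" "z [^] p = \<one>"
  shows "(x \<otimes> y) [^] p = x [^] p \<otimes> y [^] p"
proof -
  obtain k where "\<Sum>{..<p} = p * k" using odd_dvd_sum_lessThan[OF assms(7)] by blast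
  then have "z [^] (\<Sum>{..<p}) = \<one>" using assms by (simp add: nat_pow_pow[symmetric])
  then show ?thesis using pow_mult_central_commutator[OF assms(1-6), of p] assms by simp
qed

text \<open>With \<open>m = 1 + p v\<close> the binomial expansion gives
  \<open>m^i = 1 + p v i\<close> modulo \<open>p^2\<close>, and
  \<open>p v (0 + ... + (p - 1))\<close> vanishes modulo \<open>p^2\<close> because \<open>p\<close>
  is odd. The point is that \<open>p\<close> divides the sum exactly once.\<close>

lemma geometric_sum_cong_prime_square:
  fixes p m :: nat
  assumes "odd p" "[m = 1] (mod p)" "p > 1"
  shows "[(\<Sum>i<p. m ^ i) = p] (mod p\<^sup>2)"
proof -
  have "m \<ge> 1" using assms by (cases m) (auto simp: cong_def)
  then obtain v where v: "m = 1 + p * v"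
    using assms(2) by (metis cong_altdef_nat cong_sym_eq dvdE le_add_diff_inverse)
  have e: "[m ^ i = 1 + p * v * i] (mod p\<^sup>2)" for i
  proof (induction i)
    case (Suc i)
    have "[m ^ Suc i = (1 + p * v) * (1 + p * v * i)] (mod p\<^sup>2)"
      unfolding power_Suc using Suc v by (intro cong_mult) auto
    also have "(1 + p * v) * (1 + p * v * i) = (1 + p * v * Suc i) + p\<^sup>2 * (v * v * i)"
      by (simp add: algebra_simps power2_eq_square)
    also have "[(1 + p * v * Suc i) + p\<^sup>2 * (v * v * i) = 1 + p * v * Suc i] (mod p\<^sup>2)"
      by (simp add: cong_def)
    finally show ?case .
  qed simp
  have "[(\<Sum>i<p. m ^ i) = (\<Sum>i<p. 1 + p * v * i)] (mod p\<^sup>2)"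
    by (intro cong_sum e)
  also have "(\<Sum>i<p. 1 + p * v * i) = p + p * v * \<Sum>{..<p}"
    unfolding sum.distrib sum_distrib_left by simp
  also obtain k where "\<Sum>{..<p} = p * k" using odd_dvd_sum_lessThan[OF assms(1)] by blast
  then have "p + p * v * \<Sum>{..<p} = p + p\<^sup>2 * (v * k)" by (simp add: power2_eq_square)
  also have "[p + p\<^sup>2 * (v * k) = p] (mod p\<^sup>2)" by (simp add: cong_def)
  finally show ?thesis .
qed

section \<open>Fixed-point-free abelian normal subgroups\<close>

text \<open>\<open>abelian_fpf\<close> speaks of \<open>b \<noteq> \<one>\<close>, not of
  \<open>b\<close> acting nontrivially, so commutator identities in the group can be compared
  directly with the action. Instances are accordingly built from the operators induced by
  \<open>P\<close> and \<open>Q\<close>.\<close>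

locale fpf_action = lin_action G T act q
  for G :: "('g, 'e) monoid_scheme" (structure) and T :: "('v, 'd) ring_scheme" and act and q :: nat +
  fixes p n :: nat and P Q :: "'g set"
  assumes prime_p: "Factorial_Ring.prime p" and odd_p: "odd p" and p_neq_q: "p \<noteq> q"
    and P: "subgroup P G" and card_P: "card P = p ^ n"
    and Q: "subgroup Q G" and Q_norm_P: "normalized_by Q P"
    and abelian_fpf: "\<lbrakk>subgroup B G; B \<subseteq> P; \<And>x y. x \<in> B \<Longrightarrow> y \<in> B \<Longrightarrow> x \<otimes> y = y \<otimes> x;
        normalized_by (P \<union> Q) B; b \<in> B; b \<noteq> \<one>; v \<in> carrier T; act b v = v\<rbrakk> \<Longrightarrow> v = \<zero>\<^bsub>T\<^esub>"
begin

abbreviation "S \<equiv> P \<union> Q"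

definition good :: "'g set \<Rightarrow> bool" where
  "good B \<longleftrightarrow> subgroup B G \<and> B \<subseteq> P \<and> (\<forall>x\<in>B. \<forall>y\<in>B. x \<otimes> y = y \<otimes> x) \<and> normalized_by S B"

lemma good_fpf: "good B \<Longrightarrow> b \<in> B \<Longrightarrow> b \<noteq> \<one> \<Longrightarrow> v \<in> carrier T \<Longrightarrow> act b v = v \<Longrightarrow> v = \<zero>\<^bsub>T\<^esub>"
  using abelian_fpf[of B b v] by (auto simp: good_def)

lemma Pc [simp]: "x \<in> P \<Longrightarrow> x \<in> carrier G" using P by (rule subgroup.mem_carrier)
lemma Sc [simp]: "x \<in> S \<Longrightarrow> x \<in> carrier G" using P Q by (auto dest: subgroup.mem_carrier)
lemma S_inv: "x \<in> S \<Longrightarrow> inv x \<in> S" using P Q by (auto dest: subgroup.m_inv_closed)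
lemma P_inv: "x \<in> P \<Longrightarrow> inv x \<in> P" using P by (rule subgroup.m_inv_closed)
lemma P_mult: "x \<in> P \<Longrightarrow> y \<in> P \<Longrightarrow> x \<otimes> y \<in> P" using P by (rule subgroup.m_closed)

lemma S_norm_P: "normalized_by S P"
  using Q_norm_P by (auto simp: normalized_by_def P_mult P_inv)

lemma conj_P: "g \<in> S \<Longrightarrow> x \<in> P \<Longrightarrow> g \<otimes> x \<otimes> inv g \<in> P"
  using S_norm_P by (rule normalized_byD)

lemma conj_inv_mem:
  assumes "normalized_by S B" "g \<in> S" "x \<in> B"
  shows "inv g \<otimes> x \<otimes> g \<in> B"
  using normalized_by_inv[OF P Q assms] .

lemma finite_P: "finite P"
  using finite_G P subgroup.subset finite_subset by blast

lemma subgroup_card: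
  assumes "subgroup B G" "B \<subseteq> P"
  shows "\<exists>i. card B = p ^ i" "\<not> q dvd card B"
proof -
  have "card B dvd p ^ n" using subgroup_card_dvd[OF assms(1) P assms(2)] card_P by simp
  then show 1: "\<exists>i. card B = p ^ i" using prime_p by (auto simp: divides_primepow_nat)
  then show "\<not> q dvd card B" using prime_q prime_p p_neq_q
    by (metis prime_dvd_power primes_dvd_imp_eq)
qed

lemma comm_conj:
  assumes "g \<in> carrier G" "x \<in> carrier G" "y \<in> carrier G" "x \<otimes> (inv g \<otimes> y \<otimes> g) = (inv g \<otimes> y \<otimes> g) \<otimes> x"
  shows "(g \<otimes> x \<otimes> inv g) \<otimes> y = y \<otimes> (g \<otimes> x \<otimes> inv g)"
proof -
  have "(g \<otimes> x \<otimes> inv g) \<otimes> y = g \<otimes> (x \<otimes> (inv g \<otimes> y \<otimes> g)) \<otimes> inv g" using assms(1-3) by (simp add: grp_simps)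
  also have "\<dots> = y \<otimes> (g \<otimes> x \<otimes> inv g)" unfolding assms(4) using assms(1-3) by (simp add: grp_simps)
  finally show ?thesis .
qed

lemma comm_mult:
  assumes "x \<in> carrier G" "y \<in> carrier G" "z \<in> carrier G" "x \<otimes> z = z \<otimes> x" "y \<otimes> z = z \<otimes> y"
  shows "(x \<otimes> y) \<otimes> z = z \<otimes> (x \<otimes> y)"
  using assms by (metis m_assoc)

lemma comm_inv:
  assumes "x \<in> carrier G" "z \<in> carrier G" "x \<otimes> z = z \<otimes> x"
  shows "inv x \<otimes> z = z \<otimes> inv x"
  using assms by (metis inv_closed inv_solve_left inv_solve_right m_assoc m_closed)

definition cent :: "'g set \<Rightarrow> 'g set \<Rightarrow> 'g set" where
  "cent K Y = {k \<in> K. \<forall>y\<in>Y. k \<otimes> y = y \<otimes> k}"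

lemma centD: "k \<in> cent K Y \<Longrightarrow> k \<in> K" "k \<in> cent K Y \<Longrightarrow> y \<in> Y \<Longrightarrow> k \<otimes> y = y \<otimes> k"
  by (auto simp: cent_def)

lemma cent_subgroup:
  assumes K: "subgroup K G" and Y: "Y \<subseteq> carrier G"
  shows "subgroup (cent K Y) G"
proof (rule subgroupI)
  note c = subgroup.mem_carrier[OF K]
  show "cent K Y \<subseteq> carrier G" using c by (auto simp: cent_def)
  have "\<one> \<in> cent K Y" using Y K by (auto simp: cent_def subgroup.one_closed)
  then show "cent K Y \<noteq> {}" by blast
  show "inv x \<in> cent K Y" if "x \<in> cent K Y" for x
    using that Y c K comm_inv by (auto simp: cent_def subgroup.m_inv_closed)
  show "x \<otimes> y \<in> cent K Y" if "x \<in> cent K Y" "y \<in> cent K Y" for x y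
    using that Y c K comm_mult by (auto simp: cent_def subgroup.m_closed)
qed

lemma cent_normalized:
  assumes "normalized_by S K" "normalized_by S Y" "K \<subseteq> carrier G" "Y \<subseteq> carrier G"
  shows "normalized_by S (cent K Y)"
  unfolding normalized_by_def
proof (intro ballI)
  fix g x assume g: "g \<in> S" and x: "x \<in> cent K Y"
  have xK: "x \<in> K" using x by (rule centD)
  have "(g \<otimes> x \<otimes> inv g) \<otimes> y = y \<otimes> (g \<otimes> x \<otimes> inv g)" if y: "y \<in> Y" for y
    using comm_conj[OF Sc[OF g], of x y] assms(3,4) xK y centD(2)[OF x conj_inv_mem[OF assms(2) g y]] by blast
  moreover have "g \<otimes> x \<otimes> inv g \<in> K" using normalized_byD[OF assms(1) g xK] .
  ultimately show "g \<otimes> x \<otimes> inv g \<in> cent K Y" by (auto simp: cent_def)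
qed

text \<open>Maximality and cyclicity apply only to abelian subgroups; passing to the centre makes
  them usable for the nonabelian \<open>Y\<close> and \<open>L\<close> below.\<close>

lemma centre_good:
  assumes "subgroup Y G" "Y \<subseteq> P" "normalized_by S Y"
  shows "good (cent Y Y)"
  unfolding good_def
proof (intro conjI ballI)
  show "cent Y Y \<subseteq> P" using assms(2) centD(1) by blast
  show "x \<otimes> y = y \<otimes> x" if "x \<in> cent Y Y" "y \<in> cent Y Y" for x y
    using centD(2)[OF that(1) centD(1)[OF that(2)]] .
qed (use assms cent_subgroup cent_normalized subgroup.subset[OF assms(1)] in blast)+

lemma max_good:
  obtains A where "good A" "\<And>B. good B \<Longrightarrow> A \<subseteq> B \<Longrightarrow> B = A"
proof -
  have fin: "finite {B. good B}"
    by (rule finite_subset[of _ "Pow P"]) (auto simp: good_def finite_P)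
  have "good {\<one>}" using P by (auto simp: good_def normalized_by_def triv_subgroup subgroup.one_closed)
  then obtain A where "A \<in> {B. good B}" "\<forall>B\<in>{B. good B}. A \<subseteq> B \<longrightarrow> A = B"
    using finite_has_maximal[OF fin] by blast
  then show ?thesis using that by blast
qed

lemma good_order_p_unique:
  assumes B: "good B" and b: "b \<in> B" "b [^] p = \<one>" "b \<noteq> \<one>" and d: "d \<in> B" "d [^] p = \<one>"
    and v: "v \<in> carrier T" "v \<noteq> \<zero>\<^bsub>T\<^esub>"
  shows "\<exists>i::nat. d = b [^] i"
proof (rule fpf_order_p_unique[OF prime_p p_neq_q _ b(2,3) _ d(2) _ _ v])
  have sB: "subgroup B G" using B by (simp add: good_def)
  show c: "b \<in> carrier G" "d \<in> carrier G" using b d subgroup.mem_carrier[OF sB] by auto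
  show "b \<otimes> d = d \<otimes> b" using B b d by (auto simp: good_def)
  have pow: "x [^] (i::nat) \<in> B" if "x \<in> B" for x i
    using that sB by (induction i) (auto simp: subgroup.one_closed subgroup.m_closed)
  fix i j :: nat and u assume "d [^] i \<otimes> b [^] j \<noteq> \<one>" "u \<in> carrier T" "act (d [^] i \<otimes> b [^] j) u = u"
  then show "u = \<zero>\<^bsub>T\<^esub>" using good_fpf[OF B subgroup.m_closed[OF sB pow[OF d(1)] pow[OF b(1)]]] by blast
qed

text \<open>Fixed-point-freeness leaves room for only one subgroup of order \<open>p\<close>. The
  nonzero \<open>v\<close> is needed as a vector on which the trace argument can fail.\<close>

lemma good_cyclic:
  assumes "good A" and v: "v \<in> carrier T" "v \<noteq> \<zero>\<^bsub>T\<^esub>"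
  shows "\<exists>a\<in>A. \<forall>x\<in>A. \<exists>i::nat. x = a [^] i"
proof -
  have A: "subgroup A G" "A \<subseteq> P" using assms by (auto simp: good_def)
  then obtain i where i: "card A = p ^ i" using subgroup_card by blast
  show ?thesis
  proof (rule abelian_p_group_cyclic[OF finite_G A(1) i prime_p])
    show "\<And>x y. x \<in> A \<Longrightarrow> y \<in> A \<Longrightarrow> x \<otimes> y = y \<otimes> x" using assms by (auto simp: good_def)
  qed (use good_order_p_unique[OF assms(1) _ _ _ _ _ v] in blast)
qed

text \<open>Write \<open>K\<close> for the centralizer of \<open>A\<close> and let \<open>Y\<close>
  be its part that is central in \<open>P\<close> modulo \<open>A\<close>. The centre of
  \<open>Y\<close> is good and contains \<open>A\<close>, so it equals \<open>A\<close> by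
  maximality. If the centralizer \<open>D\<close> of \<open>Y\<close> in \<open>K\<close> exceeded
  \<open>A\<close>, it would contain an element outside \<open>A\<close> that is central in
  \<open>P\<close> modulo \<open>A\<close>; this lies in \<open>Y\<close> and centralizes
  \<open>Y\<close>, hence lies in \<open>A\<close> after all. So \<open>D = A\<close>, and
  \<open>twisted_complement\<close> factors every \<open>k\<close> in \<open>K\<close> as an element
  of \<open>D\<close> times one of \<open>Y\<close>, whence \<open>K = Y\<close>.\<close>

lemma centralizer_commutators:
  assumes A: "good A" "\<And>B. good B \<Longrightarrow> A \<subseteq> B \<Longrightarrow> B = A" and v: "v \<in> carrier T" "v \<noteq> \<zero>\<^bsub>T\<^esub>"
    and k: "k \<in> cent P A" and g: "g \<in> P"
  shows "g \<otimes> k \<otimes> inv g \<otimes> inv k \<in> A"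
proof -
  have sA: "subgroup A G" and AP: "A \<subseteq> P" and Acomm: "\<And>x y. x \<in> A \<Longrightarrow> y \<in> A \<Longrightarrow> x \<otimes> y = y \<otimes> x"
    and nA: "normalized_by S A" using A by (auto simp: good_def)
  note Ac = subgroup.mem_carrier[OF sA]
  define K where "K = cent P A"
  have sK: "subgroup K G" unfolding K_def using P sA by (intro cent_subgroup) (auto dest: Ac)
  have KP: "K \<subseteq> P" by (auto simp: K_def cent_def)
  have nK: "normalized_by S K" unfolding K_def using S_norm_P nA Ac by (intro cent_normalized) auto
  have Kc: "x \<in> carrier G" if "x \<in> K" for x using that KP by auto
  have KA: "x \<otimes> y = y \<otimes> x" if "x \<in> K" "y \<in> A" for x y using that by (auto simp: K_def cent_def)
  have AK: "A \<subseteq> K" using AP Acomm by (auto simp: K_def cent_def)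
  define Y where "Y = {y \<in> K. \<forall>g\<in>P. g \<otimes> y \<otimes> inv g \<otimes> inv y \<in> A}"
  have YK: "Y \<subseteq> K" by (auto simp: Y_def)
  have Yc: "x \<in> carrier G" if "x \<in> Y" for x using that YK Kc by auto
  have nAP: "normalized_by P A" using nA by (auto simp: normalized_by_def)
  have sY: "subgroup Y G" unfolding Y_def using commutator_preimage_subgroup[OF P sK KP sA nAP] .
  have nY: "normalized_by S Y" unfolding Y_def using commutator_preimage_normalized[OF P Q sK S_norm_P nK nA] .
  have AY: "A \<subseteq> Y"
  proof
    fix x assume x: "x \<in> A"
    have "g \<otimes> x \<otimes> inv g \<otimes> inv x \<in> A" if "g \<in> P" for g
      using normalized_byD[OF nA _ x, of g] that x sA by (simp add: subgroup.m_closed subgroup.m_inv_closed)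
    then show "x \<in> Y" using x AK by (auto simp: Y_def)
  qed
  have "good (cent Y Y)" using sY YK KP nY by (intro centre_good) auto
  moreover have "A \<subseteq> cent Y Y" using AY YK KA by (force simp: cent_def)
  ultimately have ZY: "cent Y Y = A" using A(2) by blast
  define D where "D = cent K Y"
  have sD: "subgroup D G" unfolding D_def using sK Yc by (intro cent_subgroup) auto
  have nD: "normalized_by S D" unfolding D_def using nK nY Kc Yc by (intro cent_normalized) auto
  have AD: "A \<subseteq> D" using AK YK KA by (force simp: cent_def D_def)
  have DA: "D = A"
  proof (rule ccontr)
    assume "D \<noteq> A"
    have DP: "D \<subseteq> P" using KP by (auto simp: D_def cent_def)
    obtain d where d: "d \<in> D" "d \<notin> A" "\<And>g. g \<in> P \<Longrightarrow> g \<otimes> d \<otimes> inv g \<otimes> inv d \<in> A"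
      using p_group_central_element[OF P card_P prime_p sD DP sA AD] \<open>D \<noteq> A\<close> nD nA
      by (auto simp: normalized_by_def)
    then have "d \<in> cent Y Y" by (auto simp: Y_def D_def cent_def)
    then show False using ZY d by blast
  qed
  have kK: "k \<in> K" using k by (simp add: K_def)
  have "\<exists>y0\<in>Y. \<forall>y\<in>Y. (k \<otimes> inv y0) \<otimes> y = y \<otimes> (k \<otimes> inv y0)"
  proof (rule twisted_complement[OF sY _ sA AY Kc[OF kK] _ _ _ _ _ _ v])
    show "\<not> q dvd card Y" using subgroup_card(2)[OF sY] YK KP by blast
    show "a \<otimes> y = y \<otimes> a" if "a \<in> A" "y \<in> Y" for a y using that KA YK by (metis subsetD)
    show "a \<otimes> k = k \<otimes> a" if "a \<in> A" for a using that KA kK by metis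
    have com: "inv y \<otimes> z \<otimes> y \<otimes> inv z \<in> A" if y: "y \<in> Y" and z: "z \<in> K" for y z
    proof -
      define \<alpha> where "\<alpha> = z \<otimes> y \<otimes> inv z \<otimes> inv y"
      have \<alpha>: "\<alpha> \<in> A" using y z KP by (auto simp: \<alpha>_def Y_def)
      have "inv y \<otimes> z \<otimes> y \<otimes> inv z = inv y \<otimes> (\<alpha> \<otimes> y)"
        unfolding \<alpha>_def using Yc[OF y] Kc[OF z] by (simp add: grp_simps)
      also have "\<dots> = \<alpha>" using KA[of y \<alpha>] \<alpha> y YK Yc[OF y] Ac[OF \<alpha>]
        by (metis inv_cancel_simps(1) subsetD)
      finally show ?thesis using \<alpha> by simp
    qed
    then show "inv y \<otimes> k \<otimes> y \<otimes> inv k \<in> A" if "y \<in> Y" for y using kK that by blast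
    show "inv y \<otimes> z \<otimes> y \<otimes> inv z \<in> A" if "y \<in> Y" "z \<in> Y" for y z using com that YK by blast
    show "y \<in> A" if "y \<in> Y" "\<And>z. z \<in> Y \<Longrightarrow> y \<otimes> z = z \<otimes> y" for y
      using that ZY by (auto simp: cent_def)
  qed (use good_fpf[OF A(1)] in blast)
  then obtain y0 where y0: "y0 \<in> Y" "\<And>y. y \<in> Y \<Longrightarrow> (k \<otimes> inv y0) \<otimes> y = y \<otimes> (k \<otimes> inv y0)" by blast
  have "k \<otimes> inv y0 \<in> K" using sK kK y0 YK by (auto simp: subgroup.m_closed subgroup.m_inv_closed)
  then have "k \<otimes> inv y0 \<in> D" using y0 by (auto simp: D_def cent_def)
  then have "(k \<otimes> inv y0) \<otimes> y0 \<in> Y" using DA AY y0 sY by (auto simp: subgroup.m_closed)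
  moreover have "(k \<otimes> inv y0) \<otimes> y0 = k" using Kc[OF kK] Yc[OF y0(1)] by (simp add: grp_simps)
  ultimately have "k \<in> Y" by simp
  then show ?thesis using g by (auto simp: Y_def)
qed

lemma P_ord: "x \<in> P \<Longrightarrow> \<exists>i. ord x = p ^ i"
proof -
  assume x: "x \<in> P"
  have "x [^] card P = \<one>"
    using group.pow_order_eq_1[OF subgroup_imp_group[OF P], of x] x
    by (simp add: order_def nat_pow_consistent[symmetric])
  then have "ord x dvd p ^ n" using pow_eq_id[of x] x card_P by simp
  then show ?thesis using prime_p by (auto simp: divides_primepow_nat)
qed

lemma order_p_power:
  assumes "x \<in> P" "x \<noteq> \<one>"
  obtains i :: nat where "x [^] i \<noteq> \<one>" "(x [^] i) [^] p = \<one>"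
proof -
  obtain k where k: "ord x = p ^ k" using P_ord assms by blast
  have k0: "k \<noteq> 0" using assms k ord_eq_1[of x] by (metis Pc power_0)
  have "\<not> p ^ k dvd p ^ (k - 1)"
    using k0 power_dvd_imp_le[OF _ prime_gt_1_nat[OF prime_p], of k "k - 1"] by auto
  then have "x [^] (p ^ (k - 1)) \<noteq> \<one>" using pow_eq_id[of x] assms k by simp
  moreover have "(x [^] (p ^ (k - 1))) [^] p = \<one>"
    using assms k k0 pow_ord_eq_1[of x] by (simp add: nat_pow_pow power_eq_if mult.commute)
  ultimately show ?thesis using that by blast
qed

lemma pow_eq_iff_cong:
  assumes "x \<in> carrier G"
  shows "x [^] (i::nat) = x [^] (j::nat) \<longleftrightarrow> [i = j] (mod ord x)"
proof -
  have "x [^] i = x [^] j \<longleftrightarrow> x [^] int i = x [^] int j" by (simp add: int_pow_int)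
  also have "\<dots> \<longleftrightarrow> int (ord x) dvd int j - int i" using assms by (rule int_pow_eq)
  also have "\<dots> \<longleftrightarrow> [i = j] (mod ord x)" by (metis cong_iff_dvd_diff cong_int_iff cong_sym)
  finally show ?thesis .
qed

lemma subgroup_pow: "subgroup B G \<Longrightarrow> x \<in> B \<Longrightarrow> x [^] (i::nat) \<in> B"
  by (induction i) (auto simp: subgroup.one_closed subgroup.m_closed)

lemma conj_pow: "g \<in> carrier G \<Longrightarrow> x \<in> carrier G \<Longrightarrow> g \<otimes> x [^] (i::nat) \<otimes> inv g = (g \<otimes> x \<otimes> inv g) [^] i"
proof (induction i)
  case (Suc i)
  have "g \<otimes> x [^] Suc i \<otimes> inv g = (g \<otimes> x [^] i \<otimes> inv g) \<otimes> (g \<otimes> x \<otimes> inv g)"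
    using Suc.prems by (simp add: grp_simps)
  then show ?case using Suc by simp
qed simp

text \<open>Conjugation raises a generator of the cyclic group \<open>A\<close> to some power, and
  the same exponent then serves for every element.\<close>

lemma good_conj_pow:
  assumes A: "good A" and v: "v \<in> carrier T" "v \<noteq> \<zero>\<^bsub>T\<^esub>" and g: "g \<in> S"
  obtains m :: nat where "\<And>x. x \<in> A \<Longrightarrow> g \<otimes> x \<otimes> inv g = x [^] m"
proof -
  have sA: "subgroup A G" and nA: "normalized_by S A" using A by (auto simp: good_def)
  obtain a where a: "a \<in> A" "\<And>x. x \<in> A \<Longrightarrow> \<exists>i::nat. x = a [^] i" using good_cyclic[OF A v] by blast
  have ac: "a \<in> carrier G" using a sA subgroup.mem_carrier by metis
  obtain m :: nat where m: "g \<otimes> a \<otimes> inv g = a [^] m" using a(2)[OF normalized_byD[OF nA g a(1)]] by blast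
  have "g \<otimes> x \<otimes> inv g = x [^] m" if x: "x \<in> A" for x
  proof -
    obtain i :: nat where i: "x = a [^] i" using a(2)[OF x] by blast
    have "g \<otimes> x \<otimes> inv g = (a [^] m) [^] i" unfolding i m[symmetric] using conj_pow[OF Sc[OF g] ac] .
    then show ?thesis unfolding i using ac by (simp add: nat_pow_pow mult.commute)
  qed
  then show ?thesis using that by blast
qed

text \<open>Automorphisms of a cyclic group are power maps and commute with one another. So
  \<open>c\<close> and its conjugate by \<open>g\<close> induce the same power map on
  \<open>A\<close>, and their quotient centralizes \<open>A\<close>.\<close>

lemma commutator_centralizes_good:
  assumes A: "good A" and v: "v \<in> carrier T" "v \<noteq> \<zero>\<^bsub>T\<^esub>" and g: "g \<in> S" and c: "c \<in> P"
  shows "inv c \<otimes> (g \<otimes> c \<otimes> inv g) \<in> cent P A"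
proof -
  have sA: "subgroup A G" and nA: "normalized_by S A" using A by (auto simp: good_def)
  note Ac = subgroup.mem_carrier[OF sA]
  note gc = Sc[OF g] and cc = Pc[OF c]
  have cS: "c \<in> S" using c by simp
  obtain m :: nat where m: "\<And>x. x \<in> A \<Longrightarrow> c \<otimes> x \<otimes> inv c = x [^] m" using good_conj_pow[OF A v cS] by blast
  have "inv c \<otimes> (g \<otimes> c \<otimes> inv g) \<otimes> x = x \<otimes> (inv c \<otimes> (g \<otimes> c \<otimes> inv g))" if x: "x \<in> A" for x
  proof -
    define x' where "x' = inv g \<otimes> x \<otimes> g"
    have x': "x' \<in> A" unfolding x'_def using conj_inv_mem[OF nA g x] .
    have xc: "x \<in> carrier G" using Ac[OF x] .
    have "(g \<otimes> c \<otimes> inv g) \<otimes> x \<otimes> inv (g \<otimes> c \<otimes> inv g) = g \<otimes> (c \<otimes> x' \<otimes> inv c) \<otimes> inv g"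
      unfolding x'_def using gc cc xc by (simp add: grp_simps)
    also have "\<dots> = (g \<otimes> x' \<otimes> inv g) [^] m" unfolding m[OF x'] using conj_pow[OF gc Ac[OF x']] .
    also have "g \<otimes> x' \<otimes> inv g = x" unfolding x'_def using gc xc by (simp add: grp_simps)
    also have "x [^] m = c \<otimes> x \<otimes> inv c" using m[OF x] by simp
    finally have "(g \<otimes> c \<otimes> inv g) \<otimes> x = (c \<otimes> x \<otimes> inv c) \<otimes> (g \<otimes> c \<otimes> inv g)"
      using gc cc xc by (metis inv_solve_right inv_closed m_closed)
    then show ?thesis using gc cc xc by (simp add: grp_simps)
  qed
  moreover have "inv c \<otimes> (g \<otimes> c \<otimes> inv g) \<in> P" using c conj_P[OF g c] by (simp add: P_mult P_inv)
  ultimately show ?thesis by (auto simp: cent_def)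
qed

text \<open>The element \<open>e\<close> acts on the cyclic group \<open>A\<close> by an exponent
  \<open>m\<close> that is 1 modulo \<open>p\<close> unless \<open>A\<close> is trivial. This
  settles the elements of order \<open>p\<close>; for the commutators,
  \<open>e [^] p = \<one>\<close> yields a relation whose exponent is a geometric sum in
  \<open>m\<close>.\<close>

lemma order_p_commutators:
  assumes A: "good A" "\<And>B. good B \<Longrightarrow> A \<subseteq> B \<Longrightarrow> B = A" and v: "v \<in> carrier T" "v \<noteq> \<zero>\<^bsub>T\<^esub>"
    and e: "e \<in> P" "e [^] p = \<one>"
  shows "k \<in> cent P A \<Longrightarrow> (e \<otimes> k \<otimes> inv e \<otimes> inv k) [^] p = \<one>"
    and "z \<in> A \<Longrightarrow> z [^] p = \<one> \<Longrightarrow> e \<otimes> z = z \<otimes> e"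
proof -
  have sA: "subgroup A G" and AP: "A \<subseteq> P" using A by (auto simp: good_def)
  note Ac = subgroup.mem_carrier[OF sA]
  note ec = Pc[OF e(1)]
  have eS: "e \<in> S" using e by simp
  obtain m :: nat where m: "\<And>x. x \<in> A \<Longrightarrow> e \<otimes> x \<otimes> inv e = x [^] m" using good_conj_pow[OF A(1) v eS] by blast
  have powm: "e [^] j \<otimes> x \<otimes> inv (e [^] j) = x [^] (m ^ j)" if x: "x \<in> A" for x and j :: nat
  proof (induction j)
    case (Suc j)
    have "e [^] Suc j \<otimes> x \<otimes> inv (e [^] Suc j) = e [^] j \<otimes> (e \<otimes> x \<otimes> inv e) \<otimes> inv (e [^] j)"
      using ec Ac[OF x] by (simp add: grp_simps)
    also have "\<dots> = (x [^] (m ^ j)) [^] m"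
      unfolding m[OF x] conj_pow[OF nat_pow_closed[OF ec] Ac[OF x]] Suc ..
    finally show ?case using Ac[OF x] by (simp add: nat_pow_pow mult.commute)
  qed (use Ac[OF x] in simp)
  \<comment> \<open>From \<open>e [^] p = \<one>\<close> comes \<open>m^p = 1\<close> modulo
    \<open>ord x\<close>, hence modulo \<open>p\<close>; Fermat's theorem gives
    \<open>m^p = m\<close> modulo \<open>p\<close>.\<close>
  have m1: "[m = 1] (mod p)" if x: "x \<in> A" "x \<noteq> \<one>" for x
  proof -
    have xc: "x \<in> carrier G" using Ac x by simp
    obtain i where i: "ord x = p ^ i" using P_ord x AP by blast
    have "i \<noteq> 0" using x i ord_eq_1[OF xc] by (metis power_0)
    then have pd: "p dvd ord x" using i by simp
    have "x [^] (m ^ p) = x" using powm[OF x(1), of p] e xc by simp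
    moreover have "x [^] (m ^ p) = x [^] (1::nat) \<longleftrightarrow> [m ^ p = 1] (mod ord x)"
      using pow_eq_iff_cong xc by blast
    ultimately have "[m ^ p = 1] (mod ord x)" using xc by simp
    then have c1: "[m ^ p = 1] (mod p)" using pd cong_dvd_modulus_nat by blast
    have "\<not> p dvd m"
    proof
      assume "p dvd m"
      then have "p dvd m ^ p" using prime_gt_0_nat[OF prime_p] by (meson dvd_power dvd_trans)
      then have "p dvd 1" using c1 cong_dvd_iff by blast
      then show False using prime_gt_1_nat[OF prime_p] by simp
    qed
    from fermat_theorem[OF prime_p this] have "[m ^ (p - 1) * m = 1 * m] (mod p)" by (intro cong_mult) auto
    moreover have "m ^ (p - 1) * m = m ^ p" using prime_gt_0_nat[OF prime_p] by (metis power_minus_mult)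
    ultimately have "[m ^ p = m] (mod p)" by simp
    with c1 show ?thesis by (metis cong_sym cong_trans)
  qed
  show "e \<otimes> z = z \<otimes> e" if z: "z \<in> A" "z [^] p = \<one>"
  proof (cases "z = \<one>")
    case False
    have zc: "z \<in> carrier G" using Ac z by simp
    have "ord z dvd p" using z pow_eq_id[OF zc] by simp
    then have "[m = 1] (mod ord z)" using m1[OF z(1) False] cong_dvd_modulus_nat by blast
    then have "z [^] m = z [^] (1::nat)" using pow_eq_iff_cong zc by blast
    then have "e \<otimes> z \<otimes> inv e = z" using m[OF z(1)] zc by simp
    then show ?thesis using ec zc by (metis inv_solve_right m_closed)
  qed (use ec in simp)
  show "(e \<otimes> k \<otimes> inv e \<otimes> inv k) [^] p = \<one>" if k: "k \<in> cent P A"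
  proof -
    define t where "t = e \<otimes> k \<otimes> inv e \<otimes> inv k"
    have tA: "t \<in> A" unfolding t_def using centralizer_commutators[OF A v k e(1)] .
    have tc: "t \<in> carrier G" using Ac tA by simp
    have kc: "k \<in> carrier G" using k centD(1) Pc by blast
    have ek: "e \<otimes> k \<otimes> inv e = t \<otimes> k" unfolding t_def using ec kc by (simp add: grp_simps)
    \<comment> \<open>Each further conjugation by \<open>e\<close> raises the factor from
      \<open>A\<close> to the power \<open>m\<close> and contributes one more \<open>t\<close>, so
      the exponent \<open>s\<close> becomes \<open>m s + 1\<close>.\<close>
    have iter: "e [^] j \<otimes> k \<otimes> inv (e [^] j) = t [^] (\<Sum>i<j. m ^ i) \<otimes> k" for j :: nat
    proof (induction j)
      case (Suc j)
      let ?s = "\<Sum>i<j. m ^ i"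
      have "e [^] Suc j \<otimes> k \<otimes> inv (e [^] Suc j) = e \<otimes> (e [^] j \<otimes> k \<otimes> inv (e [^] j)) \<otimes> inv e"
        using ec kc nat_pow_Suc2[OF ec, of j] by (simp add: grp_simps del: nat_pow_Suc)
      also have "\<dots> = (e \<otimes> t [^] ?s \<otimes> inv e) \<otimes> (e \<otimes> k \<otimes> inv e)"
        unfolding Suc using ec kc tc by (simp add: grp_simps)
      also have "\<dots> = (t [^] m) [^] ?s \<otimes> (t \<otimes> k)"
        unfolding ek conj_pow[OF ec tc] m[OF tA] ..
      also have "\<dots> = t [^] (m * ?s + 1) \<otimes> k"
        using tc kc by (simp add: nat_pow_pow m_assoc)
      also have "m * ?s + 1 = (\<Sum>i<Suc j. m ^ i)"
        by (simp add: sum.lessThan_Suc_shift sum_distrib_left del: sum.lessThan_Suc)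
      finally show ?case .
    qed (use kc in simp)
    from iter[of p] have "t [^] (\<Sum>i<p. m ^ i) \<otimes> k = k" using e kc by simp
    then have ts: "t [^] (\<Sum>i<p. m ^ i) = \<one>" using tc kc by simp
    have "t [^] p = \<one>"
    proof (cases "t = \<one>")
      case False
      have cg: "[(\<Sum>i<p. m ^ i) = p] (mod p\<^sup>2)"
        using geometric_sum_cong_prime_square[OF odd_p m1[OF tA False] prime_gt_1_nat[OF prime_p]] .
      obtain i where i: "ord t = p ^ i" using P_ord tA AP by blast
      have od: "ord t dvd (\<Sum>i<p. m ^ i)" using ts pow_eq_id[OF tc] by simp
      \<comment> \<open>The geometric sum is \<open>p\<close> modulo \<open>p^2\<close>, so a power
        of \<open>p\<close> dividing it is at most \<open>p\<close>.\<close>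
      have "i < 2"
      proof (rule ccontr)
        assume "\<not> i < 2"
        then have "p\<^sup>2 dvd ord t" unfolding i by (simp add: le_imp_power_dvd)
        then have "p\<^sup>2 dvd (\<Sum>i<p. m ^ i)" using od dvd_trans by blast
        then have "p\<^sup>2 dvd p" using cg cong_dvd_iff by blast
        then have "p\<^sup>2 \<le> p" using prime_gt_0_nat[OF prime_p] dvd_imp_le by blast
        then show False using prime_gt_1_nat[OF prime_p] by (simp add: power2_eq_square)
      qed
      then have "ord t dvd p" unfolding i by (cases i) auto
      then show ?thesis using pow_eq_id[OF tc] by simp
    qed simp
    then show ?thesis by (simp add: t_def)
  qed
qed

theorem regular_fixed_vector:
  assumes w: "w \<in> carrier T" "w \<noteq> \<zero>\<^bsub>T\<^esub>" "\<And>x. x \<in> Q \<Longrightarrow> act x w = w"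
    and c0: "c0 \<in> P" "act c0 w = w"
  shows "c0 = \<one>"
proof (rule ccontr)
  assume c0_neq: "c0 \<noteq> \<one>"

  \<comment> \<open>A maximal good subgroup \<open>A\<close> and its centralizer
    \<open>K\<close>\<close>
  obtain A where A: "good A" "\<And>B. good B \<Longrightarrow> A \<subseteq> B \<Longrightarrow> B = A" using max_good by blast
  note v = w(1,2)
  have sA: "subgroup A G" and AP: "A \<subseteq> P" and Acomm: "\<And>x y. x \<in> A \<Longrightarrow> y \<in> A \<Longrightarrow> x \<otimes> y = y \<otimes> x"
    and nA: "normalized_by S A" using A by (auto simp: good_def)
  note Ac = subgroup.mem_carrier[OF sA] and Am = subgroup.m_closed[OF sA] and Ai = subgroup.m_inv_closed[OF sA]
  define K where "K = cent P A"
  have sK: "subgroup K G" unfolding K_def using P Ac by (intro cent_subgroup) auto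
  note Km = subgroup.m_closed[OF sK] and Ki = subgroup.m_inv_closed[OF sK] and Kc = subgroup.mem_carrier[OF sK]
  have KP: "K \<subseteq> P" by (auto simp: K_def cent_def)
  have nK: "normalized_by S K" unfolding K_def using S_norm_P nA Ac by (intro cent_normalized) auto
  have KA: "x \<otimes> y = y \<otimes> x" if "x \<in> K" "y \<in> A" for x y using that by (auto simp: K_def cent_def)
  have AK: "A \<subseteq> K" using AP Acomm by (auto simp: K_def cent_def)
  have PK: "g \<otimes> k \<otimes> inv g \<otimes> inv k \<in> A" if "k \<in> K" "g \<in> P" for k g
    using centralizer_commutators[OF A v] that unfolding K_def by blast

  \<comment> \<open>The stabilizer \<open>C\<close> of \<open>w\<close> meets \<open>K\<close>
    trivially\<close>
  define C where "C = {x \<in> P. act x w = w}"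
  have sC: "subgroup C G"
  proof (rule subgroupI)
    have "\<one> \<in> C" using P w by (auto simp: C_def subgroup.one_closed)
    then show "C \<noteq> {}" by blast
  qed (use w act_inv_fixed act_mult in \<open>auto simp: C_def P_inv P_mult\<close>)
  note Cm = subgroup.m_closed[OF sC] and Ci = subgroup.m_inv_closed[OF sC] and Cc = subgroup.mem_carrier[OF sC]
  have nC: "g \<otimes> x \<otimes> inv g \<in> C" if g: "g \<in> Q" and x: "x \<in> C" for g x
  proof -
    have gc: "g \<in> carrier G" using g by simp
    have "act (inv g) w = w" using act_inv_fixed[OF gc w(1) w(3)[OF g]] .
    then have "act (g \<otimes> x \<otimes> inv g) w = w" using gc Cc[OF x] x w(1) w(3)[OF g]
      by (simp add: act_mult C_def)
    then show ?thesis using conj_P[of g x] g x by (auto simp: C_def)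
  qed
  have good_C: "x = \<one>" if "good B" "x \<in> B" "x \<in> C" for B x
    using good_fpf[OF that(1,2) _ w(1)] that(3) w(2) by (auto simp: C_def)
  have CK: "x = \<one>" if x: "x \<in> C" "x \<in> K" for x
  proof -
    define B where "B = {x \<otimes> a | x a. x \<in> C \<inter> K \<and> a \<in> A}"
    have mem: "x \<otimes> a \<in> B" if "x \<in> C" "x \<in> K" "a \<in> A" for x a using that by (auto simp: B_def)
    \<comment> \<open>Commutators of elements of \<open>C \<inter> K\<close> lie in \<open>A\<close>
      by \<open>PK\<close> and fix \<open>w\<close>, so they are trivial. Hence the product of
      \<open>C \<inter> K\<close> with \<open>A\<close> is abelian.\<close>
    have Ccomm: "x \<otimes> y = y \<otimes> x" if x: "x \<in> C" "x \<in> K" and y: "y \<in> C" "y \<in> K" for x y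
    proof -
      have c: "x \<in> carrier G" "y \<in> carrier G" using x y Cc by auto
      have "x \<otimes> y \<otimes> inv x \<otimes> inv y \<in> A" using PK[OF y(2)] x KP by blast
      moreover have "x \<otimes> y \<otimes> inv x \<otimes> inv y \<in> C" using x y by (simp add: Cm Ci)
      ultimately have "x \<otimes> y \<otimes> inv x \<otimes> inv y = \<one>" using good_C[OF A(1)] by blast
      then have "x \<otimes> y \<otimes> inv x \<otimes> inv y \<otimes> (y \<otimes> x) = y \<otimes> x" using c by simp
      then show ?thesis using c by (simp add: grp_simps)
    qed
    have "good B"
      unfolding good_def
    proof (intro conjI)
      show "subgroup B G"
      proof (rule subgroupI)
        show "B \<subseteq> carrier G" using Cc Ac by (auto simp: B_def)
        show "B \<noteq> {}" using mem[of \<one> \<one>] sC sK sA by (auto simp: subgroup.one_closed)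
      next
        fix b assume "b \<in> B"
        then obtain x a where b: "b = x \<otimes> a" "x \<in> C" "x \<in> K" "a \<in> A" by (auto simp: B_def)
        have "inv b = inv x \<otimes> inv a" using b KA[OF b(3,4)] Cc[OF b(2)] Ac[OF b(4)] by (metis inv_mult_group)
        then show "inv b \<in> B" using mem b Ci Ki Ai by simp
      next
        fix b b' assume "b \<in> B" "b' \<in> B"
        then obtain x a x' a' where b: "b = x \<otimes> a" "x \<in> C" "x \<in> K" "a \<in> A"
          and b': "b' = x' \<otimes> a'" "x' \<in> C" "x' \<in> K" "a' \<in> A" by (auto simp: B_def)
        note c = Cc[OF b(2)] Ac[OF b(4)] Cc[OF b'(2)] Ac[OF b'(4)]
        have "b \<otimes> b' = x \<otimes> (a \<otimes> x') \<otimes> a'" unfolding b b' using c by (simp add: m_assoc)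
        also have "\<dots> = (x \<otimes> x') \<otimes> (a \<otimes> a')" unfolding KA[OF b'(3) b(4), symmetric] using c by (simp add: m_assoc)
        finally show "b \<otimes> b' \<in> B" using mem b b' Cm Km Am by simp
      qed
      show "B \<subseteq> P" using KP AP by (auto simp: B_def intro!: P_mult)
      show "\<forall>b\<in>B. \<forall>b'\<in>B. b \<otimes> b' = b' \<otimes> b"
      proof (intro ballI)
        fix b b' assume "b \<in> B" "b' \<in> B"
        then obtain x a x' a' where b: "b = x \<otimes> a" "x \<in> C" "x \<in> K" "a \<in> A"
          and b': "b' = x' \<otimes> a'" "x' \<in> C" "x' \<in> K" "a' \<in> A" by (auto simp: B_def)
        note c = Cc[OF b(2)] Ac[OF b(4)] Cc[OF b'(2)] Ac[OF b'(4)]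
        have "b \<otimes> b' = x \<otimes> (a \<otimes> x') \<otimes> a'" unfolding b b' using c by (simp add: m_assoc)
        also have "\<dots> = (x \<otimes> x') \<otimes> (a \<otimes> a')" unfolding KA[OF b'(3) b(4), symmetric] using c by (simp add: m_assoc)
        also have "\<dots> = (x' \<otimes> x) \<otimes> (a' \<otimes> a)" using Ccomm[OF b(2,3) b'(2,3)] Acomm[OF b(4) b'(4)] by simp
        also have "\<dots> = x' \<otimes> (x \<otimes> a') \<otimes> a" using c by (simp add: m_assoc)
        also have "\<dots> = b' \<otimes> b" unfolding KA[OF b(3) b'(4)] b b' using c by (simp add: m_assoc)
        finally show "b \<otimes> b' = b' \<otimes> b" .
      qed
      show "normalized_by S B"
        unfolding normalized_by_def
      proof (intro ballI)
        fix g b assume g: "g \<in> S" and "b \<in> B"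
        then obtain x a where b: "b = x \<otimes> a" "x \<in> C" "x \<in> K" "a \<in> A" by (auto simp: B_def)
        note c = Cc[OF b(2)] Ac[OF b(4)] Sc[OF g]
        have ga: "g \<otimes> a \<otimes> inv g \<in> A" using normalized_byD[OF nA g b(4)] .
        have e: "g \<otimes> b \<otimes> inv g = (g \<otimes> x \<otimes> inv g) \<otimes> (g \<otimes> a \<otimes> inv g)" unfolding b using c by (simp add: grp_simps)
        \<comment> \<open>\<open>Q\<close> normalizes \<open>C\<close> because it fixes
          \<open>w\<close>; an element of \<open>P\<close> changes members of \<open>K\<close> only
          by factors from \<open>A\<close>, which \<open>B\<close> absorbs.\<close>
        show "g \<otimes> b \<otimes> inv g \<in> B"
        proof (cases "g \<in> Q")
          case True
          then show ?thesis using e mem[OF nC[OF True b(2)] normalized_byD[OF nK g b(3)] ga] by simp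
        next
          case False
          then have gP: "g \<in> P" using g by simp
          define \<alpha> where "\<alpha> = g \<otimes> x \<otimes> inv g \<otimes> inv x"
          have \<alpha>: "\<alpha> \<in> A" unfolding \<alpha>_def using PK[OF b(3) gP] .
          have "g \<otimes> x \<otimes> inv g = \<alpha> \<otimes> x" unfolding \<alpha>_def using c by (simp add: grp_simps)
          also have "\<dots> = x \<otimes> \<alpha>" using KA[OF b(3) \<alpha>] by simp
          finally have "g \<otimes> b \<otimes> inv g = x \<otimes> (\<alpha> \<otimes> (g \<otimes> a \<otimes> inv g))"
            using e c Ac[OF \<alpha>] by (simp add: m_assoc)
          then show ?thesis using mem b \<alpha> ga Am by simp
        qed
      qed
    qed
    moreover have "x \<in> B" using mem[OF x subgroup.one_closed[OF sA]] Cc[OF x(1)] by simp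
    ultimately show ?thesis using good_C x by blast
  qed

  \<comment> \<open>An element \<open>c\<close> of order \<open>p\<close> in \<open>C\<close>, and
    the elements \<open>Z\<close> of order dividing \<open>p\<close> in \<open>A\<close>\<close>
  obtain i :: nat where i: "c0 [^] i \<noteq> \<one>" "(c0 [^] i) [^] p = \<one>" using order_p_power[OF c0(1) c0_neq] by blast
  define c where "c = c0 [^] i"
  have cC: "c \<in> C" unfolding c_def using c0 by (intro subgroup_pow[OF sC]) (simp add: C_def)
  have c: "c \<in> P" "c [^] p = \<one>" "c \<notin> K" "c \<in> carrier G" using i cC CK by (auto simp: c_def C_def)

  define Z where "Z = {x \<in> A. x [^] p = \<one>}"
  have sZ: "subgroup Z G"
  proof (rule subgroupI)
    have "\<one> \<in> Z" using sA by (auto simp: Z_def subgroup.one_closed)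
    then show "Z \<noteq> {}" by blast
    show "x \<otimes> y \<in> Z" if "x \<in> Z" "y \<in> Z" for x y
      using that Acomm[of x y] pow_mult_distrib[of x y p] Ac Am by (auto simp: Z_def)
  qed (use Ac Ai in \<open>auto simp: Z_def nat_pow_inv\<close>)
  have ZA: "Z \<subseteq> A" by (auto simp: Z_def)
  note Zm = subgroup.m_closed[OF sZ] and Zi = subgroup.m_inv_closed[OF sZ] and Zc = subgroup.mem_carrier[OF sZ]
  have nZ: "normalized_by S Z"
    unfolding normalized_by_def
  proof (intro ballI)
    fix g x assume g: "g \<in> S" and x: "x \<in> Z"
    have "(g \<otimes> x \<otimes> inv g) [^] p = \<one>" using conj_pow[OF Sc[OF g] Zc[OF x], of p] x Sc[OF g] by (auto simp: Z_def)
    then show "g \<otimes> x \<otimes> inv g \<in> Z" using normalized_byD[OF nA g] x by (auto simp: Z_def)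
  qed
  have ZK: "x \<otimes> z = z \<otimes> x" if "x \<in> K" "z \<in> Z" for x z using KA that ZA by blast
  have eZ: "e \<otimes> z = z \<otimes> e" if "e \<in> P" "e [^] p = \<one>" "z \<in> Z" for e z
    using order_p_commutators(2)[OF A v that(1,2)] that(3) by (auto simp: Z_def)
  have eK: "e \<otimes> k \<otimes> inv e \<otimes> inv k \<in> Z" if "e \<in> P" "e [^] p = \<one>" "k \<in> K" for e k
    using order_p_commutators(1)[OF A v that(1,2)] PK[OF that(3,1)] that(3) by (auto simp: Z_def K_def)
  \<comment> \<open>\<open>A\<close> is nontrivial because \<open>c\<close>, not being in
    \<open>K\<close>, fails to commute with some element of it.\<close>
  obtain z where z: "z \<in> Z" "z \<noteq> \<one>"
  proof -
    obtain a where a: "a \<in> A" "c \<otimes> a \<noteq> a \<otimes> c" using c by (auto simp: K_def cent_def)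
    then have "a \<noteq> \<one>" using c by auto
    then obtain j :: nat where "a [^] j \<noteq> \<one>" "(a [^] j) [^] p = \<one>" using order_p_power a AP by blast
    then show ?thesis using that[of "a [^] j"] subgroup_pow[OF sA a(1)] by (auto simp: Z_def)
  qed

  \<comment> \<open>The subgroup \<open>L\<close> of exponent \<open>p\<close> between
    \<open>Z\<close> and \<open>K\<close>\<close>
  have Zp: "x [^] p = \<one>" if "x \<in> Z" for x using that by (simp add: Z_def)
  \<comment> \<open>Requiring commutators in \<open>Z\<close>, which \<open>K\<close> centralizes,
    makes \<open>pow_p_mult\<close> applicable, so elements of order dividing \<open>p\<close> are
    closed under products. It also supplies the commutator hypotheses of
    \<open>twisted_complement\<close> for \<open>L\<close> and \<open>Z\<close>.\<close>
  define L where "L = {k \<in> K. k [^] p = \<one> \<and> (\<forall>x\<in>K. k \<otimes> x \<otimes> inv k \<otimes> inv x \<in> Z)}"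
  have Lp: "x [^] p = \<one>" if "x \<in> L" for x using that by (simp add: L_def)
  have LK: "L \<subseteq> K" by (auto simp: L_def)
  have Lc: "x \<in> carrier G" if "x \<in> L" for x using that LK Kc by blast
  have ZL: "Z \<subseteq> L"
  proof
    fix x assume x: "x \<in> Z"
    have "x \<otimes> y \<otimes> inv x \<otimes> inv y = \<one>" if "y \<in> K" for y
      using ZK[OF that x] Kc[OF that] Zc[OF x] by (metis m_assoc inv_closed m_closed r_inv inv_mult_group)
    moreover have "x \<in> K" "x [^] p = \<one>" using x ZA AK by (auto simp: Z_def)
    ultimately show "x \<in> L" using subgroup.one_closed[OF sZ] by (simp add: L_def)
  qed
  have sL: "subgroup L G"
  proof (rule subgroupI)
    show "L \<subseteq> carrier G" using Lc by blast
    show "L \<noteq> {}" using ZL z by blast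
  next
    fix k assume k: "k \<in> L"
    have kK: "k \<in> K" using k LK by blast
    have "inv k \<otimes> x \<otimes> inv (inv k) \<otimes> inv x \<in> Z" if x: "x \<in> K" for x
    proof -
      define t where "t = k \<otimes> x \<otimes> inv k \<otimes> inv x"
      have t: "t \<in> Z" "inv t \<in> Z" unfolding t_def using k x Zi by (auto simp: L_def)
      have "inv k \<otimes> x \<otimes> inv (inv k) \<otimes> inv x = inv k \<otimes> inv t \<otimes> k"
        unfolding t_def using Lc[OF k] Kc[OF x] by (simp add: grp_simps)
      also have "\<dots> = inv t" using ZK[OF kK t(2)] Lc[OF k] Zc[OF t(2)]
        by (metis inv_cancel_simps(1) m_assoc inv_closed)
      finally show ?thesis using t by simp
    qed
    then show "inv k \<in> L" using k Ki[OF kK] Lc[OF k] by (auto simp: L_def nat_pow_inv)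
  next
    fix k l assume k: "k \<in> L" and l: "l \<in> L"
    have kl: "k \<in> K" "l \<in> K" using k l LK by auto
    note kc = Lc[OF k] Lc[OF l]
    have "k \<otimes> l \<otimes> x \<otimes> inv (k \<otimes> l) \<otimes> inv x \<in> Z" if x: "x \<in> K" for x
    proof -
      define t where "t = l \<otimes> x \<otimes> inv l \<otimes> inv x"
      have t: "t \<in> Z" unfolding t_def using l x by (auto simp: L_def)
      have s: "k \<otimes> x \<otimes> inv k \<otimes> inv x \<in> Z" using k x by (auto simp: L_def)
      have "k \<otimes> l \<otimes> x \<otimes> inv (k \<otimes> l) \<otimes> inv x = (k \<otimes> t) \<otimes> (x \<otimes> inv k \<otimes> inv x)"
        unfolding t_def using kc Kc[OF x] by (simp add: grp_simps)
      also have "\<dots> = t \<otimes> (k \<otimes> x \<otimes> inv k \<otimes> inv x)"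
        unfolding ZK[OF kl(1) t] using kc Kc[OF x] Zc[OF t] by (simp add: m_assoc)
      finally show ?thesis using t s Zm by simp
    qed
    moreover have "(k \<otimes> l) [^] p = \<one>"
    proof -
      define t where "t = l \<otimes> k \<otimes> inv l \<otimes> inv k"
      have t: "t \<in> Z" unfolding t_def using l kl by (auto simp: L_def)
      have "l \<otimes> k = t \<otimes> k \<otimes> l" unfolding t_def using kc by (simp add: grp_simps)
      then have "(k \<otimes> l) [^] p = k [^] p \<otimes> l [^] p"
        using pow_p_mult[OF kc Zc[OF t] _ ZK[OF kl(1) t, symmetric] ZK[OF kl(2) t, symmetric] odd_p Zp[OF t]] by simp
      then show ?thesis using Lp k l by simp
    qed
    ultimately show "k \<otimes> l \<in> L" using Km kl by (auto simp: L_def)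
  qed
  have nL: "normalized_by S L"
    unfolding normalized_by_def
  proof (intro ballI)
    fix g k assume g: "g \<in> S" and k: "k \<in> L"
    note gc = Sc[OF g] and kc = Lc[OF k]
    have "g \<otimes> k \<otimes> inv g \<otimes> x \<otimes> inv (g \<otimes> k \<otimes> inv g) \<otimes> inv x \<in> Z" if x: "x \<in> K" for x
    proof -
      define x' where "x' = inv g \<otimes> x \<otimes> g"
      have "x' \<in> K" unfolding x'_def using conj_inv_mem[OF nK g x] .
      then have "k \<otimes> x' \<otimes> inv k \<otimes> inv x' \<in> Z" using k by (auto simp: L_def)
      from normalized_byD[OF nZ g this] show ?thesis
        unfolding x'_def using gc kc Kc[OF x] by (simp add: grp_simps)
    qed
    moreover have "(g \<otimes> k \<otimes> inv g) [^] p = \<one>" using conj_pow[OF gc kc, of p] k gc by (auto simp: L_def)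
    ultimately show "g \<otimes> k \<otimes> inv g \<in> L" using normalized_byD[OF nK g] k LK by (auto simp: L_def)
  qed
  have LP: "L \<subseteq> P" using LK KP by blast
  \<comment> \<open>The centre of \<open>L\<close> is good and contains \<open>z\<close>; since all
    elements of \<open>L\<close> have order dividing \<open>p\<close>, it consists of powers of
    \<open>z\<close>.\<close>
  have centL: "y \<in> Z" if y: "y \<in> L" "\<And>x. x \<in> L \<Longrightarrow> y \<otimes> x = x \<otimes> y" for y
  proof -
    have gd: "good (cent L L)" using centre_good[OF sL LP nL] .
    have "z \<in> cent L L" using z ZL LK ZK by (force simp: cent_def)
    moreover have "y \<in> cent L L" using y by (auto simp: cent_def)
    ultimately obtain i :: nat where "y = z [^] i"
      using good_order_p_unique[OF gd _ Zp[OF z(1)] z(2) _ Lp[OF y(1)] v] by blast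
    then show ?thesis using subgroup_pow[OF sZ z(1)] by simp
  qed

  \<comment> \<open>Correction of \<open>c\<close> to an element \<open>d\<close> of order
    \<open>p\<close> that centralizes \<open>L\<close>\<close>
  have "\<exists>y0\<in>L. \<forall>y\<in>L. (c \<otimes> inv y0) \<otimes> y = y \<otimes> (c \<otimes> inv y0)"
  proof (rule twisted_complement[OF sL _ sZ ZL c(4) _ _ _ _ centL _ v])
    show "\<not> q dvd card L" using subgroup_card(2)[OF sL LP] .
    show "a \<otimes> y = y \<otimes> a" if "a \<in> Z" "y \<in> L" for a y using that ZK LK by (metis subsetD)
    show "a \<otimes> c = c \<otimes> a" if "a \<in> Z" for a using that eZ c by metis
    show "inv y \<otimes> c \<otimes> y \<otimes> inv c \<in> Z" if y: "y \<in> L" for y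
    proof -
      define t where "t = c \<otimes> y \<otimes> inv c \<otimes> inv y"
      have yK: "y \<in> K" using y LK by blast
      have t: "t \<in> Z" unfolding t_def using eK[OF c(1,2) yK] .
      have "inv y \<otimes> c \<otimes> y \<otimes> inv c = inv y \<otimes> (t \<otimes> y)" unfolding t_def using c Lc[OF y] by (simp add: grp_simps)
      also have "\<dots> = t" unfolding ZK[OF yK t, symmetric] using Lc[OF y] Zc[OF t] by (simp add: grp_simps)
      finally show ?thesis using t by simp
    qed
    show "inv y \<otimes> x \<otimes> y \<otimes> inv x \<in> Z" if y: "y \<in> L" and x: "x \<in> L" for y x
    proof -
      have "inv y \<in> L" using subgroup.m_inv_closed[OF sL y] .
      then have "inv y \<otimes> x \<otimes> inv (inv y) \<otimes> inv x \<in> Z" using x LK by (auto simp: L_def)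
      then show ?thesis using Lc[OF y] by simp
    qed
    show "u = \<zero>\<^bsub>T\<^esub>" if "a \<in> Z" "a \<noteq> \<one>" "u \<in> carrier T" "act a u = u" for a u
      using good_fpf[OF A(1)] that ZA by blast
  qed
  then obtain k0 where k0: "k0 \<in> L" "\<And>y. y \<in> L \<Longrightarrow> (c \<otimes> inv k0) \<otimes> y = y \<otimes> (c \<otimes> inv k0)" by blast
  define d where "d = c \<otimes> inv k0"
  have k0K: "k0 \<in> K" "inv k0 \<in> K" "inv k0 \<in> L" using k0 LK Ki subgroup.m_inv_closed[OF sL] by auto
  note k0c = Lc[OF k0(1)]
  have dP: "d \<in> P" unfolding d_def using c k0K KP by (auto intro: P_mult)
  note dc = Pc[OF dP]
  have dK: "d \<notin> K"
  proof
    assume "d \<in> K"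
    then have "d \<otimes> k0 \<in> K" using k0K Km by blast
    moreover have "d \<otimes> k0 = c" unfolding d_def using c k0c by (simp add: grp_simps)
    ultimately show False using c by simp
  qed
  have dp: "d [^] p = \<one>"
  proof -
    \<comment> \<open>Up to inversion this is \<open>[c, k0^-1]\<close>, which lies in
      \<open>Z\<close> and commutes with both factors of \<open>d\<close>; thus \<open>p\<close>-th
      powers are multiplicative on them.\<close>
    define t where "t = inv (c \<otimes> inv k0 \<otimes> inv c \<otimes> inv (inv k0))"
    have t: "t \<in> Z" unfolding t_def using eK[OF c(1,2) k0K(2)] Zi by blast
    have "inv k0 \<otimes> c = t \<otimes> c \<otimes> inv k0" unfolding t_def using c k0c by (simp add: grp_simps)
    then have "d [^] p = c [^] p \<otimes> (inv k0) [^] p"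
      unfolding d_def
      using pow_p_mult[OF c(4) Kc[OF k0K(2)] Zc[OF t] _ eZ[OF c(1,2) t, symmetric] ZK[OF k0K(2) t, symmetric] odd_p Zp[OF t]]
      by simp
    then show ?thesis using c(2) Lp[OF k0K(3)] by simp
  qed
  have dL: "d \<otimes> y = y \<otimes> d" if "y \<in> L" for y unfolding d_def using k0(2)[OF that] .
  \<comment> \<open>The conjugate \<open>e\<close> of \<open>d\<close> again has order dividing
    \<open>p\<close> and centralizes \<open>L\<close>, as \<open>L\<close> is normalized. The
    quotient \<open>k\<close> of \<open>e\<close> by \<open>d\<close> lies in \<open>K\<close>, then
    in \<open>L\<close> because its commutators with \<open>K\<close> are products of those of
    \<open>e\<close> and \<open>d\<close>, and it centralizes \<open>L\<close>. So it lies in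
    \<open>Z\<close>.\<close>
  have conjd: "inv d \<otimes> (g \<otimes> d \<otimes> inv g) \<in> Z" if g: "g \<in> S" for g
  proof -
    note gc = Sc[OF g]
    define e where "e = g \<otimes> d \<otimes> inv g"
    define k where "k = inv d \<otimes> e"
    have eP: "e \<in> P" unfolding e_def using conj_P[OF g dP] .
    note ec = Pc[OF eP]
    have ep: "e [^] p = \<one>" unfolding e_def using conj_pow[OF gc dc, of p] dp gc by simp
    have kK: "k \<in> K" unfolding k_def e_def K_def using commutator_centralizes_good[OF A(1) v g dP] .
    note kc = Kc[OF kK]
    have idp: "inv d [^] p = \<one>" using dp dc by (simp add: nat_pow_inv)
    have kcom: "k \<otimes> x \<otimes> inv k \<otimes> inv x \<in> Z" if x: "x \<in> K" for x
    proof -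
      note xc = Kc[OF x]
      define t where "t = e \<otimes> x \<otimes> inv e \<otimes> inv x"
      have t: "t \<in> Z" unfolding t_def using eK[OF eP ep x] .
      define s where "s = inv d \<otimes> x \<otimes> inv (inv d) \<otimes> inv x"
      have s: "s \<in> Z" unfolding s_def using eK[OF P_inv[OF dP] idp x] .
      have "k \<otimes> x \<otimes> inv k \<otimes> inv x = (inv d \<otimes> t) \<otimes> (x \<otimes> d \<otimes> inv x)"
        unfolding k_def t_def using dc ec xc by (simp add: grp_simps)
      also have "inv d \<otimes> t = t \<otimes> inv d" using eZ[OF P_inv[OF dP] idp t] .
      also have "(t \<otimes> inv d) \<otimes> (x \<otimes> d \<otimes> inv x) = t \<otimes> s"
        unfolding s_def using dc xc Zc[OF t] by (simp add: grp_simps)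
      finally show ?thesis using t s Zm by simp
    qed
    have kp: "k [^] p = \<one>"
    proof -
      define t where "t = inv (d \<otimes> k \<otimes> inv d \<otimes> inv k)"
      have t: "t \<in> Z" unfolding t_def using eK[OF dP dp kK] Zi by blast
      have "k \<otimes> d = t \<otimes> d \<otimes> k" unfolding t_def using dc kc by (simp add: grp_simps)
      then have "(d \<otimes> k) [^] p = d [^] p \<otimes> k [^] p"
        using pow_p_mult[OF dc kc Zc[OF t] _ eZ[OF dP dp t, symmetric] ZK[OF kK t, symmetric] odd_p Zp[OF t]] by simp
      moreover have "d \<otimes> k = e" unfolding k_def using dc ec by (simp add: grp_simps)
      ultimately show ?thesis using dp ep kc by simp
    qed
    have kL: "k \<in> L" using kK kp kcom by (auto simp: L_def)
    have "e \<otimes> y = y \<otimes> e" if y: "y \<in> L" for y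
      unfolding e_def using comm_conj[OF gc dc Lc[OF y] dL[OF conj_inv_mem[OF nL g y]]] .
    moreover have "inv d \<otimes> y = y \<otimes> inv d" if y: "y \<in> L" for y using comm_inv[OF dc Lc[OF y] dL[OF y]] .
    ultimately have "k \<otimes> y = y \<otimes> k" if y: "y \<in> L" for y
      unfolding k_def using comm_mult[of "inv d" e y] dc ec Lc[OF y] y by blast
    then show ?thesis using centL[OF kL] by (simp add: k_def e_def)
  qed

  \<comment> \<open>The good subgroup generated by \<open>d\<close> and \<open>Z\<close>, and the
    contradiction\<close>
  define B where "B = {d [^] (i::nat) \<otimes> x | i x. x \<in> Z}"
  have mem: "d [^] (i::nat) \<otimes> x \<in> B" if "x \<in> Z" for i x using that by (auto simp: B_def)
  have dZ: "d [^] (i::nat) \<otimes> x = x \<otimes> d [^] i" if "x \<in> Z" for i x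
    using eZ[OF dP dp that] dc Zc[OF that] by (metis group_commutes_pow)
  have Zcomm: "x \<otimes> y = y \<otimes> x" if "x \<in> Z" "y \<in> Z" for x y using Acomm that ZA by blast
  have Bmult: "(d [^] (i::nat) \<otimes> x) \<otimes> (d [^] (j::nat) \<otimes> y) = d [^] (i + j) \<otimes> (x \<otimes> y)" if "x \<in> Z" "y \<in> Z" for i j x y
  proof -
    have "(d [^] i \<otimes> x) \<otimes> (d [^] j \<otimes> y) = d [^] i \<otimes> (x \<otimes> d [^] j) \<otimes> y"
      using dc Zc that by (simp add: m_assoc)
    also have "\<dots> = d [^] (i + j) \<otimes> (x \<otimes> y)"
      unfolding dZ[OF that(1), symmetric] using dc Zc that by (simp add: m_assoc flip: nat_pow_mult)
    finally show ?thesis .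
  qed
  have "good B"
    unfolding good_def
  proof (intro conjI)
    show "subgroup B G"
    proof (rule subgroupI)
      show "B \<subseteq> carrier G" using dc Zc by (auto simp: B_def)
      show "B \<noteq> {}" using z mem by blast
    next
      fix b assume "b \<in> B"
      then obtain i :: nat and x where b: "b = d [^] i \<otimes> x" "x \<in> Z" by (auto simp: B_def)
      have xc: "x \<in> carrier G" using Zc b by simp
      have "i * (p - 1) + i = p * i"
        using prime_gt_0_nat[OF prime_p] by (cases p) (simp_all add: algebra_simps)
      then have "d [^] (i * (p - 1) + i) = \<one>" using dc dp by (simp flip: nat_pow_pow)
      then have "(d [^] (i * (p - 1)) \<otimes> inv x) \<otimes> b = \<one>" unfolding b(1) Bmult[OF Zi[OF b(2)] b(2)] using xc by simp
      then have "inv b = d [^] (i * (p - 1)) \<otimes> inv x" unfolding b(1) using dc xc by (intro inv_equality) auto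
      then show "inv b \<in> B" using mem[OF Zi[OF b(2)]] by simp
    next
      fix b b' assume "b \<in> B" "b' \<in> B"
      then obtain i x j y where "b = d [^] (i::nat) \<otimes> x" "x \<in> Z" "b' = d [^] (j::nat) \<otimes> y" "y \<in> Z" by (auto simp: B_def)
      then show "b \<otimes> b' \<in> B" using Bmult mem[OF Zm] by simp
    qed
    show "B \<subseteq> P" using subgroup_pow[OF P dP] ZA AP by (auto simp: B_def intro!: P_mult)
    show "\<forall>b\<in>B. \<forall>b'\<in>B. b \<otimes> b' = b' \<otimes> b"
    proof (intro ballI)
      fix b b' assume "b \<in> B" "b' \<in> B"
      then obtain i x j y where b: "b = d [^] (i::nat) \<otimes> x" "x \<in> Z" "b' = d [^] (j::nat) \<otimes> y" "y \<in> Z" by (auto simp: B_def)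
      show "b \<otimes> b' = b' \<otimes> b" unfolding b(1,3) Bmult[OF b(2,4)] Bmult[OF b(4,2)] Zcomm[OF b(2,4)] by (simp add: add.commute)
    qed
    show "normalized_by S B"
      unfolding normalized_by_def
    proof (intro ballI)
      fix g b assume g: "g \<in> S" and "b \<in> B"
      then obtain i x where b: "b = d [^] (i::nat) \<otimes> x" "x \<in> Z" by (auto simp: B_def)
      note gc = Sc[OF g]
      have xc: "x \<in> carrier G" using Zc b by simp
      define k where "k = inv d \<otimes> (g \<otimes> d \<otimes> inv g)"
      have k: "k \<in> Z" unfolding k_def using conjd[OF g] .
      have gd: "g \<otimes> d \<otimes> inv g = d \<otimes> k" unfolding k_def using gc dc by (simp add: grp_simps)
      have "g \<otimes> b \<otimes> inv g = (g \<otimes> d [^] i \<otimes> inv g) \<otimes> (g \<otimes> x \<otimes> inv g)"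
        unfolding b(1) using gc dc xc by (simp add: grp_simps)
      also have "g \<otimes> d [^] i \<otimes> inv g = (d \<otimes> k) [^] i" using conj_pow[OF gc dc] gd by simp
      also have "\<dots> = d [^] i \<otimes> k [^] i" using pow_mult_distrib[OF eZ[OF dP dp k] dc Zc[OF k]] .
      also have "d [^] i \<otimes> k [^] i \<otimes> (g \<otimes> x \<otimes> inv g) = d [^] i \<otimes> (k [^] i \<otimes> (g \<otimes> x \<otimes> inv g))"
        using dc Zc[OF k] gc xc by (simp add: m_assoc)
      finally show "g \<otimes> b \<otimes> inv g \<in> B"
        using mem[OF Zm[OF subgroup_pow[OF sZ k] normalized_byD[OF nZ g b(2)]]] by simp
    qed
  qed
  moreover have "d \<in> B" using mem[OF subgroup.one_closed[OF sZ], of 1] dc by simp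
  moreover have "z \<in> B" using mem[OF z(1), of 0] Zc[OF z(1)] by simp
  \<comment> \<open>A good subgroup has only one subgroup of order \<open>p\<close>, so
    \<open>d\<close> would be a power of \<open>z\<close> and lie in \<open>K\<close>; but
    \<open>c = d k0\<close> is outside \<open>K\<close>.\<close>
  ultimately obtain j :: nat where "d = z [^] j"
    using good_order_p_unique[OF _ _ _ z(2) _ dp v] z by (auto simp: Z_def)
  then have "d \<in> Z" using subgroup_pow[OF sZ z(1)] by simp
  then show False using dK ZL LK by blast
qed

end

section \<open>Systems of blocks\<close>

context lin_action
begin

definition regular_for :: "'g set \<Rightarrow> 'g set \<Rightarrow> 'v set \<Rightarrow> 'v \<Rightarrow> bool" where
  "regular_for P Q U v \<longleftrightarrow> v \<in> U \<and> (\<forall>x\<in>Q. act x v = v) \<and>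
     (\<forall>g\<in>P. act g v = v \<longrightarrow> (\<forall>u\<in>U. act g u = u))"

text \<open>If zero is regular, all of \<open>P\<close> acts trivially on \<open>U\<close>, and then
  every \<open>Q\<close>-fixed vector is regular.\<close>

lemma regular_for_nonzero:
  assumes Q: "subgroup Q G" "card Q = q ^ b" "submod Q U" "U \<noteq> {\<zero>\<^bsub>T\<^esub>}" "P \<subseteq> carrier G"
    and v: "regular_for P Q U v"
  obtains w where "regular_for P Q U w" "w \<noteq> \<zero>\<^bsub>T\<^esub>"
proof (cases "v = \<zero>\<^bsub>T\<^esub>")
  case True
  obtain w where w: "w \<in> U" "w \<noteq> \<zero>\<^bsub>T\<^esub>" "\<And>x. x \<in> Q \<Longrightarrow> act x w = w"
    using q_group_fixed_vector[OF Q(1-4)] by blast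
  have "regular_for P Q U w" using v w True Q(5) by (auto simp: regular_for_def)
  then show ?thesis using that w by blast
qed (use that v in blast)

text \<open>The square of \<open>y\<close> fixes \<open>w\<close>, so every odd power of
  \<open>y\<close> negates \<open>w\<close>. The odd power \<open>card P\<close> of \<open>y\<close>
  is the identity, whence \<open>w = -w\<close>, and 2 is invertible modulo
  \<open>q\<close>.\<close>

lemma act_eq_minus:
  assumes "odd q" "odd (card P)" and P: "subgroup P G" and y: "y \<in> P" and w: "w \<in> carrier T" "act y w = \<ominus>\<^bsub>T\<^esub> w"
  shows "w = \<zero>\<^bsub>T\<^esub>"
proof -
  have yc: "y \<in> carrier G" using P y by (rule subgroup.mem_carrier)
  have sq: "act (y \<otimes> y) w = w" using yc w by (simp add: act_mult act_minus)
  have ev: "act ((y \<otimes> y) [^] k) w = w" for k :: nat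
    using yc w(1) sq by (induction k) (simp_all add: act_mult)
  obtain k where k: "card P = 2 * k + 1" using assms(2) by (metis oddE)
  have "y [^] card P = \<one>"
    using group.pow_order_eq_1[OF subgroup_imp_group[OF P], of y] y
    by (simp add: order_def nat_pow_consistent[symmetric])
  moreover have "y [^] card P = y \<otimes> (y \<otimes> y) [^] k"
  proof -
    have "(y \<otimes> y) [^] k = y [^] (2 * k)" using yc nat_pow_pow[of y 2 k] by (simp add: numeral_2_eq_2)
    then show ?thesis unfolding k using nat_pow_Suc2[OF yc, of "2 * k"] by (simp del: nat_pow_Suc)
  qed
  ultimately have "act y (act ((y \<otimes> y) [^] k) w) = w" using yc w(1) by (metis act_mult act_one m_closed nat_pow_closed)
  then have "\<ominus>\<^bsub>T\<^esub> w = w" using ev w by simp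
  then have "w \<oplus>\<^bsub>T\<^esub> w = \<zero>\<^bsub>T\<^esub>" using w(1) by (metis T.r_neg)
  then have "[(2::nat)] \<cdot>\<^bsub>T\<^esub> w = \<zero>\<^bsub>T\<^esub>" using w(1) by (simp add: numeral_2_eq_2 T.add.nat_pow_Suc)
  moreover have "\<not> q dvd 2" using assms(1) prime_q
    by (metis primes_dvd_imp_eq two_is_prime_nat even_numeral)
  ultimately show ?thesis using coprime_torsion w(1) by blast
qed

text \<open>Choose in each \<open>Q\<close>-orbit a representative and for it a candidate fixed by
  its stabilizer, then transport along \<open>Q\<close>. Invariance under the stabilizer makes the
  result independent of the transporting element.\<close>

lemma equivariant_selection:
  assumes Q: "subgroup Q G"
    and mv: "\<And>x D. x \<in> Q \<Longrightarrow> D \<in> \<Omega> \<Longrightarrow> mv x D \<in> \<Omega>" "\<And>D. D \<in> \<Omega> \<Longrightarrow> mv \<one> D = D"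
      "\<And>x y D. x \<in> Q \<Longrightarrow> y \<in> Q \<Longrightarrow> D \<in> \<Omega> \<Longrightarrow> mv (x \<otimes> y) D = mv x (mv y D)"
    and candT: "\<And>D. D \<in> \<Omega> \<Longrightarrow> cand D \<subseteq> carrier T"
    and cand: "\<And>x D e. x \<in> Q \<Longrightarrow> D \<in> \<Omega> \<Longrightarrow> e \<in> cand D \<Longrightarrow> act x e \<in> cand (mv x D)"
    and fixed: "\<And>D. D \<in> \<Omega> \<Longrightarrow> \<exists>e\<in>cand D. \<forall>x\<in>Q. mv x D = D \<longrightarrow> act x e = e"
  shows "\<exists>f. (\<forall>D\<in>\<Omega>. f D \<in> cand D) \<and> (\<forall>D\<in>\<Omega>. \<forall>x\<in>Q. f (mv x D) = act x (f D))"
proof -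
  note Qc = subgroup.mem_carrier[OF Q] and Qi = subgroup.m_inv_closed[OF Q] and Qm = subgroup.m_closed[OF Q]
  define orb where "orb = (\<lambda>D. (\<lambda>x. mv x D) ` Q)"
  \<comment> \<open>The choice depends on \<open>D\<close> only through the set
    \<open>orb D\<close>, so \<open>r\<close> is constant on orbits.\<close>
  define r where "r = (\<lambda>D. SOME D'. D' \<in> orb D)"
  define s where "s = (\<lambda>D. SOME e. e \<in> cand D \<and> (\<forall>x\<in>Q. mv x D = D \<longrightarrow> act x e = e))"
  define f where "f = (\<lambda>D. act (SOME y. y \<in> Q \<and> mv y (r D) = D) (s (r D)))"
  have mv_inv: "mv (inv x) (mv x D) = D" if "x \<in> Q" "D \<in> \<Omega>" for x D
    using mv(3)[OF Qi[OF that(1)] that] mv(2)[OF that(2)] Qc[OF that(1)] by simp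
  have mv_inv2: "mv x (mv (inv x) D) = D" if "x \<in> Q" "D \<in> \<Omega>" for x D
    using mv(3)[OF that(1) Qi[OF that(1)] that(2)] mv(2)[OF that(2)] Qc[OF that(1)] by simp
  have r_orb: "r D \<in> orb D" if "D \<in> \<Omega>" for D
  proof -
    have "mv \<one> D \<in> orb D" unfolding orb_def using subgroup.one_closed[OF Q] by blast
    then show ?thesis unfolding r_def by (rule someI)
  qed
  have r_Om: "r D \<in> \<Omega>" if "D \<in> \<Omega>" for D using r_orb[OF that] that mv(1) by (auto simp: orb_def)
  have s: "s D \<in> cand D" "\<And>x. x \<in> Q \<Longrightarrow> mv x D = D \<Longrightarrow> act x (s D) = s D" if "D \<in> \<Omega>" for D
    using someI_ex[of "\<lambda>e. e \<in> cand D \<and> (\<forall>x\<in>Q. mv x D = D \<longrightarrow> act x e = e)"] fixed[OF that]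
    unfolding s_def by blast+
  have sT: "s D \<in> carrier T" if "D \<in> \<Omega>" for D using s(1)[OF that] candT[OF that] by blast
  have orb_eq: "orb (mv x D) = orb D" if x: "x \<in> Q" and D: "D \<in> \<Omega>" for x D
  proof (intro equalityI subsetI)
    fix D' assume "D' \<in> orb (mv x D)"
    then obtain y where y: "y \<in> Q" "D' = mv y (mv x D)" by (auto simp: orb_def)
    then have "D' = mv (y \<otimes> x) D" using mv(3)[of y x D] x D by simp
    then show "D' \<in> orb D" using Qm[OF y(1) x] by (auto simp: orb_def)
  next
    fix D' assume "D' \<in> orb D"
    then obtain y where y: "y \<in> Q" "D' = mv y D" by (auto simp: orb_def)
    then have "D' = mv (y \<otimes> inv x) (mv x D)"
      using mv(3)[of y "inv x" "mv x D"] mv_inv[OF x D] x D Qi[OF x] mv(1)[OF x D] by simp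
    then show "D' \<in> orb (mv x D)" using y x Qm Qi by (auto simp: orb_def)
  qed
  have r_eq: "r (mv x D) = r D" if "x \<in> Q" "D \<in> \<Omega>" for x D
    unfolding r_def using orb_eq[OF that] by simp
  have f_eq: "f D = act y (s (r D))" if D: "D \<in> \<Omega>" and y: "y \<in> Q" "mv y (r D) = D" for D y
  proof -
    define z where "z = (SOME y. y \<in> Q \<and> mv y (r D) = D)"
    have z: "z \<in> Q" "mv z (r D) = D"
      using someI[of "\<lambda>y. y \<in> Q \<and> mv y (r D) = D" y] y unfolding z_def by blast+
    have "mv (inv y \<otimes> z) (r D) = r D"
      using mv(3)[OF Qi[OF y(1)] z(1) r_Om[OF D]] z mv_inv[OF y(1) r_Om[OF D]] y by simp
    then have "act (inv y \<otimes> z) (s (r D)) = s (r D)" using s(2)[OF r_Om[OF D]] Qm[OF Qi[OF y(1)] z(1)] by blast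
    then have "act y (act (inv y \<otimes> z) (s (r D))) = act y (s (r D))" by simp
    moreover have "y \<otimes> (inv y \<otimes> z) = z" using Qc y z by (simp add: grp_simps)
    ultimately have "act z (s (r D)) = act y (s (r D))"
      using act_mult[of y "inv y \<otimes> z" "s (r D)"] Qc y z sT[OF r_Om[OF D]] by simp
    then show ?thesis unfolding f_def z_def .
  qed
  have ex: "\<exists>y\<in>Q. mv y (r D) = D" if D: "D \<in> \<Omega>" for D
  proof -
    obtain x where x: "x \<in> Q" "r D = mv x D" using r_orb[OF D] by (auto simp: orb_def)
    then show ?thesis using mv_inv[OF x(1) D] Qi[OF x(1)] by auto
  qed
  show ?thesis
  proof (intro exI[of _ f] conjI ballI)
    fix D assume D: "D \<in> \<Omega>"
    obtain y where y: "y \<in> Q" "mv y (r D) = D" using ex[OF D] by blast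
    show "f D \<in> cand D" unfolding f_eq[OF D y] using cand[OF y(1) r_Om[OF D] s(1)[OF r_Om[OF D]]] y by simp
    fix x assume x: "x \<in> Q"
    have "mv (x \<otimes> y) (r (mv x D)) = mv x D" using mv(3)[OF x y(1) r_Om[OF D]] y r_eq[OF x D] by simp
    from f_eq[OF mv(1)[OF x D] Qm[OF x y(1)] this] have "f (mv x D) = act (x \<otimes> y) (s (r D))" using r_eq[OF x D] by simp
    then show "f (mv x D) = act x (f D)" unfolding f_eq[OF D y]
      using act_mult[OF Qc[OF x] Qc[OF y(1)] sT[OF r_Om[OF D]]] by simp
  qed
qed

end

text \<open>Independence is the only decomposition property assumed; what spanning would give is
  drawn from irreducibility in \<open>block_kernel\<close>. \<open>mv_mult\<close> ranges over
  \<open>carrier G\<close> because \<open>P \<union> Q\<close> is not closed under products.\<close>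

locale block_system = lin_action G T act q
  for G :: "('g, 'e) monoid_scheme" (structure) and T :: "('v, 'd) ring_scheme" and act and q :: nat +
  fixes p n b :: nat and P Q :: "'g set" and U :: "'v set"
    and \<Omega> :: "'o set" and mv :: "'g \<Rightarrow> 'o \<Rightarrow> 'o" and blk :: "'o \<Rightarrow> 'v set"
  assumes prime_p: "Factorial_Ring.prime p" and odd_p: "odd p" and p_neq_q: "p \<noteq> q" and odd_q: "odd q"
    and P: "subgroup P G" and card_P: "card P = p ^ n"
    and Q: "subgroup Q G" and card_Q: "card Q = q ^ b" and Q_norm_P: "normalized_by Q P"
    and U: "submod (P \<union> Q) U"
    and irred: "\<And>W. submod (P \<union> Q) W \<Longrightarrow> W \<subseteq> U \<Longrightarrow> W \<noteq> {\<zero>\<^bsub>T\<^esub>} \<Longrightarrow> W = U"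
    and finite_Om: "finite \<Omega>" and Om_nonempty: "\<Omega> \<noteq> {}"
    and mv_closed: "\<And>g D. g \<in> P \<union> Q \<Longrightarrow> D \<in> \<Omega> \<Longrightarrow> mv g D \<in> \<Omega>"
    and mv_one: "\<And>D. D \<in> \<Omega> \<Longrightarrow> mv \<one> D = D"
    and mv_mult: "\<And>g h D. g \<in> carrier G \<Longrightarrow> h \<in> carrier G \<Longrightarrow> D \<in> \<Omega> \<Longrightarrow> mv (g \<otimes> h) D = mv g (mv h D)"
    and blk: "\<And>D. D \<in> \<Omega> \<Longrightarrow> submod {} (blk D)" "\<And>D. D \<in> \<Omega> \<Longrightarrow> blk D \<subset> U"
      "\<And>D. D \<in> \<Omega> \<Longrightarrow> blk D \<noteq> {\<zero>\<^bsub>T\<^esub>}"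
    and blk_act: "\<And>g D u. g \<in> P \<union> Q \<Longrightarrow> D \<in> \<Omega> \<Longrightarrow> u \<in> blk D \<Longrightarrow> act g u \<in> blk (mv g D)"
    and blk_indep: "\<And>f f' D. (\<And>D. D \<in> \<Omega> \<Longrightarrow> f D \<in> blk D) \<Longrightarrow> (\<And>D. D \<in> \<Omega> \<Longrightarrow> f' D \<in> blk D) \<Longrightarrow>
        (\<Oplus>\<^bsub>T\<^esub>D\<in>\<Omega>. f D) = (\<Oplus>\<^bsub>T\<^esub>D\<in>\<Omega>. f' D) \<Longrightarrow> D \<in> \<Omega> \<Longrightarrow> f D = f' D"
begin

abbreviation "S \<equiv> P \<union> Q"

lemma Sc [simp]: "x \<in> S \<Longrightarrow> x \<in> carrier G" using P Q by (auto dest: subgroup.mem_carrier)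
lemma Pc [simp]: "x \<in> P \<Longrightarrow> x \<in> carrier G" by simp
lemma Qc [simp]: "x \<in> Q \<Longrightarrow> x \<in> carrier G" by simp
lemma S_inv: "x \<in> S \<Longrightarrow> inv x \<in> S" using P Q by (auto dest: subgroup.m_inv_closed)
lemmas P_inv = subgroup.m_inv_closed[OF P] and P_mult = subgroup.m_closed[OF P] and P_one = subgroup.one_closed[OF P]
lemmas Q_inv = subgroup.m_inv_closed[OF Q] and Q_mult = subgroup.m_closed[OF Q] and Q_one = subgroup.one_closed[OF Q]

lemma conj_P: "g \<in> S \<Longrightarrow> x \<in> P \<Longrightarrow> g \<otimes> x \<otimes> inv g \<in> P"
  using Q_norm_P by (auto simp: normalized_by_def P_mult P_inv)

lemma conj_inv_P: "g \<in> S \<Longrightarrow> x \<in> P \<Longrightarrow> inv g \<otimes> x \<otimes> g \<in> P"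
  using conj_P[OF S_inv] by force

lemma UT: "u \<in> U \<Longrightarrow> u \<in> carrier T" using submodD(1)[OF U] .

lemma blkU: "D \<in> \<Omega> \<Longrightarrow> u \<in> blk D \<Longrightarrow> u \<in> U" using blk(2) by blast

lemma blkT: "D \<in> \<Omega> \<Longrightarrow> u \<in> blk D \<Longrightarrow> u \<in> carrier T" using blkU UT by blast

lemma mv_inv: "g \<in> S \<Longrightarrow> D \<in> \<Omega> \<Longrightarrow> mv (inv g) (mv g D) = D"
  "g \<in> S \<Longrightarrow> D \<in> \<Omega> \<Longrightarrow> mv g (mv (inv g) D) = D"
  using mv_mult[of "inv g" g D] mv_mult[of g "inv g" D] by (simp_all add: mv_one)

lemma sum_act:
  assumes g: "g \<in> S" and f: "\<And>D. D \<in> \<Omega> \<Longrightarrow> f D \<in> blk D"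
  shows "act g (\<Oplus>\<^bsub>T\<^esub>D\<in>\<Omega>. f D) = (\<Oplus>\<^bsub>T\<^esub>D\<in>\<Omega>. act g (f (mv (inv g) D)))"
proof -
  have fT: "f D \<in> carrier T" if "D \<in> \<Omega>" for D using f[OF that] blkT that by blast
  have gi: "inv g \<in> S" using S_inv[OF g] .
  have inj: "inj_on (mv g) \<Omega>" by (rule inj_on_inverseI[where g = "mv (inv g)"]) (use mv_inv g in simp)
  have im: "mv g ` \<Omega> = \<Omega>"
  proof (intro equalityI subsetI)
    fix D assume D: "D \<in> \<Omega>"
    then have "D = mv g (mv (inv g) D)" using mv_inv g by simp
    then show "D \<in> mv g ` \<Omega>" using mv_closed[OF gi D] by blast
  qed (use mv_closed g in auto)
  have "(\<Oplus>\<^bsub>T\<^esub>D\<in>mv g ` \<Omega>. act g (f (mv (inv g) D))) = (\<Oplus>\<^bsub>T\<^esub>D\<in>\<Omega>. act g (f (mv (inv g) (mv g D))))"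
    by (rule T.finsum_reindex[OF _ inj]) (use fT mv_closed gi g mv_inv in auto)
  also have "\<dots> = (\<Oplus>\<^bsub>T\<^esub>D\<in>\<Omega>. act g (f D))"
    using mv_inv g fT by (intro T.finsum_cong') auto
  also have "\<dots> = act g (\<Oplus>\<^bsub>T\<^esub>D\<in>\<Omega>. f D)" using act_sum[of g \<Omega> f] g fT by simp
  finally show ?thesis unfolding im by simp
qed

text \<open>The element \<open>g\<close> permutes the summands, so by independence the equation can
  be read off block by block.\<close>

lemma sum_fixed_iff:
  assumes g: "g \<in> S" and f: "\<And>D. D \<in> \<Omega> \<Longrightarrow> f D \<in> blk D"
  shows "act g (\<Oplus>\<^bsub>T\<^esub>D\<in>\<Omega>. f D) = (\<Oplus>\<^bsub>T\<^esub>D\<in>\<Omega>. f D) \<longleftrightarrow> (\<forall>D\<in>\<Omega>. f (mv g D) = act g (f D))"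
proof
  have gi: "inv g \<in> S" using S_inv[OF g] .
  let ?f' = "\<lambda>D. act g (f (mv (inv g) D))"
  have f': "?f' D \<in> blk D" if "D \<in> \<Omega>" for D
    using blk_act[OF g mv_closed[OF gi that] f[OF mv_closed[OF gi that]]] mv_inv(2)[OF g that] by simp
  {
    assume "act g (\<Oplus>\<^bsub>T\<^esub>D\<in>\<Omega>. f D) = (\<Oplus>\<^bsub>T\<^esub>D\<in>\<Omega>. f D)"
    then have "(\<Oplus>\<^bsub>T\<^esub>D\<in>\<Omega>. f D) = (\<Oplus>\<^bsub>T\<^esub>D\<in>\<Omega>. ?f' D)" using sum_act[of g f] g f by simp
    from blk_indep[of f ?f', OF f f' this] have "f D = ?f' D" if "D \<in> \<Omega>" for D using that by simp
    from this[OF mv_closed[OF g]] show "\<forall>D\<in>\<Omega>. f (mv g D) = act g (f D)" using mv_inv(1)[OF g] by simp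
  }
  assume eq: "\<forall>D\<in>\<Omega>. f (mv g D) = act g (f D)"
  have "act g (\<Oplus>\<^bsub>T\<^esub>D\<in>\<Omega>. f D) = (\<Oplus>\<^bsub>T\<^esub>D\<in>\<Omega>. ?f' D)" using sum_act[of g f] g f by simp
  also have "\<dots> = (\<Oplus>\<^bsub>T\<^esub>D\<in>\<Omega>. f D)"
  proof (rule T.finsum_cong')
    show "?f' D = f D" if D: "D \<in> \<Omega>" for D
      using eq[THEN bspec, OF mv_closed[OF gi D]] mv_inv(2)[OF g D] by simp
  qed (use f blkT in auto)
  finally show "act g (\<Oplus>\<^bsub>T\<^esub>D\<in>\<Omega>. f D) = (\<Oplus>\<^bsub>T\<^esub>D\<in>\<Omega>. f D)" .
qed

lemma stab_subgroup:
  assumes H: "subgroup H G" "H \<subseteq> S" and D: "D \<in> \<Omega>"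
  shows "subgroup {x \<in> H. mv x D = D} G"
proof (rule subgroupI)
  show "{x \<in> H. mv x D = D} \<noteq> {}" using mv_one[OF D] subgroup.one_closed[OF H(1)] by auto
  show "inv x \<in> {x \<in> H. mv x D = D}" if x: "x \<in> {x \<in> H. mv x D = D}" for x
    using x mv_inv(1)[of x D] D H(2) subgroup.m_inv_closed[OF H(1)] by auto
qed (use subgroup.mem_carrier[OF H(1)] mv_mult D subgroup.m_closed[OF H(1)] in auto)

lemma block_translate:
  assumes x: "x \<in> S" "mv x D0 = D" and D0: "D0 \<in> \<Omega>" and g: "g \<in> carrier G"
    and triv: "\<And>u. u \<in> blk D0 \<Longrightarrow> act (inv x \<otimes> g \<otimes> x) u = u" and u: "u \<in> blk D"
  shows "act g u = u"
proof -
  have D: "D \<in> \<Omega>" using mv_closed[OF x(1) D0] x(2) by simp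
  have xc: "x \<in> carrier G" using x(1) by simp
  have "act (inv x) u \<in> blk D0"
    using blk_act[OF S_inv[OF x(1)] D u] x mv_inv(1)[OF x(1) D0] by simp
  from triv[OF this] have "act x (act (inv x \<otimes> g \<otimes> x) (act (inv x) u)) = u" using xc blkT[OF D u] by simp
  then show ?thesis using xc g blkT[OF D u] by (simp add: act_mult)
qed

text \<open>The elements of \<open>P\<close> acting trivially on an invariant family of blocks form
  a normalized set. Its fixed vectors are thus a submodule containing a nonzero block, which by
  irreducibility is \<open>U\<close>.\<close>

lemma block_kernel:
  assumes O': "\<Omega>' \<subseteq> \<Omega>" "\<Omega>' \<noteq> {}" "\<And>h D. h \<in> S \<Longrightarrow> D \<in> \<Omega>' \<Longrightarrow> mv h D \<in> \<Omega>'"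
    and g: "g \<in> P" "\<And>D u. D \<in> \<Omega>' \<Longrightarrow> u \<in> blk D \<Longrightarrow> act g u = u" and u: "u \<in> U"
  shows "act g u = u"
proof -
  define K where "K = {g \<in> P. \<forall>D\<in>\<Omega>'. \<forall>u\<in>blk D. act g u = u}"
  define W where "W = {u \<in> U. \<forall>g\<in>K. act g u = u}"
  have nK: "inv h \<otimes> k \<otimes> h \<in> K" if h: "h \<in> S" and k: "k \<in> K" for h k
  proof -
    have kP: "k \<in> P" using k by (simp add: K_def)
    have "act (inv h \<otimes> k \<otimes> h) u = u" if D: "D \<in> \<Omega>'" and u: "u \<in> blk D" for D u
    proof -
      have DO: "D \<in> \<Omega>" using D O' by blast
      have uT: "u \<in> carrier T" using blkT[OF DO u] .
      have "act h u \<in> blk (mv h D)" using blk_act[OF h DO u] .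
      then have "act k (act h u) = act h u" using k O'(3)[OF h D] by (auto simp: K_def)
      then show ?thesis using h kP uT by (simp add: act_mult)
    qed
    then show ?thesis using conj_inv_P[OF h kP] by (auto simp: K_def)
  qed
  have "submod S W"
    unfolding W_def by (rule fixed_submod[OF U _ _ nK]) (auto simp: K_def)
  moreover have "W \<subseteq> U" by (auto simp: W_def)
  moreover obtain D where D: "D \<in> \<Omega>'" using O' by blast
  have "blk D \<subseteq> W" using D O'(1) blkU by (auto simp: W_def K_def)
  then have "W \<noteq> {\<zero>\<^bsub>T\<^esub>}" using blk(1,3)[of D] D O'(1) submodD(2)[of "{}" "blk D"] by blast
  ultimately have "W = U" using irred by blast
  moreover have "g \<in> K" using g by (auto simp: K_def)
  ultimately show ?thesis using u by (auto simp: W_def)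
qed

text \<open>Since \<open>P\<close> preserves every block, a block is a module for \<open>P\<close>
  and its stabilizer \<open>Q0\<close> in \<open>Q\<close>, and the induction hypothesis gives a
  vector \<open>w\<close> there. Its \<open>Q\<close>-translates, one per block of the orbit, add up
  to the required vector.\<close>

lemma regular_trivial_blocks:
  assumes triv: "\<And>g D. g \<in> P \<Longrightarrow> D \<in> \<Omega> \<Longrightarrow> mv g D = D"
    and IH: "\<And>Q' W. subgroup Q' G \<Longrightarrow> Q' \<subseteq> Q \<Longrightarrow> submod (P \<union> Q') W \<Longrightarrow> W \<subset> U \<Longrightarrow> \<exists>v. regular_for P Q' W v"
  shows "\<exists>v. regular_for P Q U v"
proof -
  obtain D0 where D0: "D0 \<in> \<Omega>" using Om_nonempty by blast
  define Q0 where "Q0 = {x \<in> Q. mv x D0 = D0}"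
  have sQ0: "subgroup Q0 G" unfolding Q0_def by (rule stab_subgroup[OF Q _ D0]) simp
  have "submod (P \<union> Q0) (blk D0)"
  proof (rule submodI)
    show "act g v \<in> blk D0" if "g \<in> P \<union> Q0" "v \<in> blk D0" for g v
      using that blk_act[OF _ D0 that(2), of g] triv D0 by (auto simp: Q0_def)
  qed (use submodD[OF blk(1)[OF D0]] in auto)
  then obtain w where w: "regular_for P Q0 (blk D0) w"
    using IH[OF sQ0 _ _ blk(2)[OF D0]] by (auto simp: Q0_def)
  have wb: "w \<in> blk D0" using w by (simp add: regular_for_def)
  have wT: "w \<in> carrier T" using blkT[OF D0 wb] .
  define O' where "O' = (\<lambda>x. mv x D0) ` Q"
  have O'sub: "O' \<subseteq> \<Omega>" using mv_closed D0 by (auto simp: O'_def)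
  have O'Q: "mv x D \<in> O'" if "x \<in> Q" "D \<in> O'" for x D
    using that mv_mult D0 Q_mult by (auto simp: O'_def simp flip: mv_mult)
  \<comment> \<open>Blocks outside the \<open>Q\<close>-orbit of \<open>D0\<close> get the component
    zero. This loses nothing, as \<open>block_kernel\<close> needs only one invariant
    family.\<close>
  define cand where "cand = (\<lambda>D. if D \<in> O' then {act x w | x. x \<in> Q \<and> mv x D0 = D} else {\<zero>\<^bsub>T\<^esub>})"
  have cand_blk: "cand D \<subseteq> blk D" if "D \<in> \<Omega>" for D
    using blk_act[OF _ D0 wb] submodD(2)[OF blk(1)[OF that]] by (auto simp: cand_def)
  have "\<exists>f. (\<forall>D\<in>\<Omega>. f D \<in> cand D) \<and> (\<forall>D\<in>\<Omega>. \<forall>x\<in>Q. f (mv x D) = act x (f D))"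
  proof (rule equivariant_selection[OF Q])
    show "cand D \<subseteq> carrier T" if "D \<in> \<Omega>" for D using cand_blk[OF that] blkT[OF that] by blast
  next
    fix x D e assume x: "x \<in> Q" and D: "D \<in> \<Omega>" and e: "e \<in> cand D"
    show "act x e \<in> cand (mv x D)"
    proof (cases "D \<in> O'")
      case True
      then obtain y where y: "y \<in> Q" "mv y D0 = D" "e = act y w" using e by (auto simp: cand_def)
      then have "act x e = act (x \<otimes> y) w" "mv (x \<otimes> y) D0 = mv x D"
        using x wT D0 by (simp_all add: act_mult mv_mult)
      then show ?thesis using O'Q[OF x True] Q_mult[OF x y(1)] by (auto simp: cand_def)
    next
      case False
      have "mv x D \<notin> O'"
      proof
        assume "mv x D \<in> O'"
        from O'Q[OF Q_inv[OF x] this] show False using False mv_inv(1)[of x D] x D by simp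
      qed
      then show ?thesis using e False x by (auto simp: cand_def)
    qed
  next
    fix D assume D: "D \<in> \<Omega>"
    show "\<exists>e\<in>cand D. \<forall>x\<in>Q. mv x D = D \<longrightarrow> act x e = e"
    proof (cases "D \<in> O'")
      case True
      then obtain y where y: "y \<in> Q" "mv y D0 = D" by (auto simp: O'_def)
      have "act x (act y w) = act y w" if x: "x \<in> Q" "mv x D = D" for x
      proof -
        have "mv (inv y \<otimes> (x \<otimes> y)) D0 = D0" using x y D0 mv_inv(1)[of y D0] by (simp add: mv_mult)
        then have "inv y \<otimes> (x \<otimes> y) \<in> Q0" using x y Q_mult Q_inv by (auto simp: Q0_def)
        then have "act (inv y \<otimes> (x \<otimes> y)) w = w" using w by (auto simp: regular_for_def)
        then have "act y (act (inv y \<otimes> (x \<otimes> y)) w) = act y w" by simp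
        then show ?thesis using x y wT by (simp add: act_mult)
      qed
      then show ?thesis using True y by (auto simp: cand_def)
    qed (auto simp: cand_def)
  qed (use mv_closed mv_one mv_mult in auto)
  then obtain f where f: "\<And>D. D \<in> \<Omega> \<Longrightarrow> f D \<in> cand D" "\<And>D x. D \<in> \<Omega> \<Longrightarrow> x \<in> Q \<Longrightarrow> f (mv x D) = act x (f D)" by blast
  have fb: "f D \<in> blk D" if "D \<in> \<Omega>" for D using f(1)[OF that] cand_blk[OF that] by blast
  define v where "v = (\<Oplus>\<^bsub>T\<^esub>D\<in>\<Omega>. f D)"
  have "v \<in> U" unfolding v_def by (rule submod_sum[OF U blkU[OF _ fb]])
  moreover have "act x v = v" if "x \<in> Q" for x
    unfolding v_def by (rule sum_fixed_iff[THEN iffD2]) (use fb f(2) that in auto)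
  moreover have "act g u = u" if g: "g \<in> P" "act g v = v" and u: "u \<in> U" for g u
  proof (rule block_kernel[OF O'sub _ _ g(1) _ u])
    show "O' \<noteq> {}" using Q_one by (auto simp: O'_def)
    show "mv h D \<in> O'" if "h \<in> S" "D \<in> O'" for h D using that O'Q triv O'sub by (cases "h \<in> Q") auto
  next
    fix D u assume D: "D \<in> O'" and u: "u \<in> blk D"
    have DO: "D \<in> \<Omega>" using D O'sub by blast
    have "act g (f D) = f D" using sum_fixed_iff[of g f] fb g triv[OF g(1) DO] DO unfolding v_def by auto
    moreover obtain x where x: "x \<in> Q" "mv x D0 = D" "f D = act x w" using f(1)[OF DO] D by (auto simp: cand_def)
    ultimately have e: "act g (act x w) = act x w" by simp
    have xc: "x \<in> carrier G" "g \<in> carrier G" using x g by auto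
    have "act (inv x \<otimes> g \<otimes> x) w = w" using e xc wT by (simp add: act_mult)
    moreover have "inv x \<otimes> g \<otimes> x \<in> P" using conj_inv_P x g by simp
    ultimately have "act (inv x \<otimes> g \<otimes> x) u' = u'" if "u' \<in> blk D0" for u'
      using w that by (auto simp: regular_for_def)
    then show "act g u = u" using block_translate[OF _ x(2) D0 xc(2) _ u] x(1) by blast
  qed
  ultimately have "regular_for P Q U v" by (auto simp: regular_for_def)
  then show ?thesis by blast
qed

text \<open>All block stabilizers in \<open>P\<close> being equal to \<open>N\<close>, the group
  \<open>P/N\<close> permutes the blocks regularly. The induction hypothesis is used for
  \<open>N\<close> in place of \<open>P\<close>, on a block fixed by \<open>Q\<close>.\<close>

lemma regular_transitive_blocks:
  assumes N: "subgroup N G" "\<And>D. D \<in> \<Omega> \<Longrightarrow> {g \<in> P. mv g D = D} = N"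
    and trans: "\<And>D D'. D \<in> \<Omega> \<Longrightarrow> D' \<in> \<Omega> \<Longrightarrow> \<exists>g\<in>P. mv g D = D'"
    and IH: "\<And>W. submod (N \<union> Q) W \<Longrightarrow> W \<subset> U \<Longrightarrow> \<exists>v. regular_for N Q W v"
  shows "\<exists>v. regular_for P Q U v"
proof -
  have pow_ndvd: "\<not> q dvd m" if "m dvd p ^ n" for m
    using that prime_p prime_q p_neq_q by (metis dvd_trans prime_dvd_power primes_dvd_imp_eq)
  have NP: "N \<subseteq> P" using N(2) Om_nonempty by blast
  have mvN: "mv g D = D" if "g \<in> N" "D \<in> \<Omega>" for g D using N(2)[OF that(2)] that(1) by blast
  obtain D1 where D1: "D1 \<in> \<Omega>" using Om_nonempty by blast
  \<comment> \<open>The number of blocks divides the power \<open>card P\<close> of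
    \<open>p\<close>, so it is prime to \<open>q\<close> and the \<open>q\<close>-group
    \<open>Q\<close> fixes a block.\<close>
  have "\<Omega> = (\<lambda>g. mv g D1) ` P" using trans[OF D1] mv_closed[of _ D1] D1 by auto
  moreover have "card ((\<lambda>g. mv g D1) ` P) dvd card P"
    by (rule orbit_card_dvd[OF P, where E = \<Omega>]) (use mv_closed mv_one mv_mult D1 in auto)
  ultimately have "\<not> q dvd card \<Omega>" using pow_ndvd card_P by simp
  then obtain D0 where D0: "D0 \<in> \<Omega>" "\<And>x. x \<in> Q \<Longrightarrow> mv x D0 = D0"
    using p_group_acts_fixed_point[OF Q card_Q prime_q finite_Om, of mv] mv_closed mv_one mv_mult by auto
  have subm: "submod (N \<union> Q) (blk D0)"
  proof (rule submodI)
    show "act g v \<in> blk D0" if "g \<in> N \<union> Q" "v \<in> blk D0" for g v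
      using that blk_act[OF _ D0(1) that(2), of g] mvN D0 NP by auto
  qed (use submodD[OF blk(1)[OF D0(1)]] in auto)
  obtain w' where w': "regular_for N Q (blk D0) w'" using IH[OF subm blk(2)[OF D0(1)]] by blast
  obtain w where w: "regular_for N Q (blk D0) w" "w \<noteq> \<zero>\<^bsub>T\<^esub>"
    using regular_for_nonzero[OF Q card_Q submod_mono[OF subm] blk(3)[OF D0(1)] subgroup.subset[OF N(1)] w'] by blast
  have wb: "w \<in> blk D0" and wQ: "\<And>x. x \<in> Q \<Longrightarrow> act x w = w" using w by (auto simp: regular_for_def)
  have wT: "w \<in> carrier T" using blkT[OF D0(1) wb] .
  define orb where "orb = (\<lambda>D. {act x w | x. x \<in> P \<and> mv x D0 = D})"
  have orb_blk: "orb D \<subseteq> blk D" if "D \<in> \<Omega>" for D using blk_act[OF _ D0(1) wb] by (auto simp: orb_def)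
  have orbQ: "act y e \<in> orb (mv y D)" if y: "y \<in> Q" and D: "D \<in> \<Omega>" and e: "e \<in> orb D" for y D e
  proof -
    obtain x where x: "x \<in> P" "mv x D0 = D" "e = act x w" using e by (auto simp: orb_def)
    have "act y e = act (y \<otimes> x \<otimes> inv y) w"
      using x y wT wQ[OF Q_inv[OF y]] by (simp add: act_mult)
    moreover have "mv (y \<otimes> x \<otimes> inv y) D0 = mv y D"
      using x y D0(1) D0(2)[OF Q_inv[OF y]] by (simp add: mv_mult)
    moreover have "y \<otimes> x \<otimes> inv y \<in> P" using conj_P x y by simp
    ultimately show ?thesis by (auto simp: orb_def)
  qed
  have orb_fixed: "\<exists>e\<in>orb D. \<forall>x\<in>Q. mv x D = D \<longrightarrow> act x e = e" if D: "D \<in> \<Omega>" for D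
  proof -
    define QD where "QD = {x \<in> Q. mv x D = D}"
    have sQD: "subgroup QD G" unfolding QD_def by (rule stab_subgroup[OF Q _ D]) simp
    have "card QD dvd q ^ b" using subgroup_card_dvd[OF sQD Q] card_Q by (auto simp: QD_def)
    then obtain j where j: "card QD = q ^ j" using prime_q by (auto simp: divides_primepow_nat)
    obtain x0 where x0: "x0 \<in> P" "mv x0 D0 = D" using trans[OF D0(1) D] by blast
    \<comment> \<open>The \<open>P\<close>-translates of \<open>w\<close> inside one block form a
      single \<open>N\<close>-orbit, whose size divides a power of \<open>p\<close>. The stabilizer
      \<open>QD\<close>, a \<open>q\<close>-group, therefore fixes one of them.\<close>
    have "orb D = (\<lambda>m. act m (act x0 w)) ` N"
    proof (intro equalityI subsetI)
      fix e assume "e \<in> orb D"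
      then obtain x where x: "x \<in> P" "mv x D0 = D" "e = act x w" by (auto simp: orb_def)
      have "mv (x \<otimes> inv x0) D = D" using x x0 D0(1) mv_inv(1)[of x0 D0] D by (simp add: mv_mult)
      then have "x \<otimes> inv x0 \<in> N" using N(2)[OF D] x x0 P_mult P_inv by blast
      moreover have "e = act (x \<otimes> inv x0) (act x0 w)" using x x0 wT by (simp add: act_mult)
      ultimately show "e \<in> (\<lambda>m. act m (act x0 w)) ` N" by blast
    next
      fix e assume "e \<in> (\<lambda>m. act m (act x0 w)) ` N"
      then obtain m where m: "m \<in> N" "e = act m (act x0 w)" by blast
      have mP: "m \<in> P" using m NP by blast
      have "e = act (m \<otimes> x0) w" "mv (m \<otimes> x0) D0 = D" "m \<otimes> x0 \<in> P"
        using m mP x0 wT D0(1) mvN[OF m(1) D] P_mult by (simp_all add: act_mult mv_mult)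
      then show "e \<in> orb D" by (auto simp: orb_def)
    qed
    moreover have "card ((\<lambda>m. act m (act x0 w)) ` N) dvd card N"
      by (rule orbit_card_dvd[OF N(1), where E = "carrier T"])
        (use NP act_mult wT x0 in \<open>auto simp: subset_iff\<close>)
    moreover have "card N dvd p ^ n" using subgroup_card_dvd[OF N(1) P NP] card_P by simp
    ultimately have nd: "\<not> q dvd card (orb D)" using pow_ndvd dvd_trans by metis
    have orbT: "orb D \<subseteq> carrier T" using orb_blk[OF D] blkT[OF D] by blast
    have "finite (orb D)" using orbT finite_T finite_subset by blast
    moreover have "act y e \<in> orb D" if "y \<in> QD" "e \<in> orb D" for y e
      using orbQ[OF _ D that(2), of y] that(1) by (auto simp: QD_def)
    moreover have "act (y \<otimes> z) e = act y (act z e)" if "y \<in> QD" "z \<in> QD" "e \<in> orb D" for y z e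
      using act_mult[of y z e] that orbT by (auto simp: QD_def)
    moreover have "act \<one> e = e" if "e \<in> orb D" for e using that orbT by auto
    ultimately obtain e where "e \<in> orb D" "\<And>x. x \<in> QD \<Longrightarrow> act x e = e"
      using p_group_acts_fixed_point[OF sQD j prime_q _ nd, of act] by blast
    then show ?thesis by (auto simp: QD_def)
  qed
  \<comment> \<open>The sign at \<open>D0\<close> prevents elements of \<open>P\<close> that move \<open>D0\<close> from fixing the sum.\<close>
  define cand where "cand = (\<lambda>D. if D = D0 then {\<ominus>\<^bsub>T\<^esub> w} else orb D)"
  have cand_blk: "cand D \<subseteq> blk D" if "D \<in> \<Omega>" for D
    using orb_blk[OF that] submodD(4)[OF blk(1)[OF D0(1)] wb] by (auto simp: cand_def)
  have "\<exists>f. (\<forall>D\<in>\<Omega>. f D \<in> cand D) \<and> (\<forall>D\<in>\<Omega>. \<forall>x\<in>Q. f (mv x D) = act x (f D))"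
  proof (rule equivariant_selection[OF Q])
    show "cand D \<subseteq> carrier T" if "D \<in> \<Omega>" for D using cand_blk[OF that] blkT[OF that] by blast
  next
    fix x D e assume x: "x \<in> Q" and D: "D \<in> \<Omega>" and e: "e \<in> cand D"
    have "mv x D = D0 \<longleftrightarrow> D = D0"
      using D0(2)[OF x] D0(2)[OF Q_inv[OF x]] mv_inv(1)[of x D] x D by auto
    then show "act x e \<in> cand (mv x D)"
      using orbQ[OF x D] e x wT wQ[OF x] by (auto simp: cand_def act_minus)
  next
    fix D assume D: "D \<in> \<Omega>"
    show "\<exists>e\<in>cand D. \<forall>x\<in>Q. mv x D = D \<longrightarrow> act x e = e"
      using orb_fixed[OF D] wT wQ by (auto simp: cand_def act_minus)
  qed (use mv_closed mv_one mv_mult in auto)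
  then obtain f where f: "\<And>D. D \<in> \<Omega> \<Longrightarrow> f D \<in> cand D" "\<And>D x. D \<in> \<Omega> \<Longrightarrow> x \<in> Q \<Longrightarrow> f (mv x D) = act x (f D)" by blast
  have fb: "f D \<in> blk D" if "D \<in> \<Omega>" for D using f(1)[OF that] cand_blk[OF that] by blast
  have f0: "f D0 = \<ominus>\<^bsub>T\<^esub> w" using f(1)[OF D0(1)] by (simp add: cand_def)
  define v where "v = (\<Oplus>\<^bsub>T\<^esub>D\<in>\<Omega>. f D)"
  have "v \<in> U" unfolding v_def by (rule submod_sum[OF U blkU[OF _ fb]])
  moreover have "act x v = v" if "x \<in> Q" for x
    unfolding v_def by (rule sum_fixed_iff[THEN iffD2]) (use fb f(2) that in auto)
  moreover have "act g u = u" if g: "g \<in> P" "act g v = v" and u: "u \<in> U" for g u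
  proof -
    have gf: "f (mv g D) = act g (f D)" if "D \<in> \<Omega>" for D
      using sum_fixed_iff[of g f] fb g that unfolding v_def by auto
    have gc: "g \<in> carrier G" using g by simp
    have "mv g D0 = D0"
    proof (rule ccontr)
      \<comment> \<open>At the image of \<open>D0\<close> the component is some
        \<open>act x w\<close>, whereas \<open>g\<close> carries \<open>-w\<close> there. So
        \<open>inv g \<otimes> x\<close> in \<open>P\<close> would send \<open>w\<close> to
        \<open>-w\<close>.\<close>
      assume ne: "mv g D0 \<noteq> D0"
      have "mv g D0 \<in> \<Omega>" using mv_closed g D0 by auto
      then have "f (mv g D0) \<in> orb (mv g D0)" using f(1) ne by (force simp: cand_def)
      then obtain x where x: "x \<in> P" "act g (\<ominus>\<^bsub>T\<^esub> w) = act x w" using gf[OF D0(1)] f0 by (auto simp: orb_def)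
      have "act (inv g) (act g (\<ominus>\<^bsub>T\<^esub> w)) = \<ominus>\<^bsub>T\<^esub> w" using gc wT by simp
      then have "act (inv g \<otimes> x) w = \<ominus>\<^bsub>T\<^esub> w" using x gc wT by (simp add: act_mult)
      moreover have "odd (card P)" using card_P odd_p by simp
      moreover have "inv g \<otimes> x \<in> P" using g x P_mult P_inv by simp
      ultimately show False using act_eq_minus[OF odd_q _ P] wT w(2) by blast
    qed
    then have gN: "g \<in> N" using N(2)[OF D0(1)] g by blast
    show ?thesis
    proof (rule block_kernel[OF order_refl Om_nonempty _ g(1) _ u])
      fix D u assume D: "D \<in> \<Omega>" and u: "u \<in> blk D"
      have gD: "act g (f D) = f D" using gf[OF D] mvN[OF gN D] by simp
      obtain x where x: "x \<in> P" "mv x D0 = D" and e: "act g (act x w) = act x w"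
      proof (cases "D = D0")
        case True
        have "\<ominus>\<^bsub>T\<^esub> act g w = \<ominus>\<^bsub>T\<^esub> w" using gD f0 True gc wT by (simp add: act_minus)
        then have "act g w = w" using gc wT by (metis T.minus_minus act_closed)
        then show ?thesis using that[of \<one>] P_one mv_one[OF D0(1)] True wT by simp
      next
        case False
        then obtain x where "x \<in> P" "mv x D0 = D" "f D = act x w" using f(1)[OF D] by (auto simp: cand_def orb_def)
        then show ?thesis using that gD by simp
      qed
      have xc: "x \<in> carrier G" using x by simp
      have "mv (inv x \<otimes> g \<otimes> x) D0 = D0" using xc gc x D0(1) D mvN[OF gN D] mv_inv(1)[of x D0] by (simp add: mv_mult)
      moreover have "inv x \<otimes> g \<otimes> x \<in> P" using conj_inv_P x g by simp
      ultimately have m: "inv x \<otimes> g \<otimes> x \<in> N" using N(2)[OF D0(1)] by blast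
      have "act (inv x \<otimes> g \<otimes> x) w = w" using e xc gc wT by (simp add: act_mult)
      then have "act (inv x \<otimes> g \<otimes> x) u' = u'" if "u' \<in> blk D0" for u'
        using w m that by (auto simp: regular_for_def)
      then show "act g u = u" using block_translate[OF _ x(2) D0(1) gc _ u] x(1) by blast
    qed (use mv_closed in blast)
  qed
  ultimately have "regular_for P Q U v" by (auto simp: regular_for_def)
  then show ?thesis by blast
qed

end

section \<open>Imprimitive modules\<close>

context group
begin

definition conj_set :: "'a \<Rightarrow> 'a set \<Rightarrow> 'a set" where
  "conj_set g H = (\<lambda>x. g \<otimes> x \<otimes> inv g) ` H"

lemma conj_set_mult:
  assumes "g \<in> carrier G" "h \<in> carrier G" "H \<subseteq> carrier G"
  shows "conj_set (g \<otimes> h) H = conj_set g (conj_set h H)"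
  unfolding conj_set_def image_image using assms by (intro image_cong) (auto simp: grp_simps subset_iff)

lemma conj_set_one: "H \<subseteq> carrier G \<Longrightarrow> conj_set \<one> H = H"
  by (force simp: conj_set_def subset_iff)

lemma conj_set_closed: "g \<in> carrier G \<Longrightarrow> H \<subseteq> carrier G \<Longrightarrow> conj_set g H \<subseteq> carrier G"
  by (auto simp: conj_set_def)

lemma conj_set_inv:
  assumes "g \<in> carrier G" "H \<subseteq> carrier G"
  shows "conj_set (inv g) (conj_set g H) = H" "conj_set g (conj_set (inv g) H) = H"
  using conj_set_mult[of "inv g" g H] conj_set_mult[of g "inv g" H] conj_set_one assms by simp_all

lemma conj_set_subgroup:
  assumes g: "g \<in> carrier G" and H: "subgroup H G"
  shows "subgroup (conj_set g H) G"
proof (rule subgroupI)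
  note Hc = subgroup.mem_carrier[OF H]
  show "conj_set g H \<subseteq> carrier G" using conj_set_closed[OF g subgroup.subset[OF H]] .
  show "conj_set g H \<noteq> {}" using subgroup.one_closed[OF H] by (auto simp: conj_set_def)
next
  note Hc = subgroup.mem_carrier[OF H]
  fix x assume "x \<in> conj_set g H"
  then obtain h where h: "h \<in> H" "x = g \<otimes> h \<otimes> inv g" by (auto simp: conj_set_def)
  then have "inv x = g \<otimes> inv h \<otimes> inv g" using g Hc by (simp add: grp_simps)
  then show "inv x \<in> conj_set g H" using subgroup.m_inv_closed[OF H h(1)] by (auto simp: conj_set_def)
next
  note Hc = subgroup.mem_carrier[OF H]
  fix x y assume "x \<in> conj_set g H" "y \<in> conj_set g H"
  then obtain h k where h: "h \<in> H" "x = g \<otimes> h \<otimes> inv g" "k \<in> H" "y = g \<otimes> k \<otimes> inv g" by (auto simp: conj_set_def)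
  then have "x \<otimes> y = g \<otimes> (h \<otimes> k) \<otimes> inv g" using g Hc by (simp add: grp_simps)
  then show "x \<otimes> y \<in> conj_set g H" using subgroup.m_closed[OF H h(1,3)] by (auto simp: conj_set_def)
qed

end

context lin_action
begin

text \<open>\<open>Bcomm\<close> asks only for commuting operators on \<open>U\<close>, because
  \<open>B\<close> will be the preimage of an abelian group of operators. The set \<open>X1\<close>
  in the proof takes the place of the kernels of the irreducible constituents of \<open>U\<close>
  under \<open>B\<close>, and the blocks are indexed by orbits on it.\<close>

lemma imprimitive_regular:
  fixes p n b :: nat
  assumes p: "Factorial_Ring.prime p" "odd p" "p \<noteq> q" "odd q"
    and P: "subgroup P G" and card_P: "card P = p ^ n"
    and Q: "subgroup Q G" and card_Q: "card Q = q ^ b" and Q_norm_P: "normalized_by Q P"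
    and U: "submod (P \<union> Q) U"
    and irred: "\<And>W. submod (P \<union> Q) W \<Longrightarrow> W \<subseteq> U \<Longrightarrow> W \<noteq> {\<zero>\<^bsub>T\<^esub>} \<Longrightarrow> W = U"
    and B: "subgroup B G" "B \<subseteq> P" and nB: "normalized_by (P \<union> Q) B"
    and Bcomm: "\<And>x y u. x \<in> B \<Longrightarrow> y \<in> B \<Longrightarrow> u \<in> U \<Longrightarrow> act (x \<otimes> y) u = act (y \<otimes> x) u"
    and b0: "b0 \<in> B" and u0: "u0 \<in> U" "u0 \<noteq> \<zero>\<^bsub>T\<^esub>" "act b0 u0 = u0" and u1: "u1 \<in> U" "act b0 u1 \<noteq> u1"
    and IH: "\<And>P' Q' W. subgroup P' G \<Longrightarrow> P' \<subseteq> P \<Longrightarrow> subgroup Q' G \<Longrightarrow> Q' \<subseteq> Q \<Longrightarrow> normalized_by Q' P' \<Longrightarrow>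
        submod (P' \<union> Q') W \<Longrightarrow> W \<subset> U \<Longrightarrow> \<exists>v. regular_for P' Q' W v"
  shows "\<exists>v. regular_for P Q U v"
proof -
  let ?S = "P \<union> Q"
  have Sc: "x \<in> carrier G" if "x \<in> ?S" for x using that P Q by (auto dest: subgroup.mem_carrier)
  have S_inv: "inv x \<in> ?S" if "x \<in> ?S" for x using that P Q by (auto dest: subgroup.m_inv_closed)
  have UT: "u \<in> carrier T" if "u \<in> U" for u using submodD(1)[OF U that] .
  have Bc: "x \<in> carrier G" if "x \<in> B" for x using B(1) that by (rule subgroup.mem_carrier)
  have BS: "x \<in> ?S" if "x \<in> B" for x using B(2) that by blast
  have S_norm_P: "normalized_by ?S P"
    using Q_norm_P subgroup.m_closed[OF P] subgroup.m_inv_closed[OF P] by (auto simp: normalized_by_def)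
  have conj_inv: "inv g \<otimes> x \<otimes> g \<in> N" if "normalized_by ?S N" "g \<in> ?S" "x \<in> N" for N g x
    using normalized_by_inv[OF P Q that] .
  \<comment> \<open>For distinct members of \<open>X1\<close>, the trace of one kills the fixed vectors of the other, so the
    traces serve as projections onto the blocks.\<close>
  define fx where "fx = (\<lambda>H. {u \<in> U. \<forall>h\<in>H. act h u = u})"
  define ok where "ok = (\<lambda>H. subgroup H G \<and> H \<subseteq> B \<and> (\<exists>u\<in>fx H. u \<noteq> \<zero>\<^bsub>T\<^esub>))"
  define X1 where "X1 = {H. ok H \<and> (\<forall>H'. ok H' \<longrightarrow> H \<subseteq> H' \<longrightarrow> H' = H)}"
  have stab_ok: "ok {h \<in> B. act h t = t}" if t: "t \<in> U" "t \<noteq> \<zero>\<^bsub>T\<^esub>" for t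
    unfolding ok_def
  proof (intro conjI)
    show "subgroup {h \<in> B. act h t = t} G"
    proof (rule subgroupI)
      show "{h \<in> B. act h t = t} \<noteq> {}" using subgroup.one_closed[OF B(1)] UT[OF t(1)] by auto
    qed (use Bc UT[OF t(1)] act_inv_fixed subgroup.m_inv_closed[OF B(1)] subgroup.m_closed[OF B(1)] act_mult in auto)
  qed (use t in \<open>auto simp: fx_def\<close>)
  have finB: "finite B" using finite_G subgroup.subset[OF B(1)] finite_subset by blast
  have fin_ok: "finite {H. ok H}" by (rule finite_subset[of _ "Pow B"]) (auto simp: ok_def finB)
  have ok_ext: "\<exists>H'\<in>X1. H \<subseteq> H'" if "ok H" for H
    using finite_has_maximal2[OF fin_ok, of H] that by (auto simp: X1_def)
  have X1sub: "subgroup H G" "H \<subseteq> B" "H \<subseteq> carrier G" if "H \<in> X1" for H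
    using that Bc by (auto simp: X1_def ok_def)
  have finX1: "finite X1" by (rule finite_subset[OF _ fin_ok]) (auto simp: X1_def)
  have X1ndvd: "\<not> q dvd card H" if "H \<in> X1" for H
  proof -
    have "card H dvd p ^ n" using subgroup_card_dvd[OF X1sub(1)[OF that] P] X1sub(2)[OF that] B(2) card_P by auto
    then show ?thesis using p prime_q by (metis dvd_trans prime_dvd_power primes_dvd_imp_eq)
  qed
  have trU: "tr H u \<in> U" if "H \<in> X1" "u \<in> U" for H u
    using tr_submod[OF U _ that(2)] X1sub(2)[OF that(1)] BS by blast
  \<comment> \<open>The trace \<open>tr H' u\<close> is fixed by \<open>H'\<close>, and also by
    \<open>H\<close> because \<open>B\<close> acts commutatively. If it were nonzero, its stabilizer
    in \<open>B\<close> would equal both \<open>H\<close> and \<open>H'\<close> by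
    maximality.\<close>
  have tr0: "tr H' u = \<zero>\<^bsub>T\<^esub>" if H: "H \<in> X1" and H': "H' \<in> X1" and ne: "H \<noteq> H'" and u: "u \<in> fx H" for H H' u
  proof (rule ccontr)
    assume nz: "tr H' u \<noteq> \<zero>\<^bsub>T\<^esub>"
    define t where "t = tr H' u"
    have uU: "u \<in> U" using u by (simp add: fx_def)
    have tU: "t \<in> U" unfolding t_def using trU[OF H' uU] .
    let ?D = "{h \<in> B. act h t = t}"
    have D: "ok ?D" using stab_ok[OF tU] nz by (simp add: t_def)
    have "H' \<subseteq> ?D" using tr_fixed[OF X1sub(1)[OF H'] _ UT[OF uU]] X1sub(2)[OF H'] by (auto simp: t_def)
    moreover have "H \<subseteq> ?D"
    proof
      fix h assume h: "h \<in> H"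
      have hB: "h \<in> B" using h X1sub(2)[OF H] by blast
      have "act h t = (\<Oplus>\<^bsub>T\<^esub>x\<in>H'. act h (act x u))"
        unfolding t_def tr_def using Bc[OF hB] X1sub(3)[OF H'] UT[OF uU] by (intro act_sum) auto
      also have "\<dots> = (\<Oplus>\<^bsub>T\<^esub>x\<in>H'. act x u)"
      proof (rule T.finsum_cong')
        fix x assume x: "x \<in> H'"
        have xB: "x \<in> B" using x X1sub(2)[OF H'] by blast
        have "act h (act x u) = act (x \<otimes> h) u" using Bcomm[OF hB xB uU] Bc hB xB UT[OF uU] by (simp add: act_mult)
        also have "\<dots> = act x u" using u h Bc hB xB UT[OF uU] by (simp add: act_mult fx_def)
        finally show "act h (act x u) = act x u" .
      qed (use X1sub(3)[OF H'] UT[OF uU] in auto)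
      finally show "h \<in> ?D" using hB by (simp add: t_def tr_def)
    qed
    ultimately have "?D = H" "?D = H'" using H H' D by (auto simp: X1_def)
    then show False using ne by simp
  qed
  have tr_inj: "u = \<zero>\<^bsub>T\<^esub>" if "H \<in> X1" "u \<in> fx H" "tr H u = \<zero>\<^bsub>T\<^esub>" for H u
  proof -
    have "[card H] \<cdot>\<^bsub>T\<^esub> u = \<zero>\<^bsub>T\<^esub>" using tr_of_fixed[of u H] that UT by (simp add: fx_def)
    then show ?thesis using coprime_torsion[OF X1ndvd[OF that(1)]] UT that(2) by (simp add: fx_def)
  qed
  have fx_conj: "act g u \<in> fx (conj_set g H)" if g: "g \<in> ?S" and H: "H \<subseteq> carrier G" and u: "u \<in> fx H" for g H u
  proof -
    have uU: "u \<in> U" using u by (simp add: fx_def)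
    have "act (g \<otimes> h \<otimes> inv g) (act g u) = act g u" if h: "h \<in> H" for h
    proof -
      have "h \<in> carrier G" using h H by blast
      then show ?thesis using Sc[OF g] UT[OF uU] u h by (simp add: act_mult fx_def)
    qed
    then show ?thesis using submodD(5)[OF U g uU] by (auto simp: fx_def conj_set_def)
  qed
  have ok_conj: "ok (conj_set g H)" if g: "g \<in> ?S" and H: "ok H" for g H
    unfolding ok_def
  proof (intro conjI)
    have H': "subgroup H G" "H \<subseteq> B" using H by (auto simp: ok_def)
    show "subgroup (conj_set g H) G" using conj_set_subgroup[OF Sc[OF g] H'(1)] .
    show "conj_set g H \<subseteq> B" using normalized_byD[OF nB g] H' by (auto simp: conj_set_def)
    obtain u where u: "u \<in> fx H" "u \<noteq> \<zero>\<^bsub>T\<^esub>" using H by (auto simp: ok_def)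
    have uT: "u \<in> carrier T" using u UT by (simp add: fx_def)
    have "act g u \<noteq> \<zero>\<^bsub>T\<^esub>" using act_inv(1)[OF Sc[OF g] uT] u Sc[OF g] by auto
    then show "\<exists>u\<in>fx (conj_set g H). u \<noteq> \<zero>\<^bsub>T\<^esub>" using fx_conj[OF g subgroup.subset[OF H'(1)] u(1)] by blast
  qed
  have X1_conj: "conj_set g H \<in> X1" if g: "g \<in> ?S" and H: "H \<in> X1" for g H
  proof -
    have okH: "ok H" using H by (simp add: X1_def)
    have "H' = conj_set g H" if H': "ok H'" "conj_set g H \<subseteq> H'" for H'
    proof -
      have H'c: "H' \<subseteq> carrier G" using H' Bc by (auto simp: ok_def)
      have "conj_set (inv g) (conj_set g H) \<subseteq> conj_set (inv g) H'" using H'(2) by (auto simp: conj_set_def)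
      then have "H \<subseteq> conj_set (inv g) H'" using conj_set_inv(1)[OF Sc[OF g] X1sub(3)[OF H]] by simp
      then have "conj_set (inv g) H' = H" using H ok_conj[OF S_inv[OF g] H'(1)] by (auto simp: X1_def)
      then show ?thesis using conj_set_inv(2)[OF Sc[OF g] H'c] by simp
    qed
    then show ?thesis using ok_conj[OF g okH] by (auto simp: X1_def)
  qed
  obtain H0 where H0: "H0 \<in> X1" "b0 \<in> H0"
    using ok_ext[OF stab_ok[OF u0(1,2)]] b0 u0(3) by blast
  \<comment> \<open>A single member would be normalized by \<open>P \<union> Q\<close>, so its fixed
    space would be all of \<open>U\<close>, although \<open>b0\<close> in \<open>H0\<close> moves
    \<open>u1\<close>.\<close>
  have two: "\<exists>H1\<in>X1. H1 \<noteq> H0"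
  proof (rule ccontr)
    assume "\<not> ?thesis"
    then have c: "conj_set g H0 = H0" if "g \<in> ?S" for g using X1_conj[OF that H0(1)] by blast
    have "inv g \<otimes> h \<otimes> g \<in> H0" if "g \<in> ?S" "h \<in> H0" for g h
    proof -
      have "inv g \<otimes> h \<otimes> inv (inv g) \<in> conj_set (inv g) H0" using that(2) by (auto simp: conj_set_def)
      then show ?thesis using c[OF S_inv[OF that(1)]] Sc[OF that(1)] by simp
    qed
    then have "submod ?S (fx H0)"
      unfolding fx_def using Sc X1sub(3)[OF H0(1)] by (intro fixed_submod[OF U]) auto
    moreover have "fx H0 \<subseteq> U" by (auto simp: fx_def)
    moreover have "fx H0 \<noteq> {\<zero>\<^bsub>T\<^esub>}" using H0 by (auto simp: X1_def ok_def)
    ultimately have "fx H0 = U" using irred by blast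
    then show False using u1 H0 by (auto simp: fx_def)
  qed

  \<comment> \<open>The index set of the blocks: orbits of a maximal intransitive normalized
    subgroup \<open>N\<close>\<close>
  define intr where "intr = (\<lambda>N. subgroup N G \<and> N \<subseteq> P \<and> normalized_by ?S N \<and>
      (\<exists>H\<in>X1. \<exists>H'\<in>X1. \<forall>g\<in>N. conj_set g H \<noteq> H'))"
  have finP: "finite P" using finite_G subgroup.subset[OF P] finite_subset by blast
  have "finite {N. intr N}" by (rule finite_subset[of _ "Pow P"]) (auto simp: intr_def finP)
  moreover have "intr {\<one>}"
  proof -
    obtain H1 where "H1 \<in> X1" "H1 \<noteq> H0" using two by blast
    then have "\<exists>H\<in>X1. \<exists>H'\<in>X1. \<forall>g\<in>{\<one>}. conj_set g H \<noteq> H'"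
      using H0(1) conj_set_one[OF X1sub(3)[OF H0(1)]] by auto
    then show ?thesis
      using Sc subgroup.one_closed[OF P] by (auto simp: intr_def triv_subgroup normalized_by_def)
  qed
  ultimately obtain N where N: "intr N" "\<And>M. intr M \<Longrightarrow> N \<subseteq> M \<Longrightarrow> M = N"
    using finite_has_maximal[of "{N. intr N}"] by blast
  have sN: "subgroup N G" and NP: "N \<subseteq> P" and nN: "normalized_by ?S N" using N(1) by (auto simp: intr_def)
  have Nc: "x \<in> carrier G" if "x \<in> N" for x using sN that by (rule subgroup.mem_carrier)
  have NS: "x \<in> ?S" if "x \<in> N" for x using NP that by blast
  define orb where "orb = (\<lambda>H. (\<lambda>g. conj_set g H) ` N)"
  define \<Omega> where "\<Omega> = orb ` X1"
  define mv where "mv = (\<lambda>g D. conj_set g ` D)"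
  \<comment> \<open>Vanishing traces, rather than sums of the spaces \<open>fx H\<close>, describe
    the blocks; invariance and independence then follow from the behaviour of traces.\<close>
  define blk where "blk = (\<lambda>D. {u \<in> U. \<forall>H\<in>X1 - D. tr H u = \<zero>\<^bsub>T\<^esub>})"
  have orb_self: "H \<in> orb H" if "H \<in> X1" for H
    unfolding orb_def using conj_set_one[OF X1sub(3)[OF that]] subgroup.one_closed[OF sN] by (metis imageI)
  have orb_X1: "orb H \<subseteq> X1" if "H \<in> X1" for H using X1_conj NS that by (auto simp: orb_def)
  have Om_X1: "D \<subseteq> X1" if "D \<in> \<Omega>" for D using that orb_X1 by (auto simp: \<Omega>_def)
  have orb_eq: "orb (conj_set g H) = orb H" if g: "g \<in> N" and H: "H \<in> X1" for g H
  proof (intro equalityI subsetI)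
    note Hc = X1sub(3)[OF H]
    {
      fix A assume "A \<in> orb (conj_set g H)"
      then obtain h where "h \<in> N" "A = conj_set h (conj_set g H)" by (auto simp: orb_def)
      then show "A \<in> orb H" using conj_set_mult[of h g H] Nc g Hc subgroup.m_closed[OF sN, of h g] by (auto simp: orb_def)
    }
    fix A assume "A \<in> orb H"
    then obtain h where h: "h \<in> N" "A = conj_set h H" by (auto simp: orb_def)
    have "A = conj_set (h \<otimes> inv g) (conj_set g H)"
      using conj_set_mult[of h "inv g" "conj_set g H"] conj_set_inv(1)[of g H] h Nc g Hc conj_set_closed by simp
    moreover have "h \<otimes> inv g \<in> N" using h g subgroup.m_closed[OF sN] subgroup.m_inv_closed[OF sN] by blast
    ultimately show "A \<in> orb (conj_set g H)" by (auto simp: orb_def)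
  qed
  have Om_orb: "D = orb H" if D: "D \<in> \<Omega>" and H: "H \<in> D" for D H
  proof -
    obtain H' where H': "H' \<in> X1" "D = orb H'" using D by (auto simp: \<Omega>_def)
    then obtain g where "g \<in> N" "H = conj_set g H'" using H by (auto simp: orb_def)
    then show ?thesis using orb_eq H' by simp
  qed
  have mv_orb: "mv g (orb H) = orb (conj_set g H)" if g: "g \<in> ?S" and H: "H \<in> X1" for g H
  proof (intro equalityI subsetI)
    note Hc = X1sub(3)[OF H] and gc = Sc[OF g]
    {
      fix A assume "A \<in> mv g (orb H)"
      then obtain m where m: "m \<in> N" "A = conj_set g (conj_set m H)" by (auto simp: orb_def mv_def)
      have mc: "m \<in> carrier G" using Nc m by simp
      have "A = conj_set ((g \<otimes> m \<otimes> inv g) \<otimes> g) H"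
        using m conj_set_mult[of g m H] gc mc Hc by (simp add: grp_simps)
      then have "A = conj_set (g \<otimes> m \<otimes> inv g) (conj_set g H)"
        using conj_set_mult[of "g \<otimes> m \<otimes> inv g" g H] gc mc Hc by simp
      then show "A \<in> orb (conj_set g H)" using normalized_byD[OF nN g m(1)] by (auto simp: orb_def)
    }
    fix A assume "A \<in> orb (conj_set g H)"
    then obtain m where m: "m \<in> N" "A = conj_set m (conj_set g H)" by (auto simp: orb_def)
    have mc: "m \<in> carrier G" using Nc m by simp
    have "A = conj_set (g \<otimes> (inv g \<otimes> m \<otimes> g)) H"
      using m conj_set_mult[of m g H] gc mc Hc by (simp add: grp_simps)
    then have "A = conj_set g (conj_set (inv g \<otimes> m \<otimes> g) H)"
      using conj_set_mult[of g "inv g \<otimes> m \<otimes> g" H] gc mc Hc by simp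
    then show "A \<in> mv g (orb H)" using conj_inv[OF nN g m(1)] by (auto simp: orb_def mv_def)
  qed
  have mv_closed: "mv g D \<in> \<Omega>" if "g \<in> ?S" "D \<in> \<Omega>" for g D
    using that mv_orb X1_conj by (auto simp: \<Omega>_def)
  have mv_one: "mv \<one> D = D" if "D \<in> \<Omega>" for D
  proof -
    have "conj_set \<one> H = H" if "H \<in> D" for H using conj_set_one X1sub(3) Om_X1[OF \<open>D \<in> \<Omega>\<close>] that by blast
    then show ?thesis unfolding mv_def by (metis image_cong image_ident)
  qed
  have mv_mult: "mv (g \<otimes> h) D = mv g (mv h D)" if "g \<in> carrier G" "h \<in> carrier G" "D \<in> \<Omega>" for g h D
    unfolding mv_def image_image using conj_set_mult that X1sub(3) Om_X1[OF that(3)] by (intro image_cong) auto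
  have mvN: "mv g D = D" if g: "g \<in> N" and D: "D \<in> \<Omega>" for g D
    using mv_orb[OF NS[OF g]] orb_eq[OF g] D by (auto simp: \<Omega>_def)
  have two_Om: "\<exists>H\<in>X1. H \<notin> D" if D: "D \<in> \<Omega>" for D
  proof (rule ccontr)
    assume "\<not> ?thesis"
    then have DX: "D = X1" using Om_X1[OF D] by blast
    obtain H H' where H: "H \<in> X1" "H' \<in> X1" "\<forall>g\<in>N. conj_set g H \<noteq> H'" using N(1) by (auto simp: intr_def)
    have "D = orb H" using Om_orb[OF D] DX H by blast
    then show False using H DX by (auto simp: orb_def)
  qed

  \<comment> \<open>The blocks are proper, nonzero and independent\<close>
  have blk_sub: "submod {} (blk D)" for D
  proof (rule submodI)
    show "\<ominus>\<^bsub>T\<^esub> v \<in> blk D" if "v \<in> blk D" for v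
      using that X1sub(3) UT submodD(4)[OF U] by (auto simp: blk_def tr_minus)
    show "v \<oplus>\<^bsub>T\<^esub> w \<in> blk D" if "v \<in> blk D" "w \<in> blk D" for v w
      using that X1sub(3) UT submodD(3)[OF U] by (auto simp: blk_def tr_add)
  qed (use X1sub(3) UT submodD(2)[OF U] in \<open>auto simp: blk_def\<close>)
  have tr_act: "tr H (act g u) = act g (tr (conj_set (inv g) H) u)" if "g \<in> ?S" "H \<in> X1" "u \<in> U" for g H u
    using act_tr[of "conj_set (inv g) H" g u] conj_set_inv(2)[of g H] Sc[OF that(1)] X1sub(3)[OF that(2)] UT[OF that(3)]
      conj_set_closed[of "inv g" H] by (simp add: conj_set_def)
  have fx_blk: "fx H \<subseteq> blk D" if "D \<in> \<Omega>" "H \<in> D" for D H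
    using tr0[of H] Om_X1[OF that(1)] that(2) by (auto simp: blk_def fx_def)
  have fx_nz: "\<exists>u\<in>fx H. u \<noteq> \<zero>\<^bsub>T\<^esub>" if "H \<in> X1" for H using that by (auto simp: X1_def ok_def)
  have Om_ne: "\<exists>H. H \<in> D" if "D \<in> \<Omega>" for D using that orb_self by (auto simp: \<Omega>_def)
  define rad where "rad = {u \<in> U. \<forall>H\<in>X1. tr H u = \<zero>\<^bsub>T\<^esub>}"
  \<comment> \<open>The common kernel of all traces is a submodule, and it is not \<open>U\<close>
    because \<open>tr H0\<close> is injective on the nonzero space \<open>fx H0\<close>.\<close>
  have rad: "rad = {\<zero>\<^bsub>T\<^esub>}"
  proof (rule ccontr)
    assume ne: "rad \<noteq> {\<zero>\<^bsub>T\<^esub>}"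
    have "submod ?S rad"
    proof (rule submodI)
      show "act g v \<in> rad" if "g \<in> ?S" "v \<in> rad" for g v
        using that tr_act[OF that(1)] X1_conj[OF S_inv[OF that(1)]] submodD(5)[OF U that(1)] Sc[OF that(1)]
        by (auto simp: rad_def)
      show "\<ominus>\<^bsub>T\<^esub> v \<in> rad" if "v \<in> rad" for v
        using that X1sub(3) UT submodD(4)[OF U] by (auto simp: rad_def tr_minus)
      show "v \<oplus>\<^bsub>T\<^esub> w \<in> rad" if "v \<in> rad" "w \<in> rad" for v w
        using that X1sub(3) UT submodD(3)[OF U] by (auto simp: rad_def tr_add)
    qed (use X1sub(3) UT submodD(2)[OF U] in \<open>auto simp: rad_def\<close>)
    then have "rad = U" using irred ne by (auto simp: rad_def)
    obtain u where u: "u \<in> fx H0" "u \<noteq> \<zero>\<^bsub>T\<^esub>" using fx_nz[OF H0(1)] by blast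
    then have "tr H0 u = \<zero>\<^bsub>T\<^esub>" using \<open>rad = U\<close> H0 by (auto simp: fx_def rad_def)
    then show False using tr_inj[OF H0(1) u(1)] u by simp
  qed
  have finOm: "finite \<Omega>" using finX1 by (simp add: \<Omega>_def)
  have bs: "block_system G T act q p n b P Q U \<Omega> mv blk"
  proof (intro block_system.intro block_system_axioms.intro lin_action_axioms)
    show "blk D \<subset> U" if D: "D \<in> \<Omega>" for D
    proof -
      obtain H where H: "H \<in> X1" "H \<notin> D" using two_Om[OF D] by blast
      obtain u where u: "u \<in> fx H" "u \<noteq> \<zero>\<^bsub>T\<^esub>" using fx_nz[OF H(1)] by blast
      have "u \<notin> blk D" using tr_inj[OF H(1) u(1)] u H by (auto simp: blk_def)
      moreover have "u \<in> U" using u by (simp add: fx_def)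
      ultimately show ?thesis by (auto simp: blk_def)
    qed
    show "blk D \<noteq> {\<zero>\<^bsub>T\<^esub>}" if D: "D \<in> \<Omega>" for D
      using Om_ne[OF D] fx_blk[OF D] fx_nz Om_X1[OF D] by blast
    show "act g u \<in> blk (mv g D)" if g: "g \<in> ?S" and D: "D \<in> \<Omega>" and u: "u \<in> blk D" for g D u
    proof -
      have uU: "u \<in> U" using u by (simp add: blk_def)
      have "tr H (act g u) = \<zero>\<^bsub>T\<^esub>" if H: "H \<in> X1" "H \<notin> mv g D" for H
      proof -
        have "conj_set (inv g) H \<notin> D"
        proof
          assume "conj_set (inv g) H \<in> D"
          then have "conj_set g (conj_set (inv g) H) \<in> mv g D" by (auto simp: mv_def)
          then show False using H conj_set_inv(2)[OF Sc[OF g] X1sub(3)[OF H(1)]] by simp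
        qed
        then have "tr (conj_set (inv g) H) u = \<zero>\<^bsub>T\<^esub>" using u X1_conj[OF S_inv[OF g] H(1)] by (auto simp: blk_def)
        then show ?thesis using tr_act[OF g H(1) uU] Sc[OF g] by simp
      qed
      then show ?thesis using submodD(5)[OF U g uU] by (auto simp: blk_def)
    qed
  next
    fix f f' D
    assume f: "\<And>D. D \<in> \<Omega> \<Longrightarrow> f D \<in> blk D" and f': "\<And>D. D \<in> \<Omega> \<Longrightarrow> f' D \<in> blk D"
      and eq: "(\<Oplus>\<^bsub>T\<^esub>D\<in>\<Omega>. f D) = (\<Oplus>\<^bsub>T\<^esub>D\<in>\<Omega>. f' D)" and D: "D \<in> \<Omega>"
    \<comment> \<open>A member \<open>H\<close> of the orbit \<open>D\<close> lies in no other
      orbit, so its trace kills every summand except the one in \<open>blk D\<close>.\<close>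
    have sel: "tr H (\<Oplus>\<^bsub>T\<^esub>D\<in>\<Omega>. h D) = tr H (h D)" if h: "\<And>D. D \<in> \<Omega> \<Longrightarrow> h D \<in> blk D" and H: "H \<in> D" for h H
    proof -
      have HX: "H \<in> X1" using H Om_X1[OF D] by blast
      have hT: "h E \<in> carrier T" if "E \<in> \<Omega>" for E using h[OF that] UT by (auto simp: blk_def)
      have z: "tr H (h E) = \<zero>\<^bsub>T\<^esub>" if "E \<in> \<Omega> - {D}" for E
      proof -
        have "H \<notin> E" using Om_orb[of E H] Om_orb[OF D H] that by auto
        then show ?thesis using h[of E] that HX by (auto simp: blk_def)
      qed
      have "tr H (\<Oplus>\<^bsub>T\<^esub>D\<in>\<Omega>. h D) = (\<Oplus>\<^bsub>T\<^esub>E\<in>\<Omega>. tr H (h E))"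
        using tr_sum[of H \<Omega> h] X1sub(3)[OF HX] hT by simp
      also have "\<dots> = (\<Oplus>\<^bsub>T\<^esub>E\<in>{D}. tr H (h E))"
        by (rule T.add.finprod_mono_neutral_cong_right) (use finOm D z X1sub(3)[OF HX] hT in auto)
      finally show ?thesis using X1sub(3)[OF HX] hT[OF D] by simp
    qed
    have fU: "f D \<in> U" "f' D \<in> U" using f[OF D] f'[OF D] by (auto simp: blk_def)
    have "tr H (f D) = tr H (f' D)" if H: "H \<in> X1" for H
    proof (cases "H \<in> D")
      case True
      then show ?thesis using sel[of f H, OF f True] sel[of f' H, OF f' True] eq by simp
    next
      case False
      then show ?thesis using f[OF D] f'[OF D] H by (auto simp: blk_def)
    qed
    then have "tr H (f D \<oplus>\<^bsub>T\<^esub> \<ominus>\<^bsub>T\<^esub> f' D) = \<zero>\<^bsub>T\<^esub>" if "H \<in> X1" for H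
      using that X1sub(3)[OF that] UT fU by (simp add: tr_add tr_minus T.r_neg)
    then have "f D \<oplus>\<^bsub>T\<^esub> \<ominus>\<^bsub>T\<^esub> f' D \<in> rad" using fU submodD(3,4)[OF U] by (auto simp: rad_def)
    then have "f D \<oplus>\<^bsub>T\<^esub> \<ominus>\<^bsub>T\<^esub> f' D = \<zero>\<^bsub>T\<^esub>" using rad by simp
    then show "f D = f' D" using UT fU by (metis T.add.inv_closed T.minus_minus T.minus_equality)
  qed (use p P card_P Q card_Q Q_norm_P U irred finOm H0 mv_closed mv_one mv_mult blk_sub in \<open>auto simp: \<Omega>_def\<close>)

  \<comment> \<open>Blocks all fixed by \<open>P\<close>, or permuted regularly by
    \<open>P/N\<close>\<close>
  interpret block_system G T act q p n b P Q U \<Omega> mv blk by (rule bs)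
  show ?thesis
  proof (cases "N = P")
    case True
    show ?thesis
    proof (rule regular_trivial_blocks)
      show "mv g D = D" if "g \<in> P" "D \<in> \<Omega>" for g D using mvN that True by blast
      show "\<exists>v. regular_for P Q' W v" if "subgroup Q' G" "Q' \<subseteq> Q" "submod (P \<union> Q') W" "W \<subset> U" for Q' W
        using IH[OF P order_refl that(1,2) _ that(3,4)] Q_norm_P that(2) by (auto simp: normalized_by_def)
    qed
  next
    case False
    \<comment> \<open>The preimage of the centre of \<open>P/N\<close>. It is strictly larger than
      \<open>N\<close>, so by maximality of \<open>N\<close> it is transitive on
      \<open>X1\<close>.\<close>
    define M where "M = {m \<in> P. \<forall>g\<in>P. g \<otimes> m \<otimes> inv g \<otimes> inv m \<in> N}"
    have MP: "M \<subseteq> P" by (auto simp: M_def)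
    have NM: "N \<subseteq> M"
    proof
      fix x assume x: "x \<in> N"
      have "g \<otimes> x \<otimes> inv g \<otimes> inv x \<in> N" if "g \<in> P" for g
        using normalized_byD[OF nN _ x, of g] that subgroup.m_closed[OF sN] subgroup.m_inv_closed[OF sN x] by blast
      then show "x \<in> M" using x NP by (auto simp: M_def)
    qed
    have conjN: "g \<otimes> x \<otimes> inv g \<in> N" if "g \<in> P" "x \<in> N" for g x using normalized_byD[OF nN] that by blast
    have nNP: "normalized_by P N" using nN by (auto simp: normalized_by_def)
    have sM: "subgroup M G" unfolding M_def using commutator_preimage_subgroup[OF P P order_refl sN nNP] .
    have nM: "normalized_by S M"
      unfolding M_def using commutator_preimage_normalized[OF P Q P S_norm_P S_norm_P nN] .
    obtain d where d: "d \<in> P" "d \<notin> N" "\<And>g. g \<in> P \<Longrightarrow> g \<otimes> d \<otimes> inv g \<otimes> inv d \<in> N"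
      using p_group_central_element[OF P card_P p(1) P order_refl sN NP False] conj_P conjN by auto
    then have "d \<in> M" by (auto simp: M_def)
    then have "\<not> intr M" using N(2)[OF _ NM] d by blast
    then have Mtrans: "\<exists>m\<in>M. conj_set m H = H'" if "H \<in> X1" "H' \<in> X1" for H H'
      using sM MP nM that by (auto simp: intr_def)
    have Mtr: "\<exists>m\<in>M. mv m D = D'" if D: "D \<in> \<Omega>" and D': "D' \<in> \<Omega>" for D D'
    proof -
      obtain H H' where H: "H \<in> X1" "D = orb H" "H' \<in> X1" "D' = orb H'" using D D' by (auto simp: \<Omega>_def)
      obtain m where m: "m \<in> M" "conj_set m H = H'" using Mtrans H by blast
      then have "mv m D = D'" using mv_orb[of m H] MP H by blast
      then show ?thesis using m by blast
    qed
    define L where "L = {g \<in> P. \<forall>D\<in>\<Omega>. mv g D = D}"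
    \<comment> \<open>Modulo \<open>N\<close>, which fixes every block, \<open>g\<close> commutes
      with \<open>M\<close>. An element fixing one block thus fixes all its
      \<open>M\<close>-translates, that is, all blocks.\<close>
    have stab: "g \<in> L" if g: "g \<in> P" and D: "D \<in> \<Omega>" "mv g D = D" for g D
    proof -
      have "mv g D' = D'" if D': "D' \<in> \<Omega>" for D'
      proof -
        obtain m where m: "m \<in> M" "mv m D = D'" using Mtr[OF D(1) D'] by blast
        have mP: "m \<in> P" using m MP by blast
        define x where "x = g \<otimes> m \<otimes> inv g \<otimes> inv m"
        have x: "x \<in> N" unfolding x_def using m g by (auto simp: M_def)
        have "mv g D' = mv (g \<otimes> m) D" using m mv_mult g mP D(1) by simp
        also have "g \<otimes> m = x \<otimes> (m \<otimes> g)" unfolding x_def using g mP by (simp add: grp_simps)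
        also have "mv (x \<otimes> (m \<otimes> g)) D = mv x (mv m (mv g D))" using Nc[OF x] mP g D(1) by (simp add: mv_mult)
        also have "\<dots> = D'" using D m mvN[OF x D'] by simp
        finally show ?thesis .
      qed
      then show ?thesis using g by (auto simp: L_def)
    qed
    \<comment> \<open>The kernel \<open>L\<close> of \<open>P\<close> on the blocks is normalized
      and cannot move a member of one orbit into another, so it too is intransitive and equals
      \<open>N\<close>.\<close>
    have "intr L"
      unfolding intr_def
    proof (intro conjI)
      obtain D where D: "D \<in> \<Omega>" using Om_nonempty by blast
      have "L = {g \<in> P. mv g D = D}" using stab[OF _ D] D by (auto simp: L_def)
      then show "subgroup L G" using stab_subgroup[OF P _ D] by simp
      show "L \<subseteq> P" by (auto simp: L_def)
      show "normalized_by S L"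
        unfolding normalized_by_def
      proof (intro ballI)
        fix h g assume h: "h \<in> S" and g: "g \<in> L"
        have gP: "g \<in> P" using g by (simp add: L_def)
        have "mv (h \<otimes> g \<otimes> inv h) D = D" if D: "D \<in> \<Omega>" for D
        proof -
          have D': "mv (inv h) D \<in> \<Omega>" using mv_closed[OF S_inv[OF h] D] .
          then have "mv g (mv (inv h) D) = mv (inv h) D" using g by (auto simp: L_def)
          then show ?thesis using h gP D D' mv_inv(2)[OF h D] by (simp add: mv_mult)
        qed
        then show "h \<otimes> g \<otimes> inv h \<in> L" using conj_P[OF h gP] by (auto simp: L_def)
      qed
      obtain D where D: "D \<in> \<Omega>" using Om_nonempty by blast
      obtain H where H: "H \<in> D" using Om_ne[OF D] by blast
      obtain H' where H': "H' \<in> X1" "H' \<notin> D" using two_Om[OF D] by blast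
      have "conj_set g H \<noteq> H'" if "g \<in> L" for g
      proof
        assume "conj_set g H = H'"
        then have "H' \<in> mv g D" using H by (auto simp: mv_def)
        then show False using that D H' by (auto simp: L_def)
      qed
      then show "\<exists>H\<in>X1. \<exists>H'\<in>X1. \<forall>g\<in>L. conj_set g H \<noteq> H'" using H H' Om_X1[OF D] by blast
    qed
    moreover have "N \<subseteq> L" using mvN NP by (auto simp: L_def)
    ultimately have LN: "L = N" using N(2) by blast
    show ?thesis
    proof (rule regular_transitive_blocks[OF sN])
      show "{g \<in> P. mv g D = D} = N" if "D \<in> \<Omega>" for D
        using stab[OF _ that] LN mvN[OF _ that] NP by blast
      show "\<exists>g\<in>P. mv g D = D'" if "D \<in> \<Omega>" "D' \<in> \<Omega>" for D D' using Mtr[OF that] MP by blast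
      show "\<exists>v. regular_for N Q W v" if "submod (N \<union> Q) W" "W \<subset> U" for W
        using IH[OF sN NP Q order_refl _ that] nN by (auto simp: normalized_by_def)
    qed
  qed
qed

end

section \<open>Existence of regular vectors\<close>

context lin_action
begin

text \<open>If no regular vector existed, \<open>imprimitive_regular\<close> would exclude every
  offending abelian subgroup, and \<open>regular_fixed_vector\<close> would then make every nonzero
  \<open>Q\<close>-fixed vector regular.\<close>

lemma irreducible_regular:
  fixes p n b :: nat
  assumes p: "Factorial_Ring.prime p" "odd p" "p \<noteq> q" "odd q"
    and P: "subgroup P G" and card_P: "card P = p ^ n"
    and Q: "subgroup Q G" and card_Q: "card Q = q ^ b" and Q_norm_P: "normalized_by Q P"
    and U: "submod (P \<union> Q) U" and U0: "U \<noteq> {\<zero>\<^bsub>T\<^esub>}"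
    and irred: "\<And>W. submod (P \<union> Q) W \<Longrightarrow> W \<subseteq> U \<Longrightarrow> W \<noteq> {\<zero>\<^bsub>T\<^esub>} \<Longrightarrow> W = U"
    and IH: "\<And>P' Q' W. subgroup P' G \<Longrightarrow> P' \<subseteq> P \<Longrightarrow> subgroup Q' G \<Longrightarrow> Q' \<subseteq> Q \<Longrightarrow> normalized_by Q' P' \<Longrightarrow>
        submod (P' \<union> Q') W \<Longrightarrow> W \<subset> U \<Longrightarrow> \<exists>v. regular_for P' Q' W v"
  shows "\<exists>v. regular_for P Q U v"
proof (rule ccontr)
  assume neg: "\<not> ?thesis"
  have UT: "u \<in> carrier T" if "u \<in> U" for u using submodD(1)[OF U that] .
  have finU: "finite U" using submod_finite[OF U] .
  \<comment> \<open>The setwise stabilizer of \<open>U\<close>, a subgroup containing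
    \<open>P\<close> and \<open>Q\<close> on which restriction to \<open>U\<close> is a
    homomorphism.\<close>
  define H where "H = {g \<in> carrier G. \<forall>u\<in>U. act g u \<in> U}"
  have Hc: "g \<in> carrier G" if "g \<in> H" for g using that by (simp add: H_def)
  have HU: "act g u \<in> U" if "g \<in> H" "u \<in> U" for g u using that by (simp add: H_def)
  have sH: "subgroup H G"
  proof (rule subgroupI)
    show "H \<noteq> {}" using UT one_closed by (auto simp: H_def intro!: exI[of _ \<one>])
    show "inv g \<in> H" if g: "g \<in> H" for g
    proof -
      have inj: "inj_on (act g) U" using act_inj[OF Hc[OF g]] UT by (auto simp: inj_on_def)
      have im: "act g ` U = U" using endo_inj_surj[OF finU _ inj] HU[OF g] by blast
      have "act (inv g) u \<in> U" if u: "u \<in> U" for u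
      proof -
        obtain u' where "u' \<in> U" "u = act g u'" using im u by blast
        then show ?thesis using Hc[OF g] UT by simp
      qed
      then show ?thesis using Hc[OF g] by (simp add: H_def)
    qed
  qed (use UT in \<open>auto simp: H_def act_mult\<close>)
  have SH: "g \<in> H" if "g \<in> P \<union> Q" for g
    using that P Q submodD(5)[OF U that] by (auto simp: H_def dest: subgroup.mem_carrier)
  note Hm = subgroup.m_closed[OF sH] and Hi = subgroup.m_inv_closed[OF sH] and H1 = subgroup.one_closed[OF sH]
  define \<rho> where "\<rho> = (\<lambda>g. restrict (act g) U)"
  have \<rho>: "\<rho> g u = act g u" if "u \<in> U" for g u using that by (simp add: \<rho>_def)
  interpret A: group_action "G\<lparr>carrier := H\<rparr>" U \<rho>
    unfolding \<rho>_def by (rule subgroup_action[OF sH]) (use HU UT Hc act_mult in auto)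
  have homA: "group_hom (G\<lparr>carrier := H\<rparr>) (BijGroup U) \<rho>" by (rule A.group_hom)
  define R where "R = (BijGroup U)\<lparr>carrier := \<rho> ` H\<rparr>"
  have "subgroup (\<rho> ` H) (BijGroup U)" using group_hom.img_is_subgroup[OF homA] by simp
  then have gR: "group R" unfolding R_def using group.subgroup_imp_group[OF group_BijGroup] by blast
  interpret R: group R by (rule gR)
  have cR: "carrier R = \<rho> ` H" by (simp add: R_def)
  have \<rho>mult: "\<rho> g \<otimes>\<^bsub>R\<^esub> \<rho> h = \<rho> (g \<otimes> h)" if "g \<in> H" "h \<in> H" for g h
    using group_hom.hom_mult[OF homA, of g h] that by (simp add: R_def)
  have \<rho>one: "\<one>\<^bsub>R\<^esub> = \<rho> \<one>" using group_hom.hom_one[OF homA] by (simp add: R_def)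
  have \<rho>inv: "inv\<^bsub>R\<^esub> (\<rho> g) = \<rho> (inv g)" if "g \<in> H" for g
  proof (rule R.inv_equality)
    show "\<rho> (inv g) \<otimes>\<^bsub>R\<^esub> \<rho> g = \<one>\<^bsub>R\<^esub>" using \<rho>mult[OF Hi[OF that] that] Hc[OF that] \<rho>one by simp
  qed (use that Hi cR in auto)
  have \<rho>eq: "\<rho> g = \<rho> h \<longleftrightarrow> (\<forall>u\<in>U. act g u = act h u)" for g h
    unfolding \<rho>_def restrict_def fun_eq_iff by auto
  have sub_img: "subgroup (\<rho> ` K) R" if K: "subgroup K G" "K \<subseteq> H" for K
  proof (rule R.subgroupI)
    note Km = subgroup.m_closed[OF K(1)] and Ki = subgroup.m_inv_closed[OF K(1)]
    show "\<rho> ` K \<subseteq> carrier R" using K cR by blast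
    show "\<rho> ` K \<noteq> {}" using subgroup.one_closed[OF K(1)] by blast
    show "inv\<^bsub>R\<^esub> x \<in> \<rho> ` K" if "x \<in> \<rho> ` K" for x using that \<rho>inv K(2) Ki by blast
    show "x \<otimes>\<^bsub>R\<^esub> y \<in> \<rho> ` K" if "x \<in> \<rho> ` K" "y \<in> \<rho> ` K" for x y using that \<rho>mult K(2) Km by blast
  qed
  define T' where "T' = T\<lparr>carrier := U\<rparr>"
  have T': "carrier T' = U" "\<zero>\<^bsub>T'\<^esub> = \<zero>\<^bsub>T\<^esub>" "\<And>x y. x \<oplus>\<^bsub>T'\<^esub> y = x \<oplus>\<^bsub>T\<^esub> y" by (simp_all add: T'_def)
  have abT': "abelian_group T'"
  proof (rule abelian_groupI)
    fix x assume x: "x \<in> carrier T'"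
    show "\<exists>y\<in>carrier T'. y \<oplus>\<^bsub>T'\<^esub> x = \<zero>\<^bsub>T'\<^esub>"
      using x submodD(4)[OF U] UT T.l_neg unfolding T' by blast
  qed (use UT submodD[OF U] in \<open>auto simp: T' T.a_ac\<close>)
  have pow': "[k] \<cdot>\<^bsub>T'\<^esub> u = [k] \<cdot>\<^bsub>T\<^esub> u" for k :: nat and u
    by (simp add: add_pow_def nat_pow_def T'_def)
  have lin: "lin_action R T' (\<lambda>f u. f u) q"
  proof (intro lin_action.intro lin_action_axioms.intro gR abT' prime_q)
    have "H \<subseteq> carrier G" using Hc by blast
    then show "finite (carrier R)" using cR finite_subset[OF _ finite_G] by simp
    show "finite (carrier T')" using finU by (simp add: T')
    fix v assume v: "v \<in> carrier T'"
    show "[q] \<cdot>\<^bsub>T'\<^esub> v = \<zero>\<^bsub>T'\<^esub>" using q_torsion UT v by (simp add: pow' T')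
    show "\<one>\<^bsub>R\<^esub> v = v" using v UT by (simp add: \<rho>one \<rho> T')
    fix g assume g: "g \<in> carrier R"
    show "g v \<in> carrier T'" using g v HU \<rho> by (auto simp: cR T')
    show "(g \<otimes>\<^bsub>R\<^esub> h) v = g (h v)" if h: "h \<in> carrier R" for h
    proof -
      obtain g' h' where gh: "g' \<in> H" "g = \<rho> g'" "h' \<in> H" "h = \<rho> h'" using g h by (auto simp: cR)
      have vU: "v \<in> U" using v by (simp add: T')
      show ?thesis unfolding gh \<rho>mult[OF gh(1,3)]
        using \<rho>[OF vU] \<rho>[OF HU[OF gh(3) vU]] act_mult[OF Hc[OF gh(1)] Hc[OF gh(3)] UT[OF vU]] by simp
    qed
    show "g (v \<oplus>\<^bsub>T'\<^esub> w) = g v \<oplus>\<^bsub>T'\<^esub> g w" if w: "w \<in> carrier T'" for w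
    proof -
      obtain g' where g': "g' \<in> H" "g = \<rho> g'" using g by (auto simp: cR)
      show ?thesis using v w UT submodD(3)[OF U] act_add Hc[OF g'(1)] unfolding g' by (simp add: \<rho> T')
    qed
  qed
  have PH: "P \<subseteq> H" and QH: "Q \<subseteq> H" using SH by auto
  have norm_img: "R.normalized_by (\<rho> ` K) (\<rho> ` L)" if "normalized_by K L" "K \<subseteq> H" "L \<subseteq> H" for K L
    unfolding R.normalized_by_def
  proof (intro ballI)
    fix g x assume "g \<in> \<rho> ` K" "x \<in> \<rho> ` L"
    then obtain g' x' where g': "g' \<in> K" "g = \<rho> g'" and x': "x' \<in> L" "x = \<rho> x'" by blast
    have H': "g' \<in> H" "x' \<in> H" using g' x' that(2,3) by auto
    have "g \<otimes>\<^bsub>R\<^esub> x \<otimes>\<^bsub>R\<^esub> inv\<^bsub>R\<^esub> g = \<rho> (g' \<otimes> x' \<otimes> inv g')"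
      unfolding g'(2) x'(2) \<rho>inv[OF H'(1)] \<rho>mult[OF H'] using \<rho>mult[OF Hm[OF H'] Hi[OF H'(1)]] .
    then show "g \<otimes>\<^bsub>R\<^esub> x \<otimes>\<^bsub>R\<^esub> inv\<^bsub>R\<^esub> g \<in> \<rho> ` L" using normalized_byD[OF that(1) g'(1) x'(1)] by blast
  qed
  \<comment> \<open>The image of \<open>P\<close> is the orbit of the identity under left
    multiplication by \<open>P\<close>, so its size divides \<open>card P\<close>.\<close>
  have "card (\<rho> ` P) dvd p ^ n"
  proof -
    have "card ((\<lambda>g. \<rho> g \<otimes>\<^bsub>R\<^esub> \<one>\<^bsub>R\<^esub>) ` P) dvd card P"
    proof (rule orbit_card_dvd[OF P, where E = "carrier R" and f = "\<lambda>g e. \<rho> g \<otimes>\<^bsub>R\<^esub> e"])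
      have \<rho>R: "\<rho> g \<in> carrier R" if "g \<in> P" for g using that PH cR by blast
      show "\<rho> g \<otimes>\<^bsub>R\<^esub> e \<in> carrier R" if "g \<in> P" "e \<in> carrier R" for g e
        using \<rho>R[OF that(1)] that(2) by simp
      show "\<rho> \<one> \<otimes>\<^bsub>R\<^esub> e = e" if "e \<in> carrier R" for e using that \<rho>one by (metis R.l_one)
      show "\<rho> (g \<otimes> h) \<otimes>\<^bsub>R\<^esub> e = \<rho> g \<otimes>\<^bsub>R\<^esub> (\<rho> h \<otimes>\<^bsub>R\<^esub> e)"
        if "g \<in> P" "h \<in> P" "e \<in> carrier R" for g h e
      proof -
        have "\<rho> (g \<otimes> h) = \<rho> g \<otimes>\<^bsub>R\<^esub> \<rho> h" using \<rho>mult PH that by (simp add: subset_iff)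
        then show ?thesis using R.m_assoc[OF \<rho>R[OF that(1)] \<rho>R[OF that(2)] that(3)] by simp
      qed
    qed simp
    moreover have "(\<lambda>g. \<rho> g \<otimes>\<^bsub>R\<^esub> \<one>\<^bsub>R\<^esub>) ` P = \<rho> ` P"
      using PH cR by (intro image_cong) auto
    ultimately show ?thesis using card_P by simp
  qed
  then obtain n' where n': "card (\<rho> ` P) = p ^ n'" using p(1) by (auto simp: divides_primepow_nat)
  have fpf: "v = \<zero>\<^bsub>T'\<^esub>"
    if B: "subgroup B R" "B \<subseteq> \<rho> ` P" and Bc: "\<And>x y. x \<in> B \<Longrightarrow> y \<in> B \<Longrightarrow> x \<otimes>\<^bsub>R\<^esub> y = y \<otimes>\<^bsub>R\<^esub> x"
      and nB: "R.normalized_by (\<rho> ` P \<union> \<rho> ` Q) B" and bb: "c \<in> B" "c \<noteq> \<one>\<^bsub>R\<^esub>" and v: "v \<in> carrier T'" "c v = v" for B c v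
  proof (rule ccontr)
    assume v0: "v \<noteq> \<zero>\<^bsub>T'\<^esub>"
    \<comment> \<open>The preimage of \<open>B\<close> in \<open>P\<close>. It need not be abelian,
      but its elements commute as operators on \<open>U\<close>.\<close>
    define B' where "B' = {g \<in> P. \<rho> g \<in> B}"
    have B'H: "g \<in> H" if "g \<in> B'" for g using that PH by (auto simp: B'_def)
    have sB': "subgroup B' G"
    proof (rule subgroupI)
      show "B' \<subseteq> carrier G" using B'H Hc by blast
      have "\<one> \<in> B'" using subgroup.one_closed[OF P] subgroup.one_closed[OF B(1)] \<rho>one by (auto simp: B'_def)
      then show "B' \<noteq> {}" by blast
      show "inv g \<in> B'" if g: "g \<in> B'" for g
        using g subgroup.m_inv_closed[OF P] subgroup.m_inv_closed[OF B(1)] \<rho>inv[OF B'H[OF g]] by (force simp: B'_def)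
      show "g \<otimes> h \<in> B'" if g: "g \<in> B'" and h: "h \<in> B'" for g h
        using g h subgroup.m_closed[OF P] subgroup.m_closed[OF B(1)] \<rho>mult[OF B'H[OF g] B'H[OF h]] by (force simp: B'_def)
    qed
    obtain c' where c': "c' \<in> B'" "c = \<rho> c'" using bb(1) B(2) by (auto simp: B'_def)
    obtain u1 where u1: "u1 \<in> U" "act c' u1 \<noteq> u1" using bb(2) c' \<rho>eq[of c' \<one>] \<rho>one UT by auto
    have "\<exists>v. regular_for P Q U v"
    proof (rule imprimitive_regular[OF p P card_P Q card_Q Q_norm_P U irred sB' _ _ _ c'(1) _ _ _ u1 IH])
      show "B' \<subseteq> P" by (auto simp: B'_def)
      show "normalized_by (P \<union> Q) B'"
        unfolding normalized_by_def
      proof (intro ballI)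
        fix g x assume g: "g \<in> P \<union> Q" and x: "x \<in> B'"
        have xP: "x \<in> P" using x by (simp add: B'_def)
        have gH: "g \<in> H" "inv g \<in> H" using SH[OF g] Hi by auto
        have "\<rho> g \<otimes>\<^bsub>R\<^esub> \<rho> x \<otimes>\<^bsub>R\<^esub> inv\<^bsub>R\<^esub> \<rho> g \<in> B"
          using R.normalized_byD[OF nB, of "\<rho> g" "\<rho> x"] g x by (auto simp: B'_def)
        moreover have "\<rho> g \<otimes>\<^bsub>R\<^esub> \<rho> x \<otimes>\<^bsub>R\<^esub> inv\<^bsub>R\<^esub> \<rho> g = \<rho> (g \<otimes> x \<otimes> inv g)"
          using gH B'H[OF x] Hm \<rho>inv \<rho>mult by simp
        moreover have "g \<otimes> x \<otimes> inv g \<in> P"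
          using g xP normalized_byD[OF Q_norm_P _ xP] subgroup.m_closed[OF P] subgroup.m_inv_closed[OF P] by blast
        ultimately show "g \<otimes> x \<otimes> inv g \<in> B'" by (simp add: B'_def)
      qed
      show "act (x \<otimes> y) u = act (y \<otimes> x) u" if "x \<in> B'" "y \<in> B'" "u \<in> U" for x y u
      proof -
        have "\<rho> (x \<otimes> y) = \<rho> (y \<otimes> x)"
          using Bc[of "\<rho> x" "\<rho> y"] that \<rho>mult B'H by (auto simp: B'_def)
        then show ?thesis using \<rho>eq that(3) by blast
      qed
      show "v \<in> U" "v \<noteq> \<zero>\<^bsub>T\<^esub>" using v v0 by (auto simp: T')
      show "act c' v = v" using v c' \<rho> by (auto simp: T')
    qed
    then show False using neg by blast
  qed
  have fa: "fpf_action R T' (\<lambda>f u. f u) q p n' (\<rho> ` P) (\<rho> ` Q)"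
    by (intro fpf_action.intro fpf_action_axioms.intro lin p n' sub_img P Q PH QH norm_img Q_norm_P fpf)
  obtain w where w: "w \<in> U" "w \<noteq> \<zero>\<^bsub>T\<^esub>" "\<And>x. x \<in> Q \<Longrightarrow> act x w = w"
    using q_group_fixed_vector[OF Q card_Q submod_mono[OF U] U0] by blast
  have "act g u = u" if g: "g \<in> P" "act g w = w" and u: "u \<in> U" for g u
  proof -
    have "\<rho> g = \<one>\<^bsub>R\<^esub>"
      by (rule fpf_action.regular_fixed_vector[OF fa, of w]) (use w g \<rho> T' in auto)
    then have "\<rho> g = \<rho> \<one>" using \<rho>one by simp
    then show ?thesis using \<rho>eq u UT[OF u] by auto
  qed
  then have "regular_for P Q U w" using w by (auto simp: regular_for_def)
  then show False using neg by blast
qed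

text \<open>Since \<open>q\<close> does not divide \<open>card K\<close>, fixed vectors of
  \<open>K\<close> and the kernel of \<open>tr K\<close> meet trivially. If \<open>K\<close> acts
  trivially on \<open>U\<close>, an element acting trivially on \<open>W\<close> does so on
  \<open>U\<close>, and a vector for \<open>W\<close> suffices; otherwise vectors of two proper
  submodules are added.\<close>

lemma reducible_regular:
  fixes p n :: nat
  assumes p: "Factorial_Ring.prime p" "p \<noteq> q"
    and P: "subgroup P G" and card_P: "card P = p ^ n"
    and Q: "subgroup Q G" and Q_norm_P: "normalized_by Q P"
    and U: "submod (P \<union> Q) U" and W: "submod (P \<union> Q) W" "W \<subset> U" "W \<noteq> {\<zero>\<^bsub>T\<^esub>}"
    and IH: "\<And>W. submod (P \<union> Q) W \<Longrightarrow> W \<subset> U \<Longrightarrow> \<exists>v. regular_for P Q W v"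
  shows "\<exists>v. regular_for P Q U v"
proof -
  let ?S = "P \<union> Q"
  have UT: "u \<in> carrier T" if "u \<in> U" for u using submodD(1)[OF U that] .
  have Sc: "x \<in> carrier G" if "x \<in> ?S" for x using that P Q by (auto dest: subgroup.mem_carrier)
  have S_inv: "inv x \<in> ?S" if "x \<in> ?S" for x using that P Q by (auto dest: subgroup.m_inv_closed)
  have conj_P: "g \<otimes> x \<otimes> inv g \<in> P" if "g \<in> ?S" "x \<in> P" for g x
    using that Q_norm_P subgroup.m_closed[OF P] subgroup.m_inv_closed[OF P] by (auto simp: normalized_by_def)
  define K where "K = {g \<in> P. \<forall>u\<in>W. act g u = u}"
  have KP: "K \<subseteq> P" by (auto simp: K_def)
  have Kc: "g \<in> carrier G" if "g \<in> K" for g using that KP Sc by blast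
  have WT: "u \<in> carrier T" if "u \<in> W" for u using submodD(1)[OF W(1) that] .
  have sK: "subgroup K G"
  proof (rule subgroupI)
    show "K \<subseteq> carrier G" using Kc by blast
    show "K \<noteq> {}" using subgroup.one_closed[OF P] WT by (auto simp: K_def)
    show "inv g \<in> K" if "g \<in> K" for g
      using that Kc[OF that] act_inv_fixed WT subgroup.m_inv_closed[OF P] by (auto simp: K_def)
    show "g \<otimes> h \<in> K" if "g \<in> K" "h \<in> K" for g h
      using that Kc act_mult WT subgroup.m_closed[OF P] by (auto simp: K_def)
  qed
  have nK: "g \<otimes> k \<otimes> inv g \<in> K" if g: "g \<in> ?S" and k: "k \<in> K" for g k
  proof -
    have "act (g \<otimes> k \<otimes> inv g) u = u" if u: "u \<in> W" for u
    proof -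
      have "act (inv g) u \<in> W" using submodD(5)[OF W(1) S_inv[OF g] u] .
      then have "act k (act (inv g) u) = act (inv g) u" using k by (auto simp: K_def)
      then show ?thesis using Sc[OF g] Kc[OF k] WT[OF u] by (simp add: act_mult)
    qed
    then show ?thesis using conj_P[OF g] k by (auto simp: K_def)
  qed
  have imK: "(\<lambda>x. g \<otimes> x \<otimes> inv g) ` K = K" if g: "g \<in> ?S" for g
  proof (intro equalityI subsetI)
    fix k assume k: "k \<in> K"
    have "k = g \<otimes> (inv g \<otimes> k \<otimes> inv (inv g)) \<otimes> inv g" using Sc[OF g] Kc[OF k] by (simp add: grp_simps)
    then show "k \<in> (\<lambda>x. g \<otimes> x \<otimes> inv g) ` K" using nK[OF S_inv[OF g] k] by blast
  qed (use nK g in auto)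
  have trK: "act g (tr K u) = tr K (act g u)" if "g \<in> ?S" "u \<in> U" for g u
    using act_tr[OF subgroup.subset[OF sK] Sc[OF that(1)] UT[OF that(2)]] imK[OF that(1)] by simp
  have KU: "tr K u \<in> U" if "u \<in> U" for u using tr_submod[OF U _ that] KP by blast
  have Ksub: "K \<subseteq> carrier G" using Kc by blast
  have "card K dvd p ^ n" using subgroup_card_dvd[OF sK P KP] card_P by simp
  then have ndvd: "\<not> q dvd card K" using p prime_q by (metis dvd_trans prime_dvd_power primes_dvd_imp_eq)
  define F where "F = {u \<in> U. \<forall>g\<in>K. act g u = u}"
  define D where "D = {u \<in> U. tr K u = \<zero>\<^bsub>T\<^esub>}"
  have WF: "W \<subseteq> F" using W(2) by (auto simp: F_def K_def)
  have trF: "tr K u = [card K] \<cdot>\<^bsub>T\<^esub> u" if "u \<in> F" for u using tr_of_fixed[of u K] that UT by (simp add: F_def)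
  have FD: "u = \<zero>\<^bsub>T\<^esub>" if "u \<in> F" "u \<in> D" for u
    using trF[OF that(1)] that(2) coprime_torsion[OF ndvd, of u] UT by (simp add: D_def)
  show ?thesis
  proof (cases "F = U")
    case True
    obtain v where v: "regular_for P Q W v" using IH[OF W(1,2)] by blast
    have vW: "v \<in> W" "\<And>x. x \<in> Q \<Longrightarrow> act x v = v" using v by (simp_all add: regular_for_def)
    have "act g u = u" if "g \<in> P" "act g v = v" "u \<in> U" for g u
    proof -
      have "g \<in> K" using v that by (auto simp: regular_for_def K_def)
      then show ?thesis using that(3) True by (auto simp: F_def)
    qed
    then have "regular_for P Q U v" unfolding regular_for_def using vW W(2) by blast
    then show ?thesis by blast
  next
    case False
    have "inv g \<otimes> k \<otimes> g \<in> K" if "g \<in> ?S" "k \<in> K" for g k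
      using nK[OF S_inv[OF that(1)] that(2)] Sc[OF that(1)] by simp
    then have sF: "submod ?S F"
      unfolding F_def using Sc Ksub by (intro fixed_submod[OF U]) auto
    have sD: "submod ?S D"
    proof (rule submodI)
      show "act g v \<in> D" if "g \<in> ?S" "v \<in> D" for g v
        using that trK[OF that(1), of v] submodD(5)[OF U that(1)] Sc[OF that(1)] by (auto simp: D_def)
    qed (use submodD(2-4)[OF U] UT Ksub in \<open>auto simp: D_def tr_add tr_minus\<close>)
    obtain w where w: "w \<in> W" "w \<noteq> \<zero>\<^bsub>T\<^esub>" using W(3) submodD(2)[OF W(1)] by blast
    have "w \<notin> D" using FD[of w] w WF by blast
    then have "D \<subset> U" using w W(2) by (auto simp: D_def)
    then obtain d where d: "regular_for P Q D d" using IH[OF sD] by blast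
    have "F \<subset> U" using False by (auto simp: F_def)
    then obtain a where a: "regular_for P Q F a" using IH[OF sF] by blast
    have aF: "a \<in> F" "a \<in> U" "a \<in> carrier T" and dD: "d \<in> D" "d \<in> U" "d \<in> carrier T"
      using a d UT by (auto simp: regular_for_def F_def D_def)
    have "act x (a \<oplus>\<^bsub>T\<^esub> d) = a \<oplus>\<^bsub>T\<^esub> d" if "x \<in> Q" for x
      using that a d aF dD Sc[of x] by (simp add: act_add regular_for_def)
    moreover have "a \<oplus>\<^bsub>T\<^esub> d \<in> U" using submodD(3)[OF U] aF dD by blast
    moreover have "act g u = u" if g: "g \<in> P" "act g (a \<oplus>\<^bsub>T\<^esub> d) = a \<oplus>\<^bsub>T\<^esub> d" and u: "u \<in> U" for g u
    proof -
      have gS: "g \<in> ?S" using g by simp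
      note gc = Sc[OF gS]
      have uT: "u \<in> carrier T" using UT[OF u] .
      have ga: "act g a \<in> F" "act g d \<in> D" using submodD(5)[OF sF gS aF(1)] submodD(5)[OF sD gS dD(1)] by auto
      have gaT: "act g a \<in> carrier T" "act g d \<in> carrier T" using gc aF dD by auto
      \<comment> \<open>The difference \<open>g a - a\<close> equals \<open>d - g d\<close>, so it
        lies in both \<open>F\<close> and \<open>D\<close> and is zero; thus \<open>g\<close> fixes
        \<open>a\<close> and \<open>d\<close> separately.\<close>
      define t where "t = act g a \<oplus>\<^bsub>T\<^esub> \<ominus>\<^bsub>T\<^esub> a"
      have eq: "act g a \<oplus>\<^bsub>T\<^esub> act g d = a \<oplus>\<^bsub>T\<^esub> d" using g gc aF dD by (simp add: act_add)
      have t2: "t = d \<oplus>\<^bsub>T\<^esub> \<ominus>\<^bsub>T\<^esub> act g d"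
      proof -
        have "act g a = (a \<oplus>\<^bsub>T\<^esub> d) \<oplus>\<^bsub>T\<^esub> \<ominus>\<^bsub>T\<^esub> act g d" using eq gaT aF dD
          by (metis T.add.inv_solve_right' T.add.m_closed)
        then have "t = (a \<oplus>\<^bsub>T\<^esub> \<ominus>\<^bsub>T\<^esub> a) \<oplus>\<^bsub>T\<^esub> (d \<oplus>\<^bsub>T\<^esub> \<ominus>\<^bsub>T\<^esub> act g d)"
          unfolding t_def using gaT aF dD by (simp add: T.a_ac)
        then show ?thesis using gaT aF dD by (simp add: T.r_neg)
      qed
      have "t \<in> F" unfolding t_def using ga aF submodD(3,4)[OF sF] by blast
      moreover have "t \<in> D" unfolding t2 using ga dD submodD(3,4)[OF sD] by blast
      ultimately have t0: "t = \<zero>\<^bsub>T\<^esub>" using FD by blast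
      then have "act g a = a" unfolding t_def using gaT aF by (metis T.minus_minus T.minus_equality T.add.inv_closed)
      moreover have "act g d = d" using t0 unfolding t2 using gaT dD
        by (metis T.minus_minus T.minus_equality T.add.inv_closed)
      ultimately have gF: "\<And>u. u \<in> F \<Longrightarrow> act g u = u" and gD: "\<And>u. u \<in> D \<Longrightarrow> act g u = u"
        using a d g(1) by (auto simp: regular_for_def)
      \<comment> \<open>Instead of splitting \<open>u\<close> itself, its multiple by
        \<open>card K\<close> is split as \<open>s + tr K u\<close> with \<open>s\<close> in
        \<open>D\<close> and \<open>tr K u\<close> in \<open>F\<close>; the factor is cancelled at
        the end.\<close>
      let ?k = "[card K] \<cdot>\<^bsub>T\<^esub> u"
      have kU: "?k \<in> U" using submod_add_pow[OF U u] .
      have trFu: "tr K u \<in> F" using KU[OF u] tr_fixed[OF sK _ uT] by (auto simp: F_def)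
      have trT: "tr K u \<in> carrier T" "?k \<in> carrier T" using UT KU[OF u] kU by auto
      define s where "s = ?k \<oplus>\<^bsub>T\<^esub> \<ominus>\<^bsub>T\<^esub> tr K u"
      have "tr K s = \<zero>\<^bsub>T\<^esub>"
        unfolding s_def using Ksub trT uT trF[OF trFu] by (simp add: tr_add tr_minus tr_add_pow T.r_neg)
      moreover have "s \<in> U" unfolding s_def using kU KU[OF u] submodD(3,4)[OF U] by blast
      ultimately have "s \<in> D" by (simp add: D_def)
      then have gs: "act g s = s" using gD by blast
      have ks: "?k = s \<oplus>\<^bsub>T\<^esub> tr K u" unfolding s_def using trT by (simp add: T.a_assoc T.l_neg)
      have sT: "s \<in> carrier T" unfolding s_def using trT by simp
      have "act g ?k = ?k" unfolding ks using gc sT trT gs gF[OF trFu] by (simp add: act_add)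
      then have "[card K] \<cdot>\<^bsub>T\<^esub> act g u = ?k" using act_add_pow[OF gc uT] by simp
      then have "[card K] \<cdot>\<^bsub>T\<^esub> (act g u \<oplus>\<^bsub>T\<^esub> \<ominus>\<^bsub>T\<^esub> u) = \<zero>\<^bsub>T\<^esub>"
        using gc uT by (simp add: T.add.nat_pow_distrib T.add.nat_pow_inv T.r_neg)
      then have "act g u \<oplus>\<^bsub>T\<^esub> \<ominus>\<^bsub>T\<^esub> u = \<zero>\<^bsub>T\<^esub>" using coprime_torsion[OF ndvd] gc uT by simp
      then show ?thesis using gc uT by (metis T.minus_minus T.minus_equality T.add.inv_closed act_closed)
    qed
    ultimately have "regular_for P Q U (a \<oplus>\<^bsub>T\<^esub> d)" by (auto simp: regular_for_def)
    then show ?thesis by blast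
  qed
qed

text \<open>The induction generalizes over \<open>P\<close> and \<open>Q\<close> with their
  exponents, since block stabilizers replace them by subgroups; the ambient group and module stay
  the same.\<close>

theorem regular_vector_exists:
  fixes p n b :: nat
  assumes p: "Factorial_Ring.prime p" "odd p" "p \<noteq> q" "odd q"
    and "subgroup P G" "card P = p ^ n" "subgroup Q G" "card Q = q ^ b" "normalized_by Q P" "submod (P \<union> Q) U"
  shows "\<exists>v. regular_for P Q U v"
  using assms(5-)
proof (induction "card U" arbitrary: U P Q n b rule: less_induct)
  case less
  note U = less.prems(6)
  have IH: "\<exists>v. regular_for P' Q' W v"
    if P': "subgroup P' G" "P' \<subseteq> P" and Q': "subgroup Q' G" "Q' \<subseteq> Q" and nrm: "normalized_by Q' P'"
      and W: "submod (P' \<union> Q') W" "W \<subset> U" for P' Q' W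
  proof -
    have "card W < card U" using psubset_card_mono[OF submod_finite[OF U] W(2)] .
    moreover obtain i where "card P' = p ^ i"
      using subgroup_card_dvd[OF P'(1) less.prems(1) P'(2)] less.prems(2) p(1) by (auto simp: divides_primepow_nat)
    moreover obtain j where "card Q' = q ^ j"
      using subgroup_card_dvd[OF Q'(1) less.prems(3) Q'(2)] less.prems(4) prime_q by (auto simp: divides_primepow_nat)
    ultimately show ?thesis using less.hyps P'(1) Q'(1) nrm W(1) by blast
  qed
  show ?case
  proof (cases "U = {\<zero>\<^bsub>T\<^esub>}")
    case True
    have "regular_for P Q U \<zero>\<^bsub>T\<^esub>"
      using True less.prems(1,3) by (auto simp: regular_for_def dest: subgroup.mem_carrier)
    then show ?thesis by blast
  next
    case U0: False
    show ?thesis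
    proof (cases "\<exists>W. submod (P \<union> Q) W \<and> W \<subset> U \<and> W \<noteq> {\<zero>\<^bsub>T\<^esub>}")
      case True
      then obtain W where W: "submod (P \<union> Q) W" "W \<subset> U" "W \<noteq> {\<zero>\<^bsub>T\<^esub>}" by blast
      show ?thesis
        by (rule reducible_regular[OF p(1,3) less.prems(1-3,5,6) W])
          (use IH[OF less.prems(1) order_refl less.prems(3) order_refl less.prems(5)] in blast)
    next
      case False
      then show ?thesis
        by (intro irreducible_regular[OF p less.prems(1-6) U0 _ IH]) blast+
    qed
  qed
qed

end

lemma fin_dim_module_finite:
  assumes M: "module R M" and "finite (carrier R)" "fin_dim_module R M"
  shows "finite (carrier M)"
proof -
  interpret module R M by (rule M)
  obtain B where B: "finite B" "B \<subseteq> carrier M"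
    and span: "\<And>v. v \<in> carrier M \<Longrightarrow> \<exists>c. c \<in> B \<rightarrow> carrier R \<and> v = (\<Oplus>\<^bsub>M\<^esub>s\<in>B. c s \<odot>\<^bsub>M\<^esub> s)"
    using assms(3) by (auto simp: fin_dim_module_def)
  have "carrier M \<subseteq> (\<lambda>c. \<Oplus>\<^bsub>M\<^esub>s\<in>B. c s \<odot>\<^bsub>M\<^esub> s) ` (B \<rightarrow>\<^sub>E carrier R)"
  proof
    fix v assume "v \<in> carrier M"
    then obtain c where c: "c \<in> B \<rightarrow> carrier R" "v = (\<Oplus>\<^bsub>M\<^esub>s\<in>B. c s \<odot>\<^bsub>M\<^esub> s)" using span by blast
    have "v = (\<Oplus>\<^bsub>M\<^esub>s\<in>B. restrict c B s \<odot>\<^bsub>M\<^esub> s)"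
      unfolding c(2) using c(1) B(2) by (intro M.finsum_cong') (auto simp: Pi_iff subset_iff)
    moreover have "restrict c B \<in> B \<rightarrow>\<^sub>E carrier R" using c(1) by auto
    ultimately show "v \<in> (\<lambda>c. \<Oplus>\<^bsub>M\<^esub>s\<in>B. c s \<odot>\<^bsub>M\<^esub> s) ` (B \<rightarrow>\<^sub>E carrier R)" by blast
  qed
  moreover have "finite (B \<rightarrow>\<^sub>E carrier R)" using B(1) assms(2) by (intro finite_PiE) auto
  ultimately show ?thesis using finite_surj by blast
qed

lemma residue_module_torsion:
  fixes q :: nat
  assumes M: "module (residue_ring (int q)) M" and q: "q > 1" and v: "v \<in> carrier M"
  shows "[q] \<cdot>\<^bsub>M\<^esub> v = \<zero>\<^bsub>M\<^esub>"
proof -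
  interpret module "residue_ring (int q)" M by (rule M)
  have "[k] \<cdot>\<^bsub>M\<^esub> v = (int k mod int q) \<odot>\<^bsub>M\<^esub> v" for k :: nat
  proof (induction k)
    case 0
    then show ?case using smult_l_null[OF v] by (simp add: residue_ring_def)
  next
    case (Suc k)
    have "(int (Suc k) mod int q) \<odot>\<^bsub>M\<^esub> v = ((int k mod int q) \<oplus>\<^bsub>residue_ring (int q)\<^esub> \<one>\<^bsub>residue_ring (int q)\<^esub>) \<odot>\<^bsub>M\<^esub> v"
      using q by (simp add: residue_ring_def mod_simps add.commute)
    also have "\<dots> = (int k mod int q) \<odot>\<^bsub>M\<^esub> v \<oplus>\<^bsub>M\<^esub> \<one>\<^bsub>residue_ring (int q)\<^esub> \<odot>\<^bsub>M\<^esub> v"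
      using v q by (intro smult_l_distr) (auto simp: residue_ring_def)
    finally show ?case using Suc v by (simp add: M.add.nat_pow_Suc)
  qed
  from this[of q] show ?thesis using smult_l_null[OF v] by (simp add: residue_ring_def)
qed

theorem theorem5p1:
  fixes p q :: nat
    and G :: "('g, 'e) monoid_scheme"
    and P Q :: "'g set"
    and T :: "(int, 'v, 'd) module_scheme"
    and act :: "'v \<Rightarrow> 'g \<Rightarrow> 'v"
  assumes "Factorial_Ring.prime p" and "Factorial_Ring.prime q" and "odd p" and "odd q" and "p \<noteq> q"
    and "group G" and "finite (carrier G)"
    and "P \<lhd> G" and "\<exists>a. card P = p ^ a"
    and "subgroup Q G" and "\<exists>b. card Q = q ^ b"
    and "P \<inter> Q = {\<one>\<^bsub>G\<^esub>}" and "Q <#>\<^bsub>G\<^esub> P = carrier G"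
    and "module (residue_ring (int q)) T"
    and "fin_dim_module (residue_ring (int q)) T"
    and "right_linear_action G (residue_ring (int q)) T act"
    and "acts_faithfully G P T act"
  shows "\<exists>\<tau>\<in>carrier T. stabilizer_in G act \<tau> = Q"
proof -
  interpret G: group G by fact
  interpret T: module "residue_ring (int q)" T by fact
  have q1: "q > 1" using assms(2) by (rule prime_gt_1_nat)
  have act: "\<And>g v. g \<in> carrier G \<Longrightarrow> v \<in> carrier T \<Longrightarrow> act v g \<in> carrier T"
    "\<And>v. v \<in> carrier T \<Longrightarrow> act v \<one>\<^bsub>G\<^esub> = v"
    "\<And>g h v. g \<in> carrier G \<Longrightarrow> h \<in> carrier G \<Longrightarrow> v \<in> carrier T \<Longrightarrow> act v (g \<otimes>\<^bsub>G\<^esub> h) = act (act v g) h"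
    "\<And>g v w. g \<in> carrier G \<Longrightarrow> v \<in> carrier T \<Longrightarrow> w \<in> carrier T \<Longrightarrow> act (v \<oplus>\<^bsub>T\<^esub> w) g = act v g \<oplus>\<^bsub>T\<^esub> act w g"
    using assms(16) by (auto simp: right_linear_action_def)
  have sP: "subgroup P G" using assms(8) by (rule normal_imp_subgroup)
  note Pc = subgroup.mem_carrier[OF sP] and Qc = subgroup.mem_carrier[OF assms(10)]
  have finT: "finite (carrier T)"
    using fin_dim_module_finite[OF assms(14) _ assms(15)] by (simp add: residue_ring_def)
  \<comment> \<open>Inversion turns the right action into a left one. Stabilizers and fixed vectors
    of subgroups are unaffected.\<close>
  interpret L: lin_action G T "\<lambda>g v. act v (inv\<^bsub>G\<^esub> g)" q
    by (intro lin_action.intro lin_action_axioms.intro assms(6) T.M.abelian_group_axioms assms(7) finT assms(2))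
      (use residue_module_torsion[OF assms(14) q1] act in \<open>auto simp: G.inv_mult_group\<close>)
  obtain a where a: "card P = p ^ a" using assms(9) by blast
  obtain b where b: "card Q = q ^ b" using assms(11) by blast
  have nP: "G.normalized_by Q P"
    using normal.inv_op_closed2[OF assms(8)] Qc by (auto simp: G.normalized_by_def)
  have "L.submod (P \<union> Q) (carrier T)"
    by (rule L.submodI) (use act Pc Qc in auto)
  from L.regular_vector_exists[OF assms(1,3,5,4) sP a assms(10) b nP this]
  obtain v where v: "v \<in> carrier T" and vQ: "\<And>x. x \<in> Q \<Longrightarrow> act v (inv\<^bsub>G\<^esub> x) = v"
    and vP: "\<And>g u. g \<in> P \<Longrightarrow> act v (inv\<^bsub>G\<^esub> g) = v \<Longrightarrow> u \<in> carrier T \<Longrightarrow> act u (inv\<^bsub>G\<^esub> g) = u"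
    by (auto simp: L.regular_for_def)
  have vQ': "act v x = v" if "x \<in> Q" for x
    using vQ[OF subgroup.m_inv_closed[OF assms(10) that]] Qc[OF that] by simp
  have vP': "g = \<one>\<^bsub>G\<^esub>" if "g \<in> P" "act v g = v" for g
  proof -
    have "act u g = u" if "u \<in> carrier T" for u
      using vP[OF subgroup.m_inv_closed[OF sP \<open>g \<in> P\<close>] _ that] \<open>act v g = v\<close> Pc[OF \<open>g \<in> P\<close>] by simp
    then show ?thesis using assms(17) that(1) by (auto simp: acts_faithfully_def)
  qed
  have "stabilizer_in G act v = Q"
  proof (intro equalityI subsetI)
    fix g assume "g \<in> stabilizer_in G act v"
    then have g: "g \<in> carrier G" "act v g = v" by (auto simp: stabilizer_in_def)
    then have "g \<in> Q <#>\<^bsub>G\<^esub> P" using assms(13) by simp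
    \<comment> \<open>In \<open>g = x y\<close> the factor \<open>x\<close> acts first on the right
      and fixes \<open>v\<close>, so \<open>y\<close> fixes \<open>v\<close> as well.\<close>
    then obtain x y where xy: "x \<in> Q" "y \<in> P" "g = x \<otimes>\<^bsub>G\<^esub> y" by (auto simp: set_mult_def)
    then have "act v y = v" using g act(3)[OF Qc[OF xy(1)] Pc[OF xy(2)] v] vQ'[OF xy(1)] by simp
    then have "y = \<one>\<^bsub>G\<^esub>" using vP' xy by blast
    then show "g \<in> Q" using xy Qc by simp
  qed (use vQ' Qc in \<open>auto simp: stabilizer_in_def\<close>)
  then show ?thesis using v by blast
qed

end
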